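(* Let $n\ge 2$ and suppose that $\Omega\subset\mathbb{H}^{n+1}$ is a bounded weakly convex domain with smooth boundary $\partial\Omega$. Then $$\mathcal{A}_{n-1}(\Omega)\ \ge\ \psi_n(|\Omega|),$$ where $|\Omega|$ is the volume of $\Omega$ and $\psi_n:[0,\infty)\to\mathbb{R}$ is the strictly increasing function such that equality is achieved for geodesic balls (that is, $\psi_n(|B|)=\mathcal{A}_{n-1}(B)$ for every geodesic ball $B\subset \mathbb{H}^{n+1}$). Moreover, equality holds if and only if $\Omega$ is a geodesic ball.
   Context: $\mathbb{H}^{n+1}$ is the hyperbolic space of constant sectional curvature $-1$. A domain with smooth boundary is weakly convex if all principal curvatures of its boundary (with respect to the unit outward normal) satisfy $\kappa_i\ge 0$. Quermassintegrals. For a compact convex set $\Omega\subset\mathbb{H}^{n+1}$ with nonempty interior (for a domain, use its closure) and $k=0,\dots,n-1$, $$\mathcal{A}_k(\Omega)=(n-k)\binom{n}{k}\frac{\omega_k\cdots\omega_0}{\omega_{n-1}\cdots\omega_{n-k-1}}\int_{\mathcal{L}_{k+1}}\chi(L_{k+1}\cap\Omega)\,dL_{k+1},$$ where $\omega_k=|\mathbb{S}^k|$, $\mathcal{L}_{k+1}$ is the space of $(k+1)$-dimensional totally geodesic subspaces of $\mathbb{H}^{n+1}$, $\chi=1$ if $L_{k+1}\cap\Omega\ne\emptyset$ and $\chi=0$ otherwise, and $dL_{k+1}$ is the natural isometry-invariant measure. Also $\mathcal{A}_{-1}(\Omega)=|\Omega|$ and $\mathcal{A}_0(\Omega)=|\partial\Omega|$.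 In particular $\mathcal{A}_{n-1}(\Omega)=n\int_{\mathcal{L}_n}\chi(L_n\cap\Omega)\,dL_n$, where, describing a totally geodesic hyperplane $L_n$ by its orthogonal geodesic line $L_1[o]$ through a fixed origin $o$ and the intersection point on that line, $dL_n=\cosh^{n}(\rho)\,d\mu_1\,dL_1[o]$, with $d\mu_1$ the length element on $L_1[o]$, $\rho$ the distance to $o$, and $dL_1[o]$ the volume element on the Grassmannian of lines through $o$ (total measure $\omega_n/2$). Equivalently, when $\partial\Omega$ is smooth, with $\sigma_k$ the $k$th elementary symmetric function of the principal curvatures of $\partial\Omega$: $\mathcal{A}_1(\Omega)=\int_{\partial\Omega}\sigma_1\,d\mu-n\mathcal{A}_{-1}(\Omega)$ and $\mathcal{A}_k(\Omega)=\int_{\partial\Omega}\sigma_k\,d\mu-\frac{n-k+1}{k-1}\mathcal{A}_{k-2}(\Omega)$ for $k=2,\dots,n$. *)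

theory Defs
  imports "HOL-Analysis.Analysis"
begin

section \<open>Smooth maps\<close>

text \<open>Intended for open \<open>S\<close> only, where \<open>at x\<close> and \<open>at x within S\<close> agree for \<open>x \<in> S\<close>.\<close>

fun Ck_on :: "nat \<Rightarrow> ('a::real_normed_vector \<Rightarrow> 'b::real_normed_vector) \<Rightarrow> 'a set \<Rightarrow> bool" where
  "Ck_on 0 f S \<longleftrightarrow> continuous_on S f"
| "Ck_on (Suc k) f S \<longleftrightarrow>
     (\<forall>x\<in>S. f differentiable (at x)) \<and> (\<forall>v. Ck_on k (\<lambda>x. frechet_derivative f (at x) v) S)"

definition smooth_on :: "('a::real_normed_vector \<Rightarrow> 'b::real_normed_vector) \<Rightarrow> 'a set \<Rightarrow> bool" where
  "smooth_on f S \<longleftrightarrow> (\<forall>k. Ck_on k f S)"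


section \<open>Hyperbolic space\<close>

text \<open>
  Hyperbolic space of dimension \<open>DIM('a)\<close> is the upper sheet of the hyperboloid
  \<open>\<langle>p, p\<rangle> = -1\<close> in the Minkowski space \<open>'a \<times> real\<close>, with the Riemannian metric induced by the
  Minkowski form; it has constant curvature \<open>-1\<close>. The tangent space at \<open>p\<close> is the
  Minkowski-orthogonal complement of \<open>p\<close>, on which the form is positive definite.
\<close>

definition minkowski :: "'a::euclidean_space \<times> real \<Rightarrow> 'a \<times> real \<Rightarrow> real" where
  "minkowski p q = fst p \<bullet> fst q - snd p * snd q"

definition hyp_space :: "('a::euclidean_space \<times> real) set" where
  "hyp_space = {p. minkowski p p = -1 \<and> snd p > 0}"

definition hyp_dist :: "'a::euclidean_space \<times> real \<Rightarrow> 'a \<times> real \<Rightarrow> real" where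
  "hyp_dist p q = arcosh (- minkowski p q)"

definition hyp_ball :: "'a::euclidean_space \<times> real \<Rightarrow> real \<Rightarrow> ('a \<times> real) set" where
  "hyp_ball p r = {q \<in> hyp_space. hyp_dist p q < r}"

definition is_geodesic_ball :: "('a::euclidean_space \<times> real) set \<Rightarrow> bool" where
  "is_geodesic_ball B \<longleftrightarrow> (\<exists>p\<in>hyp_space. \<exists>r>0. B = hyp_ball p r)"

definition hyp_bounded :: "('a::euclidean_space \<times> real) set \<Rightarrow> bool" where
  "hyp_bounded \<Omega> \<longleftrightarrow> (\<exists>p\<in>hyp_space. \<exists>r. \<forall>q\<in>\<Omega>. hyp_dist p q \<le> r)"

text \<open>The geodesic starting at \<open>p\<close> with unit initial velocity \<open>v\<close>.\<close>

definition hyp_geodesic :: "'a::euclidean_space \<times> real \<Rightarrow> 'a \<times> real \<Rightarrow> real \<Rightarrow> 'a \<times> real" where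
  "hyp_geodesic p v t = cosh t *\<^sub>R p + sinh t *\<^sub>R v"

text \<open>
  The hyperboloid is the graph of \<open>x \<mapsto> sqrt (1 + |x|\<^sup>2)\<close> over \<open>'a\<close>. In the coordinate \<open>x\<close> the
  metric is \<open>I - x x\<^sup>T / (1 + |x|\<^sup>2)\<close>, with determinant \<open>1 / (1 + |x|\<^sup>2)\<close>; the square root of this
  is the density of the Riemannian volume.
\<close>

definition hyp_volume_measure :: "('a::euclidean_space \<times> real) measure" where
  "hyp_volume_measure =
     distr (density lborel (\<lambda>x::'a. ennreal (1 / sqrt (1 + (norm x)\<^sup>2)))) borel
       (\<lambda>x. (x, sqrt (1 + (norm x)\<^sup>2)))"

definition hyp_volume :: "('a::euclidean_space \<times> real) set \<Rightarrow> real" where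
  "hyp_volume \<Omega> = measure hyp_volume_measure \<Omega>"


section \<open>Weakly convex domains with smooth boundary\<close>

definition hyp_domain :: "('a::euclidean_space \<times> real) set \<Rightarrow> bool" where
  "hyp_domain \<Omega> \<longleftrightarrow> openin (top_of_set hyp_space) \<Omega> \<and> connected \<Omega> \<and> \<Omega> \<noteq> {}"

text \<open>
  The boundary is taken relative to hyperbolic space, since the \<^const>\<open>frontier\<close> in the ambient
  Minkowski space would be the whole closure.
\<close>

definition hyp_boundary :: "('a::euclidean_space \<times> real) set \<Rightarrow> ('a \<times> real) set" where
  "hyp_boundary \<Omega> = top_of_set hyp_space frontier_of \<Omega>"

text \<open>
  Locally the domain is a sublevel set of a smooth function whose differential does not vanish
  on the tangent space of hyperbolic space.
\<close>

definition smooth_boundary :: "('a::euclidean_space \<times> real) set \<Rightarrow> bool" where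
  "smooth_boundary \<Omega> \<longleftrightarrow>
     (\<forall>p\<in>hyp_boundary \<Omega>. \<exists>U f. open U \<and> p \<in> U \<and> smooth_on f U \<and>
        \<Omega> \<inter> U = {q \<in> hyp_space \<inter> U. f q < (0::real)} \<and>
        hyp_boundary \<Omega> \<inter> U = {q \<in> hyp_space \<inter> U. f q = 0} \<and>
        (\<exists>v. minkowski v p = 0 \<and> frechet_derivative f (at p) v \<noteq> 0))"

definition smooth_curve_through ::
  "'b::real_normed_vector set \<Rightarrow> 'b \<Rightarrow> 'b \<Rightarrow> (real \<Rightarrow> 'b) \<Rightarrow> bool" where
  "smooth_curve_through M p v c \<longleftrightarrow>
     (\<exists>\<epsilon>>0. smooth_on c {-\<epsilon><..<\<epsilon>} \<and> c ` {-\<epsilon><..<\<epsilon>} \<subseteq> M) \<and>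
     c 0 = p \<and> (c has_vector_derivative v) (at 0)"

definition tangent_vectors :: "'b::real_normed_vector set \<Rightarrow> 'b \<Rightarrow> 'b set" where
  "tangent_vectors M p = {v. \<exists>c. smooth_curve_through M p v c}"

definition is_outward_unit_normal ::
  "('a::euclidean_space \<times> real) set \<Rightarrow> 'a \<times> real \<Rightarrow> 'a \<times> real \<Rightarrow> bool" where
  "is_outward_unit_normal \<Omega> p \<nu> \<longleftrightarrow>
     minkowski \<nu> p = 0 \<and> minkowski \<nu> \<nu> = 1 \<and>
     (\<forall>v\<in>tangent_vectors (hyp_boundary \<Omega>) p. minkowski \<nu> v = 0) \<and>
     (\<exists>\<epsilon>>0. \<forall>t\<in>{0<..<\<epsilon>}. hyp_geodesic p \<nu> t \<notin> closure \<Omega>)"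

definition outward_unit_normal ::
  "('a::euclidean_space \<times> real) set \<Rightarrow> 'a \<times> real \<Rightarrow> 'a \<times> real" where
  "outward_unit_normal \<Omega> p = (THE \<nu>. is_outward_unit_normal \<Omega> p \<nu>)"

text \<open>
  The shape operator \<open>v \<mapsto> \<nabla>\<^sub>v \<nu>\<close>. The Levi-Civita connection of the hyperboloid is the flat
  derivative followed by the projection \<open>w \<mapsto> w + \<langle>w, p\<rangle> p\<close> onto the tangent space at \<open>p\<close>.
  With this sign, geodesic spheres of radius \<open>r\<close> have principal curvatures \<open>coth r > 0\<close>.
\<close>

definition shape_operator ::
  "('a::euclidean_space \<times> real) set \<Rightarrow> 'a \<times> real \<Rightarrow> 'a \<times> real \<Rightarrow> 'a \<times> real" where
  "shape_operator \<Omega> p v =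
     (THE w. \<exists>c w'. smooth_curve_through (hyp_boundary \<Omega>) p v c \<and>
        ((\<lambda>s. outward_unit_normal \<Omega> (c s)) has_vector_derivative w') (at 0) \<and>
        w = w' + minkowski w' p *\<^sub>R p)"

definition principal_curvatures ::
  "('a::euclidean_space \<times> real) set \<Rightarrow> 'a \<times> real \<Rightarrow> real set" where
  "principal_curvatures \<Omega> p =
     {\<kappa>. \<exists>v\<in>tangent_vectors (hyp_boundary \<Omega>) p. v \<noteq> 0 \<and> shape_operator \<Omega> p v = \<kappa> *\<^sub>R v}"

definition weakly_convex :: "('a::euclidean_space \<times> real) set \<Rightarrow> bool" where
  "weakly_convex \<Omega> \<longleftrightarrow> (\<forall>p\<in>hyp_boundary \<Omega>. \<forall>\<kappa>\<in>principal_curvatures \<Omega> p. \<kappa> \<ge> 0)"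


section \<open>The quermassintegral of hyperplanes\<close>

text \<open>
  The surface measure of the unit sphere as cone measure: \<open>DIM('a)\<close> times the Lebesgue measure
  of the part of the unit ball lying radially below the given set.
\<close>

definition sphere_measure :: "'a::euclidean_space measure" where
  "sphere_measure =
     scale_measure (of_nat DIM('a)) (distr (restrict_space lborel (ball 0 1)) borel sgn)"

text \<open>
  The totally geodesic hyperplane orthogonal, at signed distance \<open>\<rho>\<close> from the origin \<open>(0, 1)\<close>,
  to the geodesic \<open>hyp_geodesic (0, 1) (u, 0)\<close> (with \<open>|u| = 1\<close>), whose velocity there is
  \<open>(cosh \<rho> u, sinh \<rho>)\<close>.
\<close>

definition hyp_hyperplane :: "'a::euclidean_space \<Rightarrow> real \<Rightarrow> ('a \<times> real) set" where
  "hyp_hyperplane u \<rho> = {p \<in> hyp_space. minkowski p (cosh \<rho> *\<^sub>R u, sinh \<rho>) = 0}"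

text \<open>
  \<open>A\<^sub>n\<^sub>-\<^sub>1(\<Omega>) = n \<integral> \<chi>(L\<^sub>n \<inter> closure \<Omega>) dL\<^sub>n\<close> with \<open>dL\<^sub>n = cosh\<^sup>n \<rho> d\<mu>\<^sub>1 dL\<^sub>1[o]\<close>, in hyperbolic
  space of dimension \<open>n + 1\<close>. The factor \<open>1/2\<close> accounts for \<open>u\<close> and \<open>-u\<close> spanning the same line
  through the origin, so that these lines have total measure \<open>\<omega>\<^sub>n / 2\<close>.
\<close>

definition quermass_hyperplanes :: "nat \<Rightarrow> ('a::euclidean_space \<times> real) set \<Rightarrow> real" where
  "quermass_hyperplanes n \<Omega> =
     real n * (1 / 2 * (LINT u|sphere_measure. LINT \<rho>|lborel.
       of_bool (hyp_hyperplane u \<rho> \<inter> closure \<Omega> \<noteq> {}) * cosh \<rho> ^ n))"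

text \<open>
  The two conditions determine \<open>\<psi>\<close> on the positive half-line, since the volumes of geodesic balls
  exhaust it.
\<close>

definition is_ball_profile :: "'a::euclidean_space itself \<Rightarrow> nat \<Rightarrow> (real \<Rightarrow> real) \<Rightarrow> bool" where
  "is_ball_profile _ n \<psi> \<longleftrightarrow>
     strict_mono_on {0..} \<psi> \<and>
     (\<forall>B :: ('a \<times> real) set. is_geodesic_ball B \<longrightarrow>
        \<psi> (hyp_volume B) = quermass_hyperplanes n B)"

end

theory Submission
  imports Defs "HOL-Complex_Analysis.Great_Picard"
begin

text \<open>
  A hyperplane of hyperbolic space is the orthogonal complement of a unit spacelike vector \<open>w\<close>, and
  it cuts a connected set \<open>K\<close> properly iff \<open>w\<close> takes both signs on \<open>K\<close>. The quermassintegral is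
  therefore, up to a constant, the Lorentz-invariant measure of the set of such \<open>w\<close>, which makes
  sense for every compact \<open>K\<close>. Two-point symmetrization with respect to a hyperplane preserves the
  volume and does not increase this measure. By compactness, among the sets obtained one may choose
  one that meets the centred ball of the given volume in maximal volume, and this set must
  contain the ball.

  For equality, let \<open>z\<close> and \<open>z'\<close> be boundary points with outer normals \<open>w\<close> and \<open>w'\<close> of supporting
  hyperplanes. If the reflection exchanging \<open>z\<close> and \<open>z'\<close> does not exchange \<open>w\<close> and \<open>w'\<close>, the
  symmetrized set can be enlarged without increasing its measure. Hence \<open>w - w'\<close> is always a
  multiple of \<open>z - z'\<close>; as three points of the hyperboloid are never collinear, \<open>w = c z + a\<close> with
  constant \<open>c\<close> and \<open>a\<close>, so that all these points lie on one sphere.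
\<close>

section \<open>Minkowski space\<close>

text \<open>Symmetrization destroys convexity and connectedness, so the quantity to be controlled
  must make sense for arbitrary compact sets. Asking for points strictly on both sides achieves
  this: of two hyperplanes exchanged by the reflection, no more have this property after
  symmetrization than before. Invariance of both measures needs no calculus on manifolds. Each is a
  Lebesgue integral over Minkowski space in which the vector enters the weight only through
  \<open>q \<star> q\<close>, and Lebesgue measure is preserved by linear involutions. Compactness
  rests on opposite semicontinuities under Hausdorff limits: volume cannot drop in the limit, the
  crossing measure cannot jump up. For equality the inequality is turned around: the closure of the
  domain has the largest volume for its crossing measure, so a contradiction only requires adding
  volume without adding crossings. The relation \<open>w = c z + a\<close> describes a sphere only
  if \<open>a\<close> is timelike; this follows from \<open>a \<star> w = 1\<close>, evaluated in
  well chosen directions.\<close>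

notation minkowski (infixl "\<star>" 70)

lemma minkowski_eq_inner: "p \<star> q = p \<bullet> (fst q, - snd q)"
  by (simp add: minkowski_def inner_prod_def)

interpretation minkowski: bounded_bilinear minkowski
proof -
  have "bounded_linear (\<lambda>q :: 'a \<times> real. (fst q, - snd q))"
    by (intro bounded_linear_Pair bounded_linear_fst bounded_linear_minus bounded_linear_snd)
  from bounded_bilinear.comp[OF bounded_bilinear_inner bounded_linear_ident this]
  show "bounded_bilinear (minkowski :: 'a \<times> real \<Rightarrow> _)"
    by (simp add: minkowski_eq_inner[abs_def])
qed

lemmas minkowski_simps = minkowski.add_left minkowski.add_right minkowski.diff_left
  minkowski.diff_right minkowski.scaleR_left minkowski.scaleR_right
  minkowski.minus_left minkowski.minus_right minkowski.zero_left minkowski.zero_right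

lemma minkowski_commute: "p \<star> q = q \<star> p"
  by (simp add: minkowski_def inner_commute mult.commute)

lemma continuous_on_minkowski [continuous_intros]:
  "continuous_on S f \<Longrightarrow> continuous_on S g \<Longrightarrow> continuous_on S (\<lambda>x. f x \<star> g x)"
  by (rule minkowski.continuous_on)

lemma borel_measurable_minkowski [measurable]:
  assumes "f \<in> borel_measurable M" "g \<in> borel_measurable M"
  shows "(\<lambda>x. f x \<star> g x) \<in> borel_measurable M"
  by (rule borel_measurable_continuous_Pair[OF assms])
    (intro continuous_intros continuous_on_fst continuous_on_snd continuous_on_id)

lemma minkowski_self: "p \<star> p = (norm (fst p))\<^sup>2 - (snd p)\<^sup>2"
  by (simp add: minkowski_def power2_norm_eq_inner power2_eq_square[of "snd p"])

lemma timelike_snd_nonzero: "p \<star> p < 0 \<Longrightarrow> snd p \<noteq> 0"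
  by (auto simp: minkowski_self)

lemma hyp_space_or_uminus:
  assumes "p \<star> p = -1"
  shows "p \<in> hyp_space \<or> - p \<in> hyp_space"
  using timelike_snd_nonzero[of p] assms by (auto simp: hyp_space_def minkowski_simps)

lemma hyp_space_iff: "p \<in> hyp_space \<longleftrightarrow> snd p = sqrt (1 + (norm (fst p))\<^sup>2)"
proof -
  have *: "p \<star> p = -1 \<longleftrightarrow> (snd p)\<^sup>2 = 1 + (norm (fst p))\<^sup>2"
    by (auto simp: minkowski_self)
  have "sqrt (1 + (norm (fst p))\<^sup>2) > 0"
    by (simp add: add_pos_nonneg)
  then show ?thesis
    unfolding hyp_space_def mem_Collect_eq *
    by (metis abs_of_pos less_eq_real_def real_sqrt_abs real_sqrt_gt_0_iff real_sqrt_pow2)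
qed

lemma hyp_space_self: "p \<in> hyp_space \<Longrightarrow> p \<star> p = -1"
  by (simp add: hyp_space_def)

lemma hyp_space_snd_pos: "p \<in> hyp_space \<Longrightarrow> snd p > 0"
  by (simp add: hyp_space_def)

lemma norm_fst_less_snd: "p \<in> hyp_space \<Longrightarrow> norm (fst p) < snd p"
  unfolding hyp_space_iff by (simp add: real_less_rsqrt)

lemma hyp_space_graph [simp]: "(x, sqrt (1 + (norm x)\<^sup>2)) \<in> hyp_space"
  by (simp add: hyp_space_iff)

lemma hyp_space_origin [simp]: "(0, 1) \<in> hyp_space"
  by (simp add: hyp_space_iff)

lemma closed_hyp_space: "closed (hyp_space :: ('a::euclidean_space \<times> real) set)"
proof -
  have "hyp_space = {p :: 'a \<times> real. snd p = sqrt (1 + (norm (fst p))\<^sup>2)}"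
    by (auto simp: hyp_space_iff)
  also have "closed \<dots>"
    by (intro closed_Collect_eq continuous_intros)
  finally show ?thesis .
qed

text \<open>Reversed Cauchy-Schwarz inequality; \<open>- (p \<star> q)\<close> is the hyperbolic
  cosine of the distance. It rests on (1 + a^2)(1 + b^2) = (1 + a b)^2 + (a - b)^2, which together
  with the Euclidean Cauchy-Schwarz inequality also settles equality.\<close>

lemma minkowski_le_minus_one:
  assumes "p \<in> hyp_space" "q \<in> hyp_space"
  shows "p \<star> q \<le> -1" and "p \<star> q = -1 \<longleftrightarrow> p = q"
proof -
  define a b where "a = norm (fst p)" and "b = norm (fst q)"
  have ab: "a \<ge> 0" "b \<ge> 0" by (auto simp: a_def b_def)
  have s: "snd p * snd q = sqrt ((1 + a * b)\<^sup>2 + (a - b)\<^sup>2)"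
    using assms by (simp add: hyp_space_iff a_def b_def flip: real_sqrt_mult)
      (simp add: algebra_simps power2_eq_square)
  have cs: "fst p \<bullet> fst q \<le> a * b"
    unfolding a_def b_def by (rule norm_cauchy_schwarz)
  have ge: "snd p * snd q \<ge> 1 + a * b"
    unfolding s using ab by (intro real_le_rsqrt) auto
  show "p \<star> q \<le> -1"
    using cs ge by (simp add: minkowski_def)
  show "p \<star> q = -1 \<longleftrightarrow> p = q"
  proof
    assume "p \<star> q = -1"
    then have eq: "fst p \<bullet> fst q = a * b" "snd p * snd q = 1 + a * b"
      using cs ge by (auto simp: minkowski_def)
    then have "(sqrt ((1 + a * b)\<^sup>2 + (a - b)\<^sup>2))\<^sup>2 = (1 + a * b)\<^sup>2"
      unfolding s by simp
    then have "a = b" by simp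
    moreover from this have "fst p = fst q"
      using eq(1) norm_cauchy_schwarz_eq[of "fst p" "fst q"]
      by (auto simp: a_def b_def)
    ultimately show "p = q"
      using assms by (auto simp: hyp_space_iff prod_eq_iff)
  qed (use assms in \<open>simp add: hyp_space_self\<close>)
qed

text \<open>Chords of the hyperboloid are spacelike, so they can be normalised to unit normals of
  bisecting hyperplanes.\<close>

lemma minkowski_diff_self:
  assumes "p \<in> hyp_space" "q \<in> hyp_space"
  shows "(p - q) \<star> (p - q) = 2 * (p \<star> (p - q))"
    and "p \<noteq> q \<Longrightarrow> p \<star> (p - q) > 0"
  using assms minkowski_le_minus_one[OF assms]
  by (auto simp: minkowski_simps hyp_space_self minkowski_commute[of q p])

lemma tangent_self_nonneg:
  assumes "p \<in> hyp_space" "v \<star> p = 0"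
  shows "v \<star> v \<ge> 0" and "v \<star> v = 0 \<longleftrightarrow> v = 0"
proof -
  define a s where "a = norm (fst p)" and "s = snd p"
  have s: "s > 0" "s\<^sup>2 = 1 + a\<^sup>2"
    using assms(1) by (auto simp: hyp_space_def a_def s_def minkowski_self)
  have "\<bar>snd v * s\<bar> \<le> norm (fst v) * a"
    using assms(2) Cauchy_Schwarz_ineq2[of "fst v" "fst p"]
    by (simp add: minkowski_def a_def s_def)
  then have "(snd v * s)\<^sup>2 \<le> (norm (fst v) * a)\<^sup>2"
    by (metis abs_ge_zero power_mono power2_abs)
  then have "(snd v)\<^sup>2 * s\<^sup>2 \<le> (norm (fst v))\<^sup>2 * (s\<^sup>2 - 1)"
    by (simp add: power_mult_distrib s)
  then have *: "(norm (fst v))\<^sup>2 \<le> (v \<star> v) * s\<^sup>2"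
    by (simp add: minkowski_self algebra_simps)
  then have "0 \<le> (v \<star> v) * s\<^sup>2"
    by (meson order_trans zero_le_power2)
  then show "v \<star> v \<ge> 0"
    using s(1) by (simp add: zero_le_mult_iff)
  show "v \<star> v = 0 \<longleftrightarrow> v = 0"
  proof
    assume "v \<star> v = 0"
    with * have "fst v = 0" by simp
    with \<open>v \<star> v = 0\<close> have "snd v = 0" by (simp add: minkowski_self)
    with \<open>fst v = 0\<close> show "v = 0" by (simp add: prod_eq_iff)
  qed (simp add: minkowski_simps)
qed

lemma tangent_Cauchy_Schwarz:
  assumes "p \<in> hyp_space" "v \<star> p = 0" "w \<star> p = 0" "v \<star> v = 1" "w \<star> w = 1"
  shows "v \<star> w \<ge> -1" and "v \<star> w = -1 \<longleftrightarrow> w = - v"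
proof -
  have "(v + w) \<star> (v + w) = 2 + 2 * (v \<star> w)"
    using assms by (simp add: minkowski_simps minkowski_commute[of w v])
  moreover have "(v + w) \<star> p = 0"
    using assms by (simp add: minkowski_simps)
  ultimately have "2 + 2 * (v \<star> w) \<ge> 0" "2 + 2 * (v \<star> w) = 0 \<longleftrightarrow> v + w = 0"
    using tangent_self_nonneg[OF assms(1), of "v + w"] by simp_all
  moreover have "v + w = 0 \<longleftrightarrow> w = - v"
    by (rule add_eq_0_iff)
  ultimately show "v \<star> w \<ge> -1" "v \<star> w = -1 \<longleftrightarrow> w = - v"
    by linarith+
qed

text \<open>This curve parametrises the geodesic through \<open>p\<close> with direction \<open>v\<close>, but not by arc length.\<close>

abbreviation hyp_curve :: "'a::euclidean_space \<times> real \<Rightarrow> 'a \<times> real \<Rightarrow> real \<Rightarrow> 'a \<times> real" where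
  "hyp_curve p v t \<equiv> sqrt (1 + t\<^sup>2 * (v \<star> v)) *\<^sub>R p + t *\<^sub>R v"

text \<open>The sheet is decided by the product with \<open>p\<close>: it equals \<open>- r\<close>,
  whereas for a point of the lower sheet it would be at least 1.\<close>

lemma hyp_space_curve:
  assumes "p \<in> hyp_space" "v \<star> p = 0"
  shows "hyp_curve p v t \<in> hyp_space"
proof -
  define r where "r = sqrt (1 + t\<^sup>2 * (v \<star> v))"
  have nn: "v \<star> v \<ge> 0" by (rule tangent_self_nonneg[OF assms])
  then have r: "r \<ge> 1" "r\<^sup>2 = 1 + t\<^sup>2 * (v \<star> v)"
    by (auto simp: r_def)
  define q where "q = r *\<^sub>R p + t *\<^sub>R v"
  have "q \<star> q = - r\<^sup>2 + t\<^sup>2 * (v \<star> v)"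
    using assms by (simp add: q_def minkowski_simps hyp_space_self minkowski_commute[of p v] power2_eq_square)
  then have self: "q \<star> q = -1" using r by simp
  have "p \<star> q = - r"
    using assms by (simp add: q_def minkowski_simps hyp_space_self minkowski_commute[of p v])
  then have pq: "p \<star> q < 0" using r by simp
  have "snd q > 0"
  proof (rule ccontr)
    assume "\<not> snd q > 0"
    then have neg: "- q \<in> hyp_space"
      using hyp_space_or_uminus[OF self] hyp_space_snd_pos by blast
    then have "p \<star> (- q) \<le> -1" using assms(1) by (intro minkowski_le_minus_one)
    then show False using pq by (simp add: minkowski_simps)
  qed
  then show ?thesis
    using self by (simp add: hyp_space_def q_def r_def)
qed

section \<open>Hyperplane reflections and bisectors\<close>

definition reflect :: "'a::euclidean_space \<times> real \<Rightarrow> 'a \<times> real \<Rightarrow> 'a \<times> real" where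
  "reflect e x = x - (2 * (x \<star> e)) *\<^sub>R e"

lemma linear_reflect: "linear (reflect e)"
  by (rule linearI) (simp_all add: reflect_def minkowski_simps algebra_simps)

lemma continuous_on_reflect [continuous_intros]:
  "continuous_on S f \<Longrightarrow> continuous_on S (\<lambda>x. reflect e (f x))"
  unfolding reflect_def by (intro continuous_intros)

lemma reflect_measurable [measurable]: "reflect e \<in> borel_measurable borel"
  by (intro borel_measurable_continuous_onI continuous_intros)

context
  fixes e :: "'a::euclidean_space \<times> real"
  assumes e: "e \<star> e = 1"
begin

lemma reflect_reflect [simp]: "reflect e (reflect e x) = x"
  using e by (simp add: reflect_def minkowski_simps)

lemma reflect_image_iff: "x \<in> reflect e ` S \<longleftrightarrow> reflect e x \<in> S"
  by (metis image_iff reflect_reflect)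

lemma minkowski_reflect_reflect [simp]: "reflect e x \<star> reflect e y = x \<star> y"
  using e by (simp add: reflect_def minkowski_simps minkowski_commute[of e y] algebra_simps)

lemma minkowski_reflect_right: "x \<star> reflect e y = reflect e x \<star> y"
  by (metis minkowski_reflect_reflect reflect_reflect)

lemma minkowski_reflect_axis [simp]: "reflect e x \<star> e = - (x \<star> e)"
  using e by (simp add: reflect_def minkowski_simps)

text \<open>The sheets are not exchanged:
  \<open>x \<star> reflect e x = -1 - 2 (x \<star> e)^2\<close> is negative, but points of opposite
  sheets have product at least 1.\<close>

lemma reflect_hyp_space [simp]: "reflect e x \<in> hyp_space \<longleftrightarrow> x \<in> hyp_space"
proof -
  have *: "reflect e x \<in> hyp_space" if "x \<in> hyp_space" for x
  proof (rule ccontr)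
    assume "reflect e x \<notin> hyp_space"
    moreover have "reflect e x \<star> reflect e x = -1" using that by (simp add: hyp_space_self)
    ultimately have "- reflect e x \<in> hyp_space"
      using hyp_space_or_uminus by blast
    from minkowski_le_minus_one(1)[OF that this] have "x \<star> reflect e x \<ge> 1"
      by (simp add: minkowski_simps)
    then show False
      using that zero_le_square[of "x \<star> e"] by (simp add: reflect_def minkowski_simps hyp_space_self)
  qed
  show ?thesis using *[of x] *[of "reflect e x"] by auto
qed

lemma reflect_fixed: "x \<star> e = 0 \<Longrightarrow> reflect e x = x"
  by (simp add: reflect_def)

end

text \<open>The unit normal of the hyperplane equidistant from \<open>p\<close> and
  \<open>q\<close>, oriented towards \<open>p\<close>. The reflection in it exchanges the two
  points.\<close>

definition bisector :: "'a::euclidean_space \<times> real \<Rightarrow> 'a \<times> real \<Rightarrow> 'a \<times> real" where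
  "bisector p q = (1 / sqrt ((p - q) \<star> (p - q))) *\<^sub>R (p - q)"

context
  fixes p q :: "'a::euclidean_space \<times> real"
  assumes pq: "p \<in> hyp_space" "q \<in> hyp_space" "p \<noteq> q"
begin

lemma bisector_unit: "bisector p q \<star> bisector p q = 1"
  and minkowski_bisector: "x \<star> bisector p q = (x \<star> p - x \<star> q) / sqrt ((p - q) \<star> (p - q))"
  and reflect_bisector: "reflect (bisector p q) p = q"
proof -
  define s where "s = (p - q) \<star> (p - q)"
  have s: "s > 0" "s = 2 * (p \<star> (p - q))"
    using minkowski_diff_self[OF pq(1,2)] pq(3) by (auto simp: s_def)
  have unfold: "bisector p q = (1 / sqrt s) *\<^sub>R (p - q)" by (simp add: bisector_def s_def)
  show "bisector p q \<star> bisector p q = 1"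
    using s(1) unfolding unfold minkowski.scaleR_left minkowski.scaleR_right s_def[symmetric]
    by (simp add: field_simps)
  show "x \<star> bisector p q = (x \<star> p - x \<star> q) / sqrt ((p - q) \<star> (p - q))" for x
    unfolding unfold s_def by (simp add: minkowski_simps)
  have "reflect (bisector p q) p = p - (2 * (p \<star> (p - q)) / s) *\<^sub>R (p - q)"
    using s(1) unfolding reflect_def unfold minkowski.scaleR_right by simp
  also have "2 * (p \<star> (p - q)) / s = 1"
    using s(1) by (simp flip: s(2))
  finally show "reflect (bisector p q) p = q"
    by simp
qed

lemma minkowski_bisector_pos_iff: "x \<star> bisector p q > 0 \<longleftrightarrow> x \<star> q < x \<star> p"
proof -
  have "(p - q) \<star> (p - q) > 0"
    using minkowski_diff_self[OF pq(1,2)] pq(3) by linarith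
  then show ?thesis
    by (simp add: minkowski_bisector zero_less_divide_iff del: minkowski.diff_left)
qed

lemma bisector_side: "p \<star> bisector p q > 0"
  using minkowski_le_minus_one[OF pq(1,2)] pq(3) hyp_space_self[OF pq(1)]
  unfolding minkowski_bisector_pos_iff by linarith

end

section \<open>Invariance of the hyperbolic volume\<close>

lemma nn_integral_lborel_translation:
  fixes f :: "'b::euclidean_space \<Rightarrow> ennreal"
  assumes [measurable]: "f \<in> borel_measurable borel"
  shows "(\<integral>\<^sup>+x. f (c + x) \<partial>lborel) = (\<integral>\<^sup>+x. f x \<partial>lborel)"
proof -
  have "(\<integral>\<^sup>+x. f x \<partial>lborel) = (\<integral>\<^sup>+x. f x \<partial>distr lborel borel ((+) c))"
    by (simp add: lborel_distr_plus)
  also have "\<dots> = (\<integral>\<^sup>+x. f (c + x) \<partial>lborel)"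
    by (rule nn_integral_distr) auto
  finally show ?thesis by simp
qed

text \<open>
  Translation-invariant measures are proportional: integrate \<open>indicator A x * indicator B (x + f y)\<close>
  in both orders. The factor is \<open>1\<close> because \<open>f\<close> is an involution.
\<close>

lemma distr_lborel_linear_involution:
  fixes f :: "'b::euclidean_space \<Rightarrow> 'b"
  assumes f: "linear f" and ff: "\<And>x. f (f x) = x"
  shows "distr lborel borel f = lborel"
proof -
  have [measurable]: "f \<in> borel_measurable borel"
    using f by (simp add: borel_measurable_continuous_onI linear_continuous_on linear_linear)
  define \<nu> where "\<nu> B = emeasure lborel (f -` B)" for B
  have f_vimage [measurable]: "f -` B \<in> sets borel" if "B \<in> sets borel" for B
    using measurable_sets_borel[OF _ that, of f] by simp
  have \<nu>_translate: "emeasure lborel {y. f y + x \<in> B} = \<nu> B" if [measurable]: "B \<in> sets borel" for x B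
  proof -
    have "emeasure lborel {y. f y + x \<in> B} = (\<integral>\<^sup>+y. indicator {y. f y + x \<in> B} y \<partial>lborel)"
      by (rule nn_integral_indicator[symmetric]) simp
    also have "\<dots> = (\<integral>\<^sup>+y. indicator (f -` B) (f x + y) \<partial>lborel)"
      by (rule nn_integral_cong) (simp add: linear_add[OF f] ff add.commute indicator_def)
    also have "\<dots> = \<nu> B"
      by (subst nn_integral_lborel_translation) (auto simp: \<nu>_def)
    finally show ?thesis .
  qed
  define A where "A = ball (0 :: 'b) 1"
  have [measurable]: "A \<in> sets borel" by (simp add: A_def)
  let ?b = "emeasure lborel A"
  have proportional: "?b * \<nu> B = emeasure lborel B * \<nu> A" if [measurable]: "B \<in> sets borel" for B
  proof -
    have "?b * \<nu> B = (\<integral>\<^sup>+x. \<integral>\<^sup>+y. indicator A x * indicator B (x + f y) \<partial>lborel \<partial>lborel)"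
    proof -
      have "(\<integral>\<^sup>+y. indicator B (x + f y) \<partial>lborel) = \<nu> B" for x
      proof -
        have "(\<integral>\<^sup>+y. indicator B (x + f y) \<partial>lborel) = (\<integral>\<^sup>+y. indicator {y. f y + x \<in> B} y \<partial>lborel)"
          by (rule nn_integral_cong) (simp add: indicator_def add.commute)
        also have "\<dots> = emeasure lborel {y. f y + x \<in> B}"
          by (rule nn_integral_indicator) simp
        finally show ?thesis by (simp add: \<nu>_translate)
      qed
      then have "(\<integral>\<^sup>+x. \<integral>\<^sup>+y. indicator A x * indicator B (x + f y) \<partial>lborel \<partial>lborel) =
          (\<integral>\<^sup>+x. indicator A x * \<nu> B \<partial>lborel)"
        by (simp add: nn_integral_cmult)
      also have "\<dots> = ?b * \<nu> B"
        by (subst nn_integral_multc) (auto intro: borel_measurable_indicator)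
      finally show ?thesis by simp
    qed
    also have "\<dots> = (\<integral>\<^sup>+y. \<integral>\<^sup>+x. indicator A x * indicator B (x + f y) \<partial>lborel \<partial>lborel)"
    proof (rule lborel_pair.Fubini')
      have [measurable]: "B \<in> sets borel" by (fact that)
      have "(\<lambda>x. indicator A (snd x) * indicator B (snd x + f (fst x)) :: ennreal)
          \<in> borel_measurable (borel \<Otimes>\<^sub>M borel)"
        by measurable
      then show "(\<lambda>(x, y). indicator A y * indicator B (y + f x) :: ennreal)
          \<in> borel_measurable (lborel \<Otimes>\<^sub>M lborel)"
        by (simp add: case_prod_beta' cong: measurable_cong_sets)
    qed
    also have "\<dots> = (\<integral>\<^sup>+y. \<integral>\<^sup>+x. indicator A (x - f y) * indicator B x \<partial>lborel \<partial>lborel)"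
    proof (rule nn_integral_cong)
      fix y
      show "(\<integral>\<^sup>+x. indicator A x * indicator B (x + f y) \<partial>lborel) =
        (\<integral>\<^sup>+x. indicator A (x - f y) * indicator B x \<partial>lborel)"
        using nn_integral_lborel_translation[of "\<lambda>x. indicator A (x - f y) * indicator B x" "f y"]
        by (simp add: add.commute)
    qed
    also have "\<dots> = (\<integral>\<^sup>+x. \<integral>\<^sup>+y. indicator A (x - f y) * indicator B x \<partial>lborel \<partial>lborel)"
      by (rule lborel_pair.Fubini'[symmetric]) measurable
    also have "\<dots> = (\<integral>\<^sup>+x. \<nu> A * indicator B x \<partial>lborel)"
    proof (rule nn_integral_cong)
      fix x
      \<comment> \<open>The ball \<open>A\<close> is symmetric about 0, so \<open>x - f y\<close>
        may be replaced by \<open>f y - x\<close>.\<close>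
      have "(\<integral>\<^sup>+y. indicator A (x - f y) \<partial>lborel) =
          (\<integral>\<^sup>+y. indicator {y. f y + (- x) \<in> A} y \<partial>lborel)"
        by (rule nn_integral_cong) (simp add: A_def indicator_def norm_minus_commute)
      also have "\<dots> = emeasure lborel {y. f y + (- x) \<in> A}"
        by (rule nn_integral_indicator) simp
      also have "\<dots> = \<nu> A"
        by (rule \<nu>_translate) simp
      finally have "(\<integral>\<^sup>+y. indicator A (x - f y) \<partial>lborel) = \<nu> A" .
      then show "(\<integral>\<^sup>+y. indicator A (x - f y) * indicator B x \<partial>lborel) = \<nu> A * indicator B x"
        by (simp add: nn_integral_multc)
    qed
    finally show ?thesis
      by (simp add: nn_integral_cmult mult.commute)
  qed
  have b: "0 < ?b" "?b < top"
    by (simp_all add: A_def emeasure_lborel_ball_finite  emeasure_ball ennreal_zero_less_mult_iff)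
  \<comment> \<open>Proportionality is applied to the preimage of \<open>A\<close>, whose own
    preimage is \<open>A\<close> again. Taking square roots then requires both factors to be
    finite.\<close>
  have "?b * ?b = \<nu> A * \<nu> A"
    using proportional[of "f -` A"] by (simp add: \<nu>_def vimage_comp o_def ff)
  moreover from this have "\<nu> A < top"
    using b by (metis ennreal_mult_less_top ennreal_zero_less_top)
  ultimately have "enn2real ?b * enn2real ?b = enn2real (\<nu> A) * enn2real (\<nu> A)"
    by (metis enn2real_mult)
  then have "enn2real ?b = enn2real (\<nu> A)"
    by (metis real_sqrt_abs2 abs_of_nonneg enn2real_nonneg)
  then have "\<nu> A = ?b"
    using b(2) \<open>\<nu> A < top\<close> by (metis ennreal_enn2real)
  then have "\<nu> B = emeasure lborel B" if "B \<in> sets borel" for B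
    using proportional[OF that] b by (auto simp: mult.commute[of _ ?b] ennreal_mult_cancel_left)
  then show ?thesis
    by (intro measure_eqI) (auto simp: emeasure_distr \<nu>_def)
qed

lemma nn_integral_reflect:
  fixes g :: "'a::euclidean_space \<times> real \<Rightarrow> ennreal"
  assumes e: "e \<star> e = 1" and [measurable]: "g \<in> borel_measurable borel"
  shows "(\<integral>\<^sup>+x. g (reflect e x) \<partial>lborel) = (\<integral>\<^sup>+x. g x \<partial>lborel)"
proof -
  have "(\<integral>\<^sup>+x. g x \<partial>lborel) = (\<integral>\<^sup>+x. g x \<partial>distr lborel borel (reflect e))"
    using distr_lborel_linear_involution[OF linear_reflect[of e]] e by simp
  also have "\<dots> = (\<integral>\<^sup>+x. g (reflect e x) \<partial>lborel)"
    by (rule nn_integral_distr) auto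
  finally show ?thesis by simp
qed

lemma nn_integral_lborel_scale:
  fixes g :: "'b::euclidean_space \<Rightarrow> ennreal"
  assumes [measurable]: "g \<in> borel_measurable borel" and "c > 0"
  shows "(\<integral>\<^sup>+x. g x \<partial>lborel) = ennreal (c ^ DIM('b)) * (\<integral>\<^sup>+x. g (c *\<^sub>R x) \<partial>lborel)"
proof -
  have "(\<integral>\<^sup>+x. g x \<partial>lborel) =
      (\<integral>\<^sup>+x. g x \<partial>density (distr lborel borel (\<lambda>x. 0 + c *\<^sub>R x)) (\<lambda>_. ennreal (\<bar>c\<bar> ^ DIM('b))))"
    using lborel_affine[of c "0 :: 'b"] assms(2) by simp
  also have "\<dots> = ennreal (c ^ DIM('b)) * (\<integral>\<^sup>+x. g (c *\<^sub>R x) \<partial>lborel)"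
    using assms(2) by (simp add: nn_integral_density nn_integral_distr nn_integral_cmult)
  finally show ?thesis .
qed

lemma nn_integral_lborel_prod_iterated:
  fixes g :: "'a::euclidean_space \<times> real \<Rightarrow> ennreal"
  assumes [measurable]: "g \<in> borel_measurable borel"
  shows "(\<integral>\<^sup>+q. g q \<partial>lborel) = (\<integral>\<^sup>+y. \<integral>\<^sup>+s. g (y, s) \<partial>lborel \<partial>lborel)"
  using lborel.nn_integral_fst[of g lborel] by (simp add: lborel_prod)

section \<open>Hyperbolic volume as a cone integral\<close>

abbreviation hvol :: "('a::euclidean_space \<times> real) set \<Rightarrow> ennreal" where
  "hvol \<equiv> emeasure hyp_volume_measure"

lemma hyp_volume_measure_sets [simp, measurable_cong]: "sets hyp_volume_measure = sets borel"
  by (simp add: hyp_volume_measure_def)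

lemma emeasure_hyp_volume_measure:
  fixes A :: "('a::euclidean_space \<times> real) set"
  assumes [measurable]: "A \<in> sets borel"
  shows "hvol A =
    (\<integral>\<^sup>+x. ennreal (1 / sqrt (1 + (norm x)\<^sup>2)) * indicator A (x, sqrt (1 + (norm x)\<^sup>2)) \<partial>lborel)"
  unfolding hyp_volume_measure_def
  by (subst nn_integral_indicator[symmetric], simp)
    (simp add: nn_integral_distr nn_integral_density del: nn_integral_indicator)

text \<open>
  Hyperbolic volume as a Lorentz-invariant Lebesgue integral over the part of the cone over \<open>A\<close>
  between the hyperboloids of radii \<open>1\<close> and \<open>2\<close>: in the coordinates \<open>(t, x) \<mapsto> t *\<^sub>R (x, sqrt (1 + |x|\<^sup>2))\<close>
  the Lebesgue measure is \<open>t ^ d dt\<close> times the hyperbolic volume.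
\<close>

lemma emeasure_hyp_volume_measure_cone:
  fixes A :: "('a::euclidean_space \<times> real) set"
  assumes [measurable]: "A \<in> sets borel" and A: "A \<subseteq> hyp_space"
  shows "hvol A =
    (\<integral>\<^sup>+q. indicator A ((1 / sqrt (- (q \<star> q))) *\<^sub>R q) *
      (indicator {1..4} (- (q \<star> q)) * ennreal (1 / sqrt (- (q \<star> q)) ^ DIM('a))) \<partial>lborel)"
    (is "_ = (\<integral>\<^sup>+q. ?F q \<partial>lborel)")
proof -
  let ?d = "DIM('a)"
  \<comment> \<open>At fixed \<open>y\<close> the height is substituted as
    \<open>s = sqrt (t^2 + |y|^2)\<close>, so that \<open>t\<close> is the Minkowski radius. The
    weight \<open>1 / t^d\<close> is there to cancel the Jacobian of the later scaling
    \<open>y = t x\<close>.\<close>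
  have inner: "(\<integral>\<^sup>+s. ?F (y, s) \<partial>lborel) =
      (\<integral>\<^sup>+t. indicator A ((1 / t) *\<^sub>R (y, sqrt (t\<^sup>2 + (norm y)\<^sup>2))) *
        ennreal (1 / t ^ ?d * (t / sqrt (t\<^sup>2 + (norm y)\<^sup>2))) * indicator {1..2} t \<partial>lborel)" for y :: 'a
  proof -
    define b where "b = norm y"
    define g where "g t = sqrt (t\<^sup>2 + b\<^sup>2)" for t
    define h where "h s = indicator A ((1 / sqrt (s\<^sup>2 - b\<^sup>2)) *\<^sub>R (y, s)) *
      ennreal (1 / sqrt (s\<^sup>2 - b\<^sup>2) ^ ?d)" for s
    have [measurable]: "h \<in> borel_measurable borel"
      unfolding h_def by measurable
    have pos: "t\<^sup>2 + b\<^sup>2 > 0" if "t \<in> {1..2}" for t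
      using that by (intro add_pos_nonneg) auto
    have mk: "- ((y, s) \<star> (y, s)) = s\<^sup>2 - b\<^sup>2" for s
      by (simp add: minkowski_self b_def)
    have "?F (y, s) = h s * indicator {g 1..g 2} s" for s
    proof (cases "(1 / sqrt (s\<^sup>2 - b\<^sup>2)) *\<^sub>R (y, s) \<in> A \<and> s\<^sup>2 - b\<^sup>2 \<ge> 1")
      case True
      \<comment> \<open>\<open>A\<close> lies on the upper sheet, so only the nappe of positive
        height contributes and the sign of the square root is determined.\<close>
      then have "snd ((1 / sqrt (s\<^sup>2 - b\<^sup>2)) *\<^sub>R (y, s)) > 0"
        using A hyp_space_snd_pos by blast
      then have "s > 0"
        using True by (simp add: zero_less_divide_iff)
      then have "s = sqrt (s\<^sup>2)" by simp
      then have "s \<in> {g 1..g 2} \<longleftrightarrow> sqrt (1 + b\<^sup>2) \<le> sqrt (s\<^sup>2) \<and> sqrt (s\<^sup>2) \<le> sqrt (4 + b\<^sup>2)"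
        by (simp add: g_def)
      then have "s \<in> {g 1..g 2} \<longleftrightarrow> s\<^sup>2 - b\<^sup>2 \<in> {1..4}"
        unfolding real_sqrt_le_iff by auto
      then show ?thesis
        unfolding mk by (simp add: h_def indicator_def)
    next
      case False
      moreover have "s\<^sup>2 - b\<^sup>2 \<ge> 1" if "s \<in> {g 1..g 2}"
        using that sqrt_le_D[of "1 + b\<^sup>2" s] by (auto simp: g_def)
      ultimately show ?thesis
        unfolding mk by (auto simp: h_def indicator_def)
    qed
    then have "(\<integral>\<^sup>+s. ?F (y, s) \<partial>lborel) = (\<integral>\<^sup>+s. h s * indicator {g 1..g 2} s \<partial>lborel)"
      by simp
    also have "\<dots> = (\<integral>\<^sup>+t. h (g t) * ennreal (t / sqrt (t\<^sup>2 + b\<^sup>2)) * indicator {1..2} t \<partial>lborel)"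
    proof (rule nn_integral_substitution_aux)
      fix t :: real assume t: "t \<in> {1..2}"
      show "(g has_real_derivative t / sqrt (t\<^sup>2 + b\<^sup>2)) (at t)"
        unfolding g_def using pos[OF t]
        by (auto intro!: derivative_eq_intros simp: field_simps)
      show "t / sqrt (t\<^sup>2 + b\<^sup>2) \<ge> 0" using t by simp
    next
      show "continuous_on {1..2} (\<lambda>t. t / sqrt (t\<^sup>2 + b\<^sup>2))"
        by (intro continuous_intros) (use pos in force)
    qed auto
    also have "\<dots> = (\<integral>\<^sup>+t. indicator A ((1 / t) *\<^sub>R (y, sqrt (t\<^sup>2 + b\<^sup>2))) *
        ennreal (1 / t ^ ?d * (t / sqrt (t\<^sup>2 + b\<^sup>2))) * indicator {1..2} t \<partial>lborel)"
    proof (rule nn_integral_cong)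
      fix t :: real
      have "h (g t) = indicator A ((1 / t) *\<^sub>R (y, sqrt (t\<^sup>2 + b\<^sup>2))) * ennreal (1 / t ^ ?d)"
        if "t \<ge> 1"
        using that by (simp add: h_def g_def)
      moreover have "ennreal (1 / t ^ ?d * (t / sqrt (t\<^sup>2 + b\<^sup>2))) =
          ennreal (1 / t ^ ?d) * ennreal (t / sqrt (t\<^sup>2 + b\<^sup>2))" if "t \<ge> 1"
        using that by (intro ennreal_mult) auto
      ultimately show "h (g t) * ennreal (t / sqrt (t\<^sup>2 + b\<^sup>2)) * indicator {1..2} t =
         indicator A ((1 / t) *\<^sub>R (y, sqrt (t\<^sup>2 + b\<^sup>2))) *
        ennreal (1 / t ^ ?d * (t / sqrt (t\<^sup>2 + b\<^sup>2))) * indicator {1..2} t"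
        by (cases "t \<in> {1..2}") (simp_all only: mult.assoc atLeastAtMost_iff indicator_simps mult_zero_right not_False_eq_True)
    qed
    finally show ?thesis by (simp add: b_def)
  qed
  have "(\<integral>\<^sup>+q. ?F q \<partial>lborel) = (\<integral>\<^sup>+y. \<integral>\<^sup>+s. ?F (y, s) \<partial>lborel \<partial>lborel)"
    by (rule nn_integral_lborel_prod_iterated) measurable
  also have "\<dots> = (\<integral>\<^sup>+t. \<integral>\<^sup>+y. indicator A ((1 / t) *\<^sub>R (y :: 'a, sqrt (t\<^sup>2 + (norm y)\<^sup>2))) *
        ennreal (1 / t ^ ?d * (t / sqrt (t\<^sup>2 + (norm y)\<^sup>2))) * indicator {1..2} t \<partial>lborel \<partial>lborel)"
    unfolding inner by (rule lborel_pair.Fubini') measurable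
  \<comment> \<open>Every layer of radius \<open>t\<close> contributes \<open>hvol A\<close>, and
    \<open>{1..2}\<close> has length 1, so no normalising factor remains.\<close>
  also have "\<dots> = (\<integral>\<^sup>+t. hvol A * indicator {1..2::real} t \<partial>lborel)"
  proof (rule nn_integral_cong)
    fix t :: real
    let ?G = "\<lambda>y. indicator A ((1 / t) *\<^sub>R (y :: 'a, sqrt (t\<^sup>2 + (norm y)\<^sup>2))) *
        ennreal (1 / t ^ ?d * (t / sqrt (t\<^sup>2 + (norm y)\<^sup>2)))"
    show "(\<integral>\<^sup>+y. ?G y * indicator {1..2} t \<partial>lborel) =
        hvol A * indicator {1..2} t"
    proof (cases "t \<in> {1..2}")
      case True
      have *: "sqrt (t\<^sup>2 + (norm (t *\<^sub>R x))\<^sup>2) = t * sqrt (1 + (norm x)\<^sup>2)" for x :: 'a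
      proof -
        have "t\<^sup>2 + (norm (t *\<^sub>R x))\<^sup>2 = t\<^sup>2 * (1 + (norm x)\<^sup>2)"
          by (simp add: power_mult_distrib algebra_simps)
        then show ?thesis using True by (simp add: real_sqrt_mult)
      qed
      have "(\<integral>\<^sup>+y. ?G y \<partial>lborel) = ennreal (t ^ ?d) * (\<integral>\<^sup>+x. ?G (t *\<^sub>R x) \<partial>lborel)"
        using True by (intro nn_integral_lborel_scale) auto
      also have "\<dots> = (\<integral>\<^sup>+x. ennreal (t ^ ?d) * ?G (t *\<^sub>R x) \<partial>lborel)"
        by (rule nn_integral_cmult[symmetric]) measurable
      also have "\<dots> = (\<integral>\<^sup>+x. ennreal (1 / sqrt (1 + (norm x)\<^sup>2)) *
          indicator A (x, sqrt (1 + (norm x)\<^sup>2)) \<partial>lborel)"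
        using True unfolding *
        by (intro nn_integral_cong) (auto simp: indicator_def simp flip: ennreal_mult')
      finally show ?thesis
        using True by (simp add: emeasure_hyp_volume_measure)
    qed simp
  qed
  also have "\<dots> = hvol A"
    by (simp add: nn_integral_cmult)
  finally show ?thesis by simp
qed

text \<open>The weight in the cone integral depends only on \<open>q \<star> q\<close>, which the
  reflection preserves, and the radial projection commutes with it by linearity. What remains is the
  invariance of Lebesgue measure.\<close>

lemma emeasure_hyp_volume_measure_reflect:
  fixes A :: "('a::euclidean_space \<times> real) set"
  assumes e: "e \<star> e = 1" and [measurable]: "A \<in> sets borel" and A: "A \<subseteq> hyp_space"
  shows "hvol (reflect e ` A) = hvol A"
proof -
  have im: "reflect e ` A = reflect e -` A"
    using e by (auto simp: reflect_image_iff)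
  have [measurable]: "reflect e ` A \<in> sets borel"
    unfolding im using measurable_sets_borel[OF reflect_measurable assms(2)] by simp
  have sub: "reflect e ` A \<subseteq> hyp_space"
    using A e by auto
  let ?F = "\<lambda>q :: 'a \<times> real. indicator A ((1 / sqrt (- (q \<star> q))) *\<^sub>R q) *
      (indicator {1..4} (- (q \<star> q)) * ennreal (1 / sqrt (- (q \<star> q)) ^ DIM('a)))"
  have [measurable]: "?F \<in> borel_measurable borel" by measurable
  have "hvol (reflect e ` A) = (\<integral>\<^sup>+q. ?F (reflect e q) \<partial>lborel)"
    unfolding emeasure_hyp_volume_measure_cone[OF \<open>reflect e ` A \<in> sets borel\<close> sub]
    using e by (intro nn_integral_cong) (simp add: im indicator_def linear_scale[OF linear_reflect])
  also have "\<dots> = hvol A"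
    by (simp only: nn_integral_reflect[OF e \<open>?F \<in> _\<close>] emeasure_hyp_volume_measure_cone[OF assms(2,3)])
  finally show ?thesis .
qed

section \<open>The dual measure\<close>

definition polar :: "('a::euclidean_space \<times> real) set \<Rightarrow> ('a \<times> real) set" where
  "polar K = {w. \<forall>x\<in>K. w \<star> x \<le> 0}"

text \<open>Strict inequalities make this set open for every \<open>K\<close> and unchanged when
  \<open>K\<close> is closed up. A hyperplane that passes between two pieces of a disconnected
  \<open>K\<close> without meeting it also counts.\<close>

definition crossing :: "('a::euclidean_space \<times> real) set \<Rightarrow> ('a \<times> real) set" where
  "crossing K = {w. (\<exists>x\<in>K. w \<star> x > 0) \<and> (\<exists>x\<in>K. w \<star> x < 0)}"

lemma crossing_iff_polar: "w \<in> crossing K \<longleftrightarrow> w \<notin> polar K \<and> - w \<notin> polar K"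
  by (auto simp: crossing_def polar_def minkowski_simps not_le)

lemma crossing_mono: "K \<subseteq> L \<Longrightarrow> crossing K \<subseteq> crossing L"
  by (auto simp: crossing_def)

lemma open_crossing: "open (crossing K)"
proof -
  have "crossing K = (\<Union>x\<in>K. {w. w \<star> x > 0}) \<inter> (\<Union>x\<in>K. {w. w \<star> x < 0})"
    by (auto simp: crossing_def)
  also have "open \<dots>"
    by (intro open_Int open_UN ballI open_Collect_less continuous_intros)
  finally show ?thesis .
qed

lemma crossing_borel [measurable]: "crossing K \<in> sets borel"
  by (simp add: open_crossing)

lemma crossing_closure: "crossing (closure K) = crossing K"
proof -
  have "\<exists>x\<in>K. P x" if "open {x. P x}" "x \<in> closure K" "P x" for P :: "'a \<times> real \<Rightarrow> bool" and x
    using that by (metis closure_iff_nhds_not_empty disjoint_iff mem_Collect_eq order_refl)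
  moreover have "open {x. w \<star> x > 0}" "open {x. w \<star> x < 0}" for w :: "'a \<times> real"
    by (intro open_Collect_less continuous_intros)+
  ultimately show ?thesis
    using closure_subset[of K] unfolding crossing_def by blast
qed

lemma crossing_scale: "t > 0 \<Longrightarrow> t *\<^sub>R w \<in> crossing K \<longleftrightarrow> w \<in> crossing K"
  by (simp add: crossing_def minkowski_simps zero_less_mult_iff mult_less_0_iff)

text \<open>With \<open>d = DIM('a)\<close> and \<open>w = r (cosh \<rho> u, sinh \<rho>)\<close>,
  Lebesgue measure is \<open>r^d cosh^(d-1) \<rho> dr d\<rho> du\<close>. The factor
  \<open>1 / r\<close> leaves \<open>r^(d-1)\<close>, whose integral over 0 < r < 1 is
  \<open>1 / d\<close>; it also makes the substitution at a fixed space component independent of its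
  norm, apart from the cut-off r < 1.\<close>

definition dual_weight :: "'a::euclidean_space \<times> real \<Rightarrow> ennreal" where
  "dual_weight w = (if 0 < w \<star> w \<and> w \<star> w < 1 then ennreal (1 / sqrt (w \<star> w)) else 0)"

lemma dual_weight_measurable [measurable]: "dual_weight \<in> borel_measurable borel"
  unfolding dual_weight_def[abs_def] by measurable

text \<open>
  The invariant measure of the space of unit spacelike vectors \<open>w\<close>, i.e. of cooriented
  hyperplanes, is spread over the vectors with \<open>0 < w \<star> w < 1\<close>, where it has a
  Lorentz-invariant Lebesgue density.
\<close>

definition dual_measure :: "('a::euclidean_space \<times> real) measure" where
  "dual_measure = density lborel dual_weight"

abbreviation crossing_vol :: "('a::euclidean_space \<times> real) set \<Rightarrow> ennreal" where
  "crossing_vol K \<equiv> emeasure dual_measure (crossing K)"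

lemma dual_measure_sets [simp, measurable_cong]: "sets dual_measure = sets borel"
  by (simp add: dual_measure_def)

lemma emeasure_dual_measure:
  "E \<in> sets borel \<Longrightarrow> emeasure dual_measure E = (\<integral>\<^sup>+w. dual_weight w * indicator E w \<partial>lborel)"
  by (simp add: dual_measure_def emeasure_density)

lemma emeasure_dual_measure_reflect:
  fixes E :: "('a::euclidean_space \<times> real) set"
  assumes e: "e \<star> e = 1" and [measurable]: "E \<in> sets borel"
  shows "emeasure dual_measure (reflect e -` E) = emeasure dual_measure E"
proof -
  have [measurable]: "reflect e -` E \<in> sets borel"
    using measurable_sets_borel[OF reflect_measurable assms(2)] by simp
  have "emeasure dual_measure (reflect e -` E) =
      (\<integral>\<^sup>+w. dual_weight (reflect e w) * indicator E (reflect e w) \<partial>lborel)"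
    using e by (simp add: emeasure_dual_measure dual_weight_def indicator_def cong: if_cong)
  also have "\<dots> = emeasure dual_measure E"
    by (simp add: nn_integral_reflect[OF e, of "\<lambda>w. dual_weight w * indicator E w"] emeasure_dual_measure)
  finally show ?thesis .
qed

text \<open>The substitution \<open>s = b tanh \<rho>\<close> maps the whole line onto an open
  interval. The rule for compact intervals is therefore applied on \<open>[-(k+1), k+1]\<close>,
  followed by monotone convergence.\<close>

lemma nn_integral_tanh_substitution:
  fixes h :: "real \<Rightarrow> ennreal"
  assumes [measurable]: "h \<in> borel_measurable borel" and b: "b > 0"
  shows "(\<integral>\<^sup>+s. h s * indicator {-b<..<b} s \<partial>lborel) =
    (\<integral>\<^sup>+\<rho>. h (b * tanh \<rho>) * ennreal (b * (1 - (tanh \<rho>)\<^sup>2)) \<partial>lborel)"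
proof -
  define g where "g \<rho> = b * tanh \<rho>" for \<rho>
  have tanh2: "(tanh \<rho>)\<^sup>2 \<le> 1" for \<rho> :: real
    using tanh_real_bounds[of \<rho>] by (simp add: abs_square_le_1 abs_le_iff)
  have [measurable]: "g \<in> borel_measurable borel"
    unfolding g_def[abs_def] by (intro borel_measurable_continuous_onI continuous_intros) simp
  have [measurable]: "(\<lambda>\<rho>::real. (tanh \<rho>)\<^sup>2) \<in> borel_measurable borel"
    by (intro borel_measurable_continuous_onI continuous_intros) simp
  define I where "I k = {- real (Suc k)..real (Suc k)}" for k
  define J where "J k = {g (- real (Suc k))..g (real (Suc k))}" for k
  have J: "J k = {-b * tanh (real (Suc k))..b * tanh (real (Suc k))}" for k
    unfolding J_def g_def tanh_minus by simp
  have bound: "\<bar>s\<bar> < b \<longleftrightarrow> (\<exists>k. \<bar>s\<bar> \<le> b * tanh (real (Suc k)))" for s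
  proof
    assume "\<bar>s\<bar> < b"
    then have "\<bar>s\<bar> / b < 1" using b by simp
    then have "eventually (\<lambda>x::real. \<bar>s\<bar> / b < tanh x) at_top"
      by (rule order_tendstoD(1)[OF tanh_real_at_top])
    then obtain X where X: "\<And>x::real. x \<ge> X \<Longrightarrow> \<bar>s\<bar> / b < tanh x"
      by (auto simp: eventually_at_top_linorder)
    obtain k where "X \<le> real k" using real_arch_simple by blast
    then have "\<bar>s\<bar> / b < tanh (real (Suc k))" by (intro X) simp
    then show "\<exists>k. \<bar>s\<bar> \<le> b * tanh (real (Suc k))"
      using b by (auto simp: field_simps intro!: exI[of _ k])
  next
    assume "\<exists>k. \<bar>s\<bar> \<le> b * tanh (real (Suc k))"
    then obtain k where "\<bar>s\<bar> \<le> b * tanh (real (Suc k))" ..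
    also have "\<dots> < b * 1"
      using b by (intro mult_strict_left_mono tanh_real_lt_1)
    finally show "\<bar>s\<bar> < b" by simp
  qed
  have "(\<integral>\<^sup>+s. h s * indicator {-b<..<b} s \<partial>lborel) =
      (\<integral>\<^sup>+s. (SUP k. h s * indicator (J k) s) \<partial>lborel)"
  proof (rule nn_integral_cong)
    fix s
    have ind: "indicator (J k) s =
        (if \<bar>s\<bar> \<le> b * tanh (real (Suc k)) then 1 else 0 :: ennreal)" for k
      unfolding J by (auto simp: indicator_def)
    show "h s * indicator {-b<..<b} s = (SUP k. h s * indicator (J k) s)"
    proof (cases "\<bar>s\<bar> < b")
      case True
      then obtain k where "\<bar>s\<bar> \<le> b * tanh (real (Suc k))" using bound by blast
      then have "h s \<le> (SUP k. h s * indicator (J k) s)"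
        by (intro SUP_upper2[of k]) (auto simp: ind)
      moreover have "(SUP k. h s * indicator (J k) s) \<le> h s"
        by (intro SUP_least) (simp add: ind)
      ultimately show ?thesis using True by (auto simp: indicator_def)
    next
      case False
      then have "\<not> \<bar>s\<bar> \<le> b * tanh (real (Suc k))" for k using bound by blast
      then show ?thesis using False unfolding ind by (auto simp: indicator_def)
    qed
  qed
  also have "\<dots> = (SUP k. \<integral>\<^sup>+s. h s * indicator (J k) s \<partial>lborel)"
  proof (rule nn_integral_monotone_convergence_SUP)
    have "J k \<subseteq> J l" if "k \<le> l" for k l
    proof -
      have "b * tanh (real (Suc k)) \<le> b * tanh (real (Suc l))"
        using that b by (intro mult_left_mono) simp_all
      then show ?thesis by (auto simp: J)
    qed
    then show "incseq (\<lambda>k s. h s * indicator (J k) s)"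
      by (intro monoI le_funI mult_left_mono) (auto simp: indicator_def)
    show "(\<lambda>s. h s * indicator (J k) s) \<in> borel_measurable lborel" for k
      unfolding J_def by measurable
  qed
  also have "\<dots> = (SUP k. \<integral>\<^sup>+\<rho>. h (g \<rho>) * ennreal (b * (1 - (tanh \<rho>)\<^sup>2)) * indicator (I k) \<rho> \<partial>lborel)"
  proof (rule SUP_cong[OF refl])
    fix k
    show "(\<integral>\<^sup>+s. h s * indicator (J k) s \<partial>lborel) =
        (\<integral>\<^sup>+\<rho>. h (g \<rho>) * ennreal (b * (1 - (tanh \<rho>)\<^sup>2)) * indicator (I k) \<rho> \<partial>lborel)"
      unfolding I_def J_def
    proof (rule nn_integral_substitution_aux)
      show "(g has_real_derivative b * (1 - (tanh \<rho>)\<^sup>2)) (at \<rho>)" for \<rho>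
        unfolding g_def by (auto intro!: derivative_eq_intros)
      show "continuous_on {- real (Suc k)..real (Suc k)} (\<lambda>\<rho>. b * (1 - (tanh \<rho>)\<^sup>2))"
        by (intro continuous_intros) auto
      show "b * (1 - (tanh \<rho>)\<^sup>2) \<ge> 0" for \<rho>
        using b tanh2[of \<rho>] by simp
    qed auto
  qed
  also have "\<dots> = (\<integral>\<^sup>+\<rho>. (SUP k. h (g \<rho>) * ennreal (b * (1 - (tanh \<rho>)\<^sup>2)) * indicator (I k) \<rho>) \<partial>lborel)"
  proof (rule nn_integral_monotone_convergence_SUP[symmetric])
    show "incseq (\<lambda>k \<rho>. h (g \<rho>) * ennreal (b * (1 - (tanh \<rho>)\<^sup>2)) * indicator (I k) \<rho>)"
      by (intro monoI le_funI mult_left_mono) (auto simp: I_def indicator_def)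
    show "(\<lambda>\<rho>. h (g \<rho>) * ennreal (b * (1 - (tanh \<rho>)\<^sup>2)) * indicator (I k) \<rho>) \<in> borel_measurable lborel" for k
      unfolding I_def by measurable
  qed
  also have "\<dots> = (\<integral>\<^sup>+\<rho>. h (g \<rho>) * ennreal (b * (1 - (tanh \<rho>)\<^sup>2)) \<partial>lborel)"
  proof (rule nn_integral_cong)
    fix \<rho>
    let ?c = "h (g \<rho>) * ennreal (b * (1 - (tanh \<rho>)\<^sup>2))"
    obtain k where "\<bar>\<rho>\<bar> \<le> real k" using real_arch_simple by blast
    then have "?c \<le> (SUP k. ?c * indicator (I k) \<rho>)"
      by (intro SUP_upper2[of k]) (auto simp: I_def indicator_def)
    moreover have "(SUP k. ?c * indicator (I k) \<rho>) \<le> ?c"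
      by (intro SUP_least) (simp add: indicator_def)
    ultimately show "(SUP k. ?c * indicator (I k) \<rho>) = ?c" by (rule antisym[rotated])
  qed
  finally show ?thesis by (simp add: g_def)
qed

lemma measurable_sgn [measurable]: "sgn \<in> borel_measurable (borel :: 'a::euclidean_space measure)"
  unfolding sgn_div_norm[abs_def] by measurable

lemma nn_integral_sphere_measure:
  fixes g :: "'a::euclidean_space \<Rightarrow> ennreal"
  assumes [measurable]: "g \<in> borel_measurable borel"
  shows "(\<integral>\<^sup>+u. g u \<partial>sphere_measure) = of_nat DIM('a) * (\<integral>\<^sup>+x. g (sgn x) * indicator (ball 0 1) x \<partial>lborel)"
proof -
  have [measurable]: "sgn \<in> measurable (restrict_space lborel (ball (0 :: 'a) 1)) borel"
    by (intro measurable_restrict_space1) simp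
  show ?thesis
    unfolding sphere_measure_def
    by (simp add: nn_integral_scale_measure nn_integral_distr nn_integral_restrict_space)
qed

text \<open>At fixed \<open>y\<close> the substitution \<open>s = |y| tanh \<rho>\<close> puts
  \<open>(y, s)\<close> on the ray through \<open>(cosh \<rho> sgn y, sinh \<rho>)\<close>, where
  membership in the cone \<open>E\<close> can be read off. Scaling \<open>y = cosh \<rho> x\<close>
  turns the condition \<open>w \<star> w < 1\<close> into \<open>|x| < 1\<close>, which is the ball
  that defines \<open>sphere_measure\<close>.\<close>

lemma dual_measure_polar_coordinates:
  fixes E :: "('a::euclidean_space \<times> real) set"
  assumes [measurable]: "E \<in> sets borel"
    and cone: "\<And>t w. t > 0 \<Longrightarrow> t *\<^sub>R w \<in> E \<longleftrightarrow> w \<in> E"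
  shows "of_nat DIM('a) * emeasure dual_measure E =
    (\<integral>\<^sup>+u. \<integral>\<^sup>+\<rho>. indicator E (cosh \<rho> *\<^sub>R u, sinh \<rho>) * ennreal (cosh \<rho> ^ (DIM('a) - 1)) \<partial>lborel \<partial>sphere_measure)"
proof -
  let ?d = "DIM('a)"
  have [measurable]: "(\<lambda>\<rho>::real. cosh \<rho>) \<in> borel_measurable borel" "(\<lambda>\<rho>::real. sinh \<rho>) \<in> borel_measurable borel"
    by (intro borel_measurable_continuous_onI continuous_intros)+
  have cosh1: "cosh \<rho> > 0" for \<rho> :: real by simp
  have inner: "(\<integral>\<^sup>+s. dual_weight (y, s) * indicator E (y, s) \<partial>lborel) =
      (\<integral>\<^sup>+\<rho>. indicator E (cosh \<rho> *\<^sub>R sgn y, sinh \<rho>) * indicator {..<cosh \<rho>} (norm y) * ennreal (1 / cosh \<rho>) \<partial>lborel)"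
    if "y \<noteq> 0" for y :: 'a
  proof -
    define b where "b = norm y"
    have b: "b > 0" using that by (simp add: b_def)
    define h where "h s = dual_weight (y, s) * indicator E (y, s)" for s
    have [measurable]: "h \<in> borel_measurable borel"
      unfolding h_def[abs_def] by measurable
    have mk: "(y, s) \<star> (y, s) = b\<^sup>2 - s\<^sup>2" for s
      by (simp add: minkowski_self b_def)
    have "h s = h s * indicator {-b<..<b} s" for s
    proof (cases "\<bar>s\<bar> < b")
      case False
      then have "\<not> s\<^sup>2 < b\<^sup>2" using b abs_le_square_iff[of b s] by simp
      then show ?thesis by (simp add: h_def dual_weight_def mk)
    qed (auto simp: indicator_def)
    then have "(\<integral>\<^sup>+s. h s \<partial>lborel) = (\<integral>\<^sup>+s. h s * indicator {-b<..<b} s \<partial>lborel)"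
      by simp
    also have "\<dots> = (\<integral>\<^sup>+\<rho>. h (b * tanh \<rho>) * ennreal (b * (1 - (tanh \<rho>)\<^sup>2)) \<partial>lborel)"
      by (rule nn_integral_tanh_substitution) (use b in auto)
    also have "\<dots> = (\<integral>\<^sup>+\<rho>. indicator E (cosh \<rho> *\<^sub>R sgn y, sinh \<rho>) * indicator {..<cosh \<rho>} (norm y) * ennreal (1 / cosh \<rho>) \<partial>lborel)"
    proof (rule nn_integral_cong)
      fix \<rho> :: real
      have sech: "1 - (tanh \<rho>)\<^sup>2 = 1 / (cosh \<rho>)\<^sup>2"
      proof -
        have "1 - (tanh \<rho>)\<^sup>2 = ((cosh \<rho>)\<^sup>2 - (sinh \<rho>)\<^sup>2) / (cosh \<rho>)\<^sup>2"
          by (simp add: tanh_def power_divide diff_divide_distrib)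
        then show ?thesis by (simp add: cosh_square_eq)
      qed
      have sq: "b\<^sup>2 - (b * tanh \<rho>)\<^sup>2 = (b / cosh \<rho>)\<^sup>2"
      proof -
        have "b\<^sup>2 - (b * tanh \<rho>)\<^sup>2 = b\<^sup>2 * (1 - (tanh \<rho>)\<^sup>2)"
          by (simp add: power_mult_distrib right_diff_distrib)
        then show ?thesis unfolding sech by (simp add: power_divide)
      qed
      have vec: "(y, b * tanh \<rho>) = (b / cosh \<rho>) *\<^sub>R (cosh \<rho> *\<^sub>R sgn y, sinh \<rho>)"
        using b by (simp add: tanh_def b_def sgn_div_norm)
      have "indicator E (y, b * tanh \<rho>) = (indicator E (cosh \<rho> *\<^sub>R sgn y, sinh \<rho>) :: ennreal)"
        unfolding vec using b cone[of "b / cosh \<rho>"] by (simp add: indicator_def del: scaleR_Pair)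
      moreover have "dual_weight (y, b * tanh \<rho>) = indicator {..<cosh \<rho>} (norm y) * ennreal (cosh \<rho> / b)"
      proof -
        have "-1 < b / cosh \<rho>"
          using divide_pos_pos[OF b cosh1[of \<rho>]] by linarith
        then have "(b / cosh \<rho>)\<^sup>2 < 1 \<longleftrightarrow> b < cosh \<rho>"
          by (simp add: power2_less_1_iff)
        then show ?thesis
          using b unfolding dual_weight_def mk sq by (simp add: b_def[symmetric])
      qed
      moreover have "ennreal (1 / cosh \<rho>) = ennreal (cosh \<rho> / b) * ennreal (b * (1 - (tanh \<rho>)\<^sup>2))"
        unfolding sech using b by (simp add: power2_eq_square flip: ennreal_mult)
      ultimately show "h (b * tanh \<rho>) * ennreal (b * (1 - (tanh \<rho>)\<^sup>2)) =
          indicator E (cosh \<rho> *\<^sub>R sgn y, sinh \<rho>) * indicator {..<cosh \<rho>} (norm y) * ennreal (1 / cosh \<rho>)"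
        unfolding h_def by (simp only: mult_ac)
    qed
    finally show ?thesis by (simp add: h_def)
  qed
  have [measurable]: "(\<lambda>x. indicator {..<cosh (fst x)} (norm (snd x)) :: ennreal) \<in> borel_measurable (borel \<Otimes>\<^sub>M (borel :: 'a measure))"
    "(\<lambda>x. indicator {..<cosh (snd x)} (norm (fst x)) :: ennreal) \<in> borel_measurable ((borel :: 'a measure) \<Otimes>\<^sub>M borel)"
    unfolding indicator_def lessThan_iff by measurable
  have "emeasure dual_measure E = (\<integral>\<^sup>+y. \<integral>\<^sup>+s. dual_weight (y, s) * indicator E (y, s) \<partial>lborel \<partial>lborel)"
    unfolding emeasure_dual_measure[OF assms(1)] by (rule nn_integral_lborel_prod_iterated) measurable
  also have "\<dots> = (\<integral>\<^sup>+y. \<integral>\<^sup>+\<rho>. indicator E (cosh \<rho> *\<^sub>R sgn y, sinh \<rho>) *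
      indicator {..<cosh \<rho>} (norm y) * ennreal (1 / cosh \<rho>) \<partial>lborel \<partial>lborel)"
  proof (rule nn_integral_cong_AE)
    have "AE y in lborel. y \<noteq> (0::'a)"
      by (rule AE_lborel_singleton)
    then show "AE y in lborel. (\<integral>\<^sup>+s. dual_weight (y :: 'a, s) * indicator E (y, s) \<partial>lborel) =
        (\<integral>\<^sup>+\<rho>. indicator E (cosh \<rho> *\<^sub>R sgn y, sinh \<rho>) * indicator {..<cosh \<rho>} (norm y) * ennreal (1 / cosh \<rho>) \<partial>lborel)"
      by eventually_elim (rule inner)
  qed
  also have "\<dots> = (\<integral>\<^sup>+\<rho>. \<integral>\<^sup>+y. indicator E (cosh \<rho> *\<^sub>R sgn y, sinh \<rho>) *
      indicator {..<cosh \<rho>} (norm y) * ennreal (1 / cosh \<rho>) \<partial>lborel \<partial>lborel)"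
    by (rule lborel_pair.Fubini') measurable
  also have "\<dots> = (\<integral>\<^sup>+\<rho>. \<integral>\<^sup>+x. indicator E (cosh \<rho> *\<^sub>R sgn x, sinh \<rho>) * indicator (ball 0 1) x *
       ennreal (cosh \<rho> ^ (?d - 1)) \<partial>lborel \<partial>lborel)"
  proof (rule nn_integral_cong)
    fix \<rho> :: real
    let ?G = "\<lambda>y::'a. indicator E (cosh \<rho> *\<^sub>R sgn y, sinh \<rho>) * indicator {..<cosh \<rho>} (norm y) * ennreal (1 / cosh \<rho>)"
    have pow: "ennreal (cosh \<rho> ^ ?d) * ennreal (1 / cosh \<rho>) = ennreal (cosh \<rho> ^ (?d - 1))"
    proof -
      have "cosh \<rho> ^ ?d = cosh \<rho> ^ (?d - 1) * cosh \<rho>"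
        by (metis DIM_positive mult.commute power_minus_mult)
      then show ?thesis by (simp flip: ennreal_mult)
    qed
    have "(\<integral>\<^sup>+y. ?G y \<partial>lborel) = ennreal (cosh \<rho> ^ ?d) * (\<integral>\<^sup>+x. ?G (cosh \<rho> *\<^sub>R x) \<partial>lborel)"
      by (rule nn_integral_lborel_scale) simp_all
    also have "\<dots> = (\<integral>\<^sup>+x. ennreal (cosh \<rho> ^ ?d) * ?G (cosh \<rho> *\<^sub>R x) \<partial>lborel)"
      by (rule nn_integral_cmult[symmetric]) measurable
    also have "\<dots> = (\<integral>\<^sup>+x. indicator E (cosh \<rho> *\<^sub>R sgn x, sinh \<rho>) * indicator (ball 0 1) x *
       ennreal (cosh \<rho> ^ (?d - 1)) \<partial>lborel)"
      unfolding pow[symmetric]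
      by (intro nn_integral_cong) (simp add: sgn_scaleR indicator_def)
    finally show "(\<integral>\<^sup>+y. ?G y \<partial>lborel) = (\<integral>\<^sup>+x. indicator E (cosh \<rho> *\<^sub>R sgn x, sinh \<rho>) * indicator (ball 0 1) x *
       ennreal (cosh \<rho> ^ (?d - 1)) \<partial>lborel)" .
  qed
  also have "\<dots> = (\<integral>\<^sup>+x. \<integral>\<^sup>+\<rho>. indicator E (cosh \<rho> *\<^sub>R sgn x, sinh \<rho>) * indicator (ball 0 1) x *
       ennreal (cosh \<rho> ^ (?d - 1)) \<partial>lborel \<partial>lborel)"
  proof -
    have [measurable]: "ball (0::'a) 1 \<in> sets borel" by simp
    show ?thesis by (rule lborel_pair.Fubini'[symmetric]) measurable
  qed
  also have "\<dots> = (\<integral>\<^sup>+x. (\<integral>\<^sup>+\<rho>. indicator E (cosh \<rho> *\<^sub>R sgn x, sinh \<rho>) *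
       ennreal (cosh \<rho> ^ (?d - 1)) \<partial>lborel) * indicator (ball 0 1) x \<partial>lborel)"
    by (intro nn_integral_cong) (simp add: indicator_def)
  moreover have "(\<lambda>u. \<integral>\<^sup>+\<rho>. indicator E (cosh \<rho> *\<^sub>R u, sinh \<rho>) *
       ennreal (cosh \<rho> ^ (?d - 1)) \<partial>lborel) \<in> borel_measurable borel"
    by measurable
  ultimately show ?thesis
    by (simp only: nn_integral_sphere_measure)
qed

lemma sphere_measure_sets [simp, measurable_cong]: "sets sphere_measure = sets borel"
  by (simp add: sphere_measure_def)

lemma space_sphere_measure [simp]: "space sphere_measure = UNIV"
  using sets_eq_imp_space_eq[OF sphere_measure_sets] by simp

lemma AE_sphere_measure: "AE u in (sphere_measure :: 'a::euclidean_space measure). norm u = 1"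
proof -
  have "(\<integral>\<^sup>+u. indicator {u::'a. norm u \<noteq> 1} u \<partial>sphere_measure) = 0"
  proof (subst nn_integral_sphere_measure)
    have "(\<integral>\<^sup>+x. indicator {u::'a. norm u \<noteq> 1} (sgn x) * indicator (ball 0 1) x \<partial>lborel) = (\<integral>\<^sup>+x. 0 \<partial>(lborel :: 'a measure))"
    proof (rule nn_integral_cong_AE)
      have "AE x in lborel. x \<noteq> (0::'a)"
        by (rule AE_lborel_singleton)
      then show "AE x in lborel. indicator {u::'a. norm u \<noteq> 1} (sgn x) * indicator (ball 0 1) x = (0::ennreal)"
        by eventually_elim (simp add: norm_sgn)
    qed
    then show "of_nat DIM('a) * (\<integral>\<^sup>+x. indicator {u::'a. norm u \<noteq> 1} (sgn x) * indicator (ball 0 1) x \<partial>lborel) = 0"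
      by simp
  qed measurable
  then have "emeasure sphere_measure {u::'a. norm u \<noteq> 1} = 0"
    by (subst (asm) nn_integral_indicator) (auto simp: sphere_measure_def)
  then show ?thesis
    by (intro AE_I[where N = "{u. norm u \<noteq> 1}"]) (auto simp: sphere_measure_def)
qed

lemma emeasure_sphere_measure_finite: "emeasure (sphere_measure :: 'a::euclidean_space measure) UNIV < top"
proof -
  have "emeasure (sphere_measure :: 'a measure) UNIV = (\<integral>\<^sup>+u. 1 \<partial>(sphere_measure :: 'a measure))"
    by simp
  also have "\<dots> = of_nat DIM('a) * emeasure lborel (ball (0::'a) 1)"
    by (subst nn_integral_sphere_measure) (auto simp: space_borel)
  also have "\<dots> < top"
    using emeasure_lborel_ball_finite[of "0::'a" 1]
    by (auto simp: ennreal_mult_less_top of_nat_less_top)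
  finally show ?thesis .
qed

section \<open>Finiteness of the crossing measure and its relation to the quermassintegral\<close>

lemma compact_subset_hyp_space:
  fixes K :: "('a::euclidean_space \<times> real) set"
  assumes "closed K" "K \<subseteq> hyp_space" and R: "\<And>x. x \<in> K \<Longrightarrow> snd x \<le> R"
  shows "compact K"
proof -
  have "norm x \<le> R + R" if "x \<in> K" for x
  proof -
    have "x \<in> hyp_space" using that assms(2) by blast
    then have "norm (fst x) < snd x" "snd x > 0"
      by (auto intro: norm_fst_less_snd hyp_space_snd_pos)
    moreover have "norm x \<le> norm (fst x) + norm (snd x)"
      by (metis norm_Pair_le prod.collapse)
    ultimately show ?thesis using R[OF that] by simp
  qed
  then show ?thesis
    using assms(1) unfolding compact_eq_bounded_closed bounded_iff by blast
qed

lemma crossing_spacelike: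
  assumes "K \<subseteq> hyp_space" "w \<in> crossing K"
  shows "\<bar>snd w\<bar> < norm (fst w)"
proof -
  have *: "snd w < norm (fst w)" if "x \<in> K" "w \<star> x > 0" for x and w :: "'a \<times> real"
  proof -
    have x: "norm (fst x) < snd x" "snd x > 0"
      using that assms(1) by (auto intro: norm_fst_less_snd hyp_space_snd_pos)
    have "snd w * snd x < fst w \<bullet> fst x"
      using that by (simp add: minkowski_def)
    also have "\<dots> \<le> norm (fst w) * norm (fst x)"
      by (rule norm_cauchy_schwarz)
    also have "\<dots> \<le> norm (fst w) * snd x"
      using x by (intro mult_left_mono) auto
    finally show ?thesis using x by simp
  qed
  show ?thesis
    using assms(2) *[of _ w] *[of _ "- w"] by (auto simp: crossing_def minkowski_simps abs_less_iff)
qed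

text \<open>On the side of the hyperplane away from the origin every point is higher than the foot
  of the perpendicular from the origin, which has height \<open>cosh \<rho>\<close>. A crossed set
  has a point there.\<close>

lemma crossing_cosh_less:
  assumes K: "K \<subseteq> hyp_space" "\<And>x. x \<in> K \<Longrightarrow> snd x \<le> R"
    and u: "norm u = 1" and w: "(cosh \<rho> *\<^sub>R u, sinh \<rho>) \<in> crossing K"
  shows "cosh \<rho> < R"
proof -
  have *: "cosh \<rho> < R" if "x \<in> K" "(cosh \<rho> *\<^sub>R u, sinh \<rho>) \<star> x > 0" "\<rho> \<ge> 0" "norm u = 1" for x \<rho> and u :: 'a
  proof -
    define a s where "a = norm (fst x)" and "s = snd x"
    have x: "s > 0" "s\<^sup>2 = 1 + a\<^sup>2" "a \<ge> 0"
      using that K(1) hyp_space_self[of x] by (auto simp: hyp_space_snd_pos a_def s_def minkowski_self)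
    have "sinh \<rho> * s < cosh \<rho> * (u \<bullet> fst x)"
      using that by (simp add: minkowski_def s_def)
    also have "\<dots> \<le> cosh \<rho> * a"
      using norm_cauchy_schwarz[of u "fst x"] that by (intro mult_left_mono) (auto simp: a_def)
    finally have "(sinh \<rho> * s)\<^sup>2 < (cosh \<rho> * a)\<^sup>2"
      using that x by (intro power_strict_mono) auto
    then have "(sinh \<rho>)\<^sup>2 * s\<^sup>2 < (1 + (sinh \<rho>)\<^sup>2) * (s\<^sup>2 - 1)"
      using x by (simp add: power_mult_distrib cosh_square_eq add.commute)
    then have "(cosh \<rho>)\<^sup>2 < s\<^sup>2"
      by (simp add: cosh_square_eq algebra_simps)
    then have "cosh \<rho> < s"
      by (rule power2_less_imp_less) (use x(1) in simp)
    then show ?thesis using K(2)[OF that(1)] by (simp add: s_def)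
  qed
  show ?thesis
  proof (cases "\<rho> \<ge> 0")
    case True
    then show ?thesis using w u * by (auto simp: crossing_def)
  next
    case False
    obtain x where "x \<in> K" "(cosh \<rho> *\<^sub>R u, sinh \<rho>) \<star> x < 0"
      using w by (auto simp: crossing_def)
    moreover from this have "(cosh (- \<rho>) *\<^sub>R (- u), sinh (- \<rho>)) \<star> x > 0"
      by (simp add: minkowski_def)
    ultimately show ?thesis using *[of x "- \<rho>" "- u"] u False by simp
  qed
qed

lemma emeasure_dual_crossing_finite:
  fixes K :: "('a::euclidean_space \<times> real) set"
  assumes K: "K \<subseteq> hyp_space" "\<And>x. x \<in> K \<Longrightarrow> snd x \<le> R"
  shows "crossing_vol K < top"
proof -
  let ?n = "DIM('a) - 1"
  \<comment> \<open>The maximum keeps the argument in the domain of \<open>arcosh\<close> even if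
    \<open>K\<close> is empty and \<open>R\<close> is less than 1.\<close>
  define T where "T = arcosh (max 1 R)"
  have T: "T \<ge> 0" "cosh T = max 1 R" by (simp_all add: T_def)
  have "of_nat DIM('a) * crossing_vol K =
    (\<integral>\<^sup>+u. \<integral>\<^sup>+\<rho>. indicator (crossing K) (cosh \<rho> *\<^sub>R u, sinh \<rho>) * ennreal (cosh \<rho> ^ ?n) \<partial>lborel \<partial>sphere_measure)"
    by (rule dual_measure_polar_coordinates) (auto simp: crossing_scale)
  also have "\<dots> \<le> (\<integral>\<^sup>+u. \<integral>\<^sup>+\<rho>. ennreal (max 1 R ^ ?n) * indicator {-T..T} \<rho> \<partial>lborel \<partial>(sphere_measure :: 'a measure))"
  proof (rule nn_integral_mono_AE)
    show "AE u in (sphere_measure :: 'a measure).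
      (\<integral>\<^sup>+\<rho>. indicator (crossing K) (cosh \<rho> *\<^sub>R u, sinh \<rho>) * ennreal (cosh \<rho> ^ ?n) \<partial>lborel)
      \<le> (\<integral>\<^sup>+\<rho>. ennreal (max 1 R ^ ?n) * indicator {-T..T} \<rho> \<partial>lborel)"
      using AE_sphere_measure
    proof eventually_elim
      fix u :: 'a assume u: "norm u = 1"
      show "(\<integral>\<^sup>+\<rho>. indicator (crossing K) (cosh \<rho> *\<^sub>R u, sinh \<rho>) * ennreal (cosh \<rho> ^ ?n) \<partial>lborel)
      \<le> (\<integral>\<^sup>+\<rho>. ennreal (max 1 R ^ ?n) * indicator {-T..T} \<rho> \<partial>lborel)"
      proof (rule nn_integral_mono)
        fix \<rho> :: real
        show "indicator (crossing K) (cosh \<rho> *\<^sub>R u, sinh \<rho>) * ennreal (cosh \<rho> ^ ?n)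
          \<le> ennreal (max 1 R ^ ?n) * indicator {-T..T} \<rho>"
        proof (cases "(cosh \<rho> *\<^sub>R u, sinh \<rho>) \<in> crossing K")
          case True
          have "cosh \<rho> < R" using True crossing_cosh_less[of K R u \<rho>] K u by blast
          then have c: "cosh \<rho> \<le> max 1 R" by simp
          then have "cosh \<bar>\<rho>\<bar> \<le> cosh T" by (simp add: T)
          then have "\<bar>\<rho>\<bar> \<le> T"
            using T(1) cosh_real_nonneg_le_iff[of "\<bar>\<rho>\<bar>" T] abs_ge_zero[of \<rho>] by blast
          moreover have "cosh \<rho> ^ ?n \<le> max 1 R ^ ?n"
            by (intro power_mono c) simp
          ultimately show ?thesis
            using True by (auto simp: indicator_def intro!: ennreal_leI)
        qed simp
      qed
    qed
  qed
  also have "\<dots> = ennreal (max 1 R ^ ?n) * ennreal (T - (- T)) * emeasure (sphere_measure :: 'a measure) UNIV"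
    using T by (simp add: nn_integral_cmult mult.assoc)
  also have "\<dots> < top"
    using emeasure_sphere_measure_finite[where 'a = 'a] by (simp add: ennreal_mult_less_top)
  finally show ?thesis
    by (auto simp: ennreal_mult_less_top)
qed

text \<open>The hyperplanes orthogonal to one geodesic through the origin are ordered by their
  parameter: on the upper sheet the factor in front of the difference is positive.\<close>

lemma hyp_hyperplane_family:
  assumes "(cosh \<rho> *\<^sub>R u, sinh \<rho>) \<star> x = 0"
  shows "(cosh \<rho>' *\<^sub>R u, sinh \<rho>') \<star> x = cosh \<rho>' * snd x * (tanh \<rho> - tanh \<rho>')"
proof -
  have "u \<bullet> fst x = snd x * tanh \<rho>"
    using assms by (simp add: minkowski_def tanh_def field_simps)
  then show ?thesis
    by (simp add: minkowski_def tanh_def field_simps)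
qed

text \<open>In a fixed direction \<open>K\<close> is touched by at most one hyperplane from each
  side. Hence hitting without crossing happens for at most two parameters, a null set.\<close>

lemma finite_supporting_hyperplanes:
  assumes "K \<subseteq> hyp_space"
  shows "finite {\<rho>. \<exists>x\<in>K. (cosh \<rho> *\<^sub>R u, sinh \<rho>) \<star> x = 0 \<and> (cosh \<rho> *\<^sub>R u, sinh \<rho>) \<notin> crossing K}" (is "finite ?S")
proof -
  have sub: "?S \<subseteq> {\<rho>. \<exists>x\<in>K. (cosh \<rho> *\<^sub>R u, sinh \<rho>) \<star> x = 0 \<and> (\<forall>y\<in>K. (cosh \<rho> *\<^sub>R u, sinh \<rho>) \<star> y \<le> 0)} \<union>
    {\<rho>. \<exists>x\<in>K. (cosh \<rho> *\<^sub>R u, sinh \<rho>) \<star> x = 0 \<and> (\<forall>y\<in>K. (cosh \<rho> *\<^sub>R u, sinh \<rho>) \<star> y \<ge> 0)}" (is "_ \<subseteq> ?A \<union> ?B")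
    by (auto simp: crossing_def not_less)
  have single: "finite S" if "\<And>a b. a \<in> S \<Longrightarrow> b \<in> S \<Longrightarrow> \<not> a < b" for S :: "real set"
  proof (cases "S = {}")
    case False
    then obtain a where "a \<in> S" by blast
    then have "S \<subseteq> {a}" using that by (metis insertI1 linorder_neqE_linordered_idom subsetI)
    then show ?thesis by (rule finite_subset) simp
  qed simp
  have pos: "cosh \<rho> * snd x > 0" if "x \<in> K" for \<rho> x
    using that assms hyp_space_snd_pos by fastforce
  have "finite ?A"
  proof (rule single)
    fix a b assume a: "a \<in> ?A" and "b \<in> ?A"
    then obtain x where x: "x \<in> K" "(cosh b *\<^sub>R u, sinh b) \<star> x = 0" by auto
    then have "cosh a * snd x * (tanh b - tanh a) \<le> 0"
      using a by (auto simp flip: hyp_hyperplane_family)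
    then have "tanh b - tanh a \<le> 0"
      using pos[OF x(1), of a] by (metis mult_pos_pos not_le)
    then show "\<not> a < b" by simp
  qed
  moreover have "finite ?B"
  proof (rule single)
    fix a b assume "a \<in> ?B" and b: "b \<in> ?B"
    then obtain x where x: "x \<in> K" "(cosh a *\<^sub>R u, sinh a) \<star> x = 0" by auto
    then have "cosh b * snd x * (tanh a - tanh b) \<ge> 0"
      using b by (auto simp flip: hyp_hyperplane_family)
    then have "tanh a - tanh b \<ge> 0"
      using pos[OF x(1), of b] by (metis mult_pos_neg not_le)
    then show "\<not> a < b" by simp
  qed
  ultimately show ?thesis using sub by (meson finite_UnI finite_subset)
qed

text \<open>The set is a projection along the compact factor \<open>K\<close>. It provides the joint
  measurability of the integrand of the quermassintegral.\<close>

lemma closed_hitting_parameters: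
  fixes K :: "('a::euclidean_space \<times> real) set"
  assumes "compact K"
  shows "closed {(u :: 'a, \<rho>). \<exists>x\<in>K. (cosh \<rho> *\<^sub>R u, sinh \<rho>) \<star> x = 0}"
proof -
  define F where "F z = (case z of (x, u :: 'a, \<rho> :: real) \<Rightarrow> (cosh \<rho> *\<^sub>R u, sinh \<rho>) \<star> x)" for z :: "('a \<times> real) \<times> 'a \<times> real"
  have "continuous_on UNIV F"
    unfolding F_def case_prod_unfold by (intro continuous_intros)
  then have "closed {z. F z = 0}"
    by (intro closed_Collect_eq continuous_on_const)
  then have "closed {z. \<exists>x. x \<in> K \<and> (x, z) \<in> {z. F z = 0}}"
    by (rule closed_compact_projection[OF assms])
  moreover have "{z. \<exists>x. x \<in> K \<and> (x, z) \<in> {z. F z = 0}} =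
      {(u :: 'a, \<rho>). \<exists>x\<in>K. (cosh \<rho> *\<^sub>R u, sinh \<rho>) \<star> x = 0}"
    by (auto simp: F_def)
  ultimately show ?thesis by simp
qed

text \<open>A hyperplane crossing a connected set hits it by the intermediate value property;
  conversely, hitting the closure without crossing is a null event in \<open>\<rho>\<close>. The
  factor \<open>n + 1\<close> is the dimension factor of the polar coordinates.\<close>

lemma quermass_hyperplanes_eq_dual_measure:
  fixes \<Omega> :: "('a::euclidean_space \<times> real) set"
  assumes \<Omega>: "connected \<Omega>" "\<Omega> \<subseteq> hyp_space" "\<And>x. x \<in> \<Omega> \<Longrightarrow> snd x \<le> R"
    and n: "DIM('a) = n + 1"
  shows "quermass_hyperplanes n \<Omega> = real n / 2 * real (n + 1) * measure dual_measure (crossing \<Omega>)"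
proof -
  define K where "K = closure \<Omega>"
  have K: "K \<subseteq> hyp_space"
    unfolding K_def by (rule closure_minimal[OF \<Omega>(2) closed_hyp_space])
  have "K \<subseteq> {x. snd x \<le> R}"
    unfolding K_def by (rule closure_minimal) (use \<Omega>(3) in \<open>auto intro!: closed_Collect_le continuous_intros\<close>)
  then have KR: "\<And>x. x \<in> K \<Longrightarrow> snd x \<le> R" by blast
  then have "compact K"
    using K by (intro compact_subset_hyp_space) (auto simp: K_def)
  define W where "W u \<rho> = (cosh \<rho> *\<^sub>R u, sinh \<rho>)" for u :: 'a and \<rho> :: real
  define hit where "hit u \<rho> = (if \<exists>x\<in>K. W u \<rho> \<star> x = 0 then 1 else 0 :: real)" for u \<rho>
  have hit_def': "of_bool (hyp_hyperplane u \<rho> \<inter> closure \<Omega> \<noteq> {}) = hit u \<rho>" for u \<rho>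
  proof -
    have "hyp_hyperplane u \<rho> \<inter> closure \<Omega> \<noteq> {} \<longleftrightarrow> (\<exists>x\<in>K. W u \<rho> \<star> x = 0)"
      using K by (auto simp: hyp_hyperplane_def K_def W_def minkowski_commute)
    then show ?thesis by (simp add: hit_def)
  qed
  have "{z. \<exists>x\<in>K. W (fst z) (snd z) \<star> x = 0} \<in> sets borel"
    using closed_hitting_parameters[OF \<open>compact K\<close>]
    by (intro borel_closed) (simp add: W_def case_prod_unfold)
  then have [measurable]: "Measurable.pred (borel \<Otimes>\<^sub>M borel) (\<lambda>z. \<exists>x\<in>K. W (fst z) (snd z) \<star> x = 0)"
    by (simp add: pred_def borel_prod space_pair_measure)
  have hit_meas: "(\<lambda>z. hit (fst z) (snd z)) \<in> borel_measurable (borel \<Otimes>\<^sub>M borel)"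
    unfolding hit_def by measurable
  have [measurable]: "(\<lambda>z. hit (fst z) (snd z) * cosh (snd z) ^ n) \<in> borel_measurable (sphere_measure \<Otimes>\<^sub>M lborel)"
  proof -
    have [measurable]: "(\<lambda>\<rho>::real. cosh \<rho>) \<in> borel_measurable borel"
      by (intro borel_measurable_continuous_onI continuous_intros)
    note hit_meas [measurable]
    show ?thesis by measurable
  qed
  have slice [measurable]: "(\<lambda>\<rho>. hit u \<rho> * cosh \<rho> ^ n) \<in> borel_measurable lborel" for u
  proof -
    have "Pair u \<in> lborel \<rightarrow>\<^sub>M sphere_measure \<Otimes>\<^sub>M lborel"
      by (rule measurable_Pair1') simp
    from measurable_compose[OF this \<open>(\<lambda>z. hit (fst z) (snd z) * cosh (snd z) ^ n) \<in> _\<close>]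
    show ?thesis by simp
  qed
  have hit_nonneg: "hit u \<rho> * cosh \<rho> ^ n \<ge> 0" for u \<rho> by (simp add: hit_def)
  have hit_crossing: "AE \<rho> in lborel. ennreal (hit u \<rho> * cosh \<rho> ^ n) = indicator (crossing \<Omega>) (W u \<rho>) * ennreal (cosh \<rho> ^ n)" for u
  proof -
    have "AE \<rho> in lborel. \<rho> \<notin> {\<rho>. \<exists>x\<in>K. W u \<rho> \<star> x = 0 \<and> W u \<rho> \<notin> crossing K}"
      unfolding W_def by (intro AE_not_in finite_imp_null_set_lborel finite_supporting_hyperplanes K)
    then show ?thesis
    proof eventually_elim
      fix \<rho> assume *: "\<rho> \<notin> {\<rho>. \<exists>x\<in>K. W u \<rho> \<star> x = 0 \<and> W u \<rho> \<notin> crossing K}"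
      have "(\<exists>x\<in>K. W u \<rho> \<star> x = 0) \<longleftrightarrow> W u \<rho> \<in> crossing \<Omega>"
      proof
        assume "W u \<rho> \<in> crossing \<Omega>"
        then obtain x y where xy: "x \<in> \<Omega>" "y \<in> \<Omega>" "W u \<rho> \<star> x > 0" "W u \<rho> \<star> y < 0"
          by (auto simp: crossing_def)
        have "connected ((\<lambda>x. W u \<rho> \<star> x) ` \<Omega>)"
          by (intro connected_continuous_image continuous_intros \<Omega>(1))
        from connected_contains_Icc[OF this, of "W u \<rho> \<star> y" "W u \<rho> \<star> x"] xy
        have "0 \<in> (\<lambda>x. W u \<rho> \<star> x) ` \<Omega>" by auto
        then show "\<exists>x\<in>K. W u \<rho> \<star> x = 0"
          unfolding K_def using closure_subset by fastforce
      qed (use * in \<open>auto simp: K_def crossing_closure\<close>)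
      then show "ennreal (hit u \<rho> * cosh \<rho> ^ n) = indicator (crossing \<Omega>) (W u \<rho>) * ennreal (cosh \<rho> ^ n)"
        by (simp add: hit_def indicator_def)
    qed
  qed
  let ?I = "\<lambda>u. \<integral>\<^sup>+\<rho>. ennreal (hit u \<rho> * cosh \<rho> ^ n) \<partial>lborel"
  have I_meas [measurable]: "?I \<in> borel_measurable sphere_measure"
    by (rule lborel.borel_measurable_nn_integral) (simp add: case_prod_unfold)
  have total: "(\<integral>\<^sup>+u. ?I u \<partial>sphere_measure) = ennreal (real (n + 1)) * crossing_vol \<Omega>"
  proof -
    have "(\<integral>\<^sup>+u. ?I u \<partial>sphere_measure) =
        (\<integral>\<^sup>+u. \<integral>\<^sup>+\<rho>. indicator (crossing \<Omega>) (W u \<rho>) * ennreal (cosh \<rho> ^ n) \<partial>lborel \<partial>sphere_measure)"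
      by (intro nn_integral_cong nn_integral_cong_AE hit_crossing)
    also have "\<dots> = of_nat DIM('a) * crossing_vol \<Omega>"
      unfolding W_def using n
      by (subst dual_measure_polar_coordinates) (auto simp: crossing_scale)
    finally show ?thesis by (simp only: n ennreal_of_nat_eq_real_of_nat)
  qed
  have fin: "crossing_vol \<Omega> < top"
    by (rule emeasure_dual_crossing_finite[OF \<Omega>(2,3)])
  \<comment> \<open>A divergent inner integral would get the default value 0 as a real integral.
    Finiteness of the total excludes this for almost every \<open>u\<close>.\<close>
  have "AE u in sphere_measure. ?I u \<noteq> \<infinity>"
    by (rule nn_integral_PInf_AE[OF I_meas]) (use fin in \<open>simp add: total ennreal_mult_eq_top_iff\<close>)
  then have "(\<integral>\<^sup>+u. ennreal (enn2real (?I u)) \<partial>sphere_measure) = (\<integral>\<^sup>+u. ?I u \<partial>sphere_measure)"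
    by (intro nn_integral_cong_AE) (auto simp: ennreal_enn2real_if)
  moreover have "(LINT u|sphere_measure. LINT \<rho>|lborel. hit u \<rho> * cosh \<rho> ^ n) =
      enn2real (\<integral>\<^sup>+u. ennreal (enn2real (?I u)) \<partial>sphere_measure)"
    using hit_nonneg slice by (subst integral_eq_nn_integral) (simp_all add: integral_eq_nn_integral)
  ultimately show ?thesis
    unfolding quermass_hyperplanes_def hit_def' total
    by (simp add: enn2real_mult measure_def del: of_nat_Suc of_nat_add)
qed

section \<open>Geodesic balls\<close>

text \<open>Balls are indexed by \<open>c = cosh r\<close>, so that membership is linear in the
  Minkowski product. For a centre in \<open>hyp_space\<close>, \<open>c = 1\<close> gives the empty
  open ball and the one-point closed ball.\<close>

definition hball :: "'a::euclidean_space \<times> real \<Rightarrow> real \<Rightarrow> ('a \<times> real) set" where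
  "hball p c = {q \<in> hyp_space. - (p \<star> q) < c}"

definition hcball :: "'a::euclidean_space \<times> real \<Rightarrow> real \<Rightarrow> ('a \<times> real) set" where
  "hcball p c = {q \<in> hyp_space. - (p \<star> q) \<le> c}"

lemma hyp_ball_eq_hball:
  assumes "p \<in> hyp_space" "r > 0"
  shows "hyp_ball p r = hball p (cosh r)"
proof -
  have "hyp_dist p q < r \<longleftrightarrow> - (p \<star> q) < cosh r" if "q \<in> hyp_space" for q
  proof -
    have "- (p \<star> q) \<ge> 1"
      using minkowski_le_minus_one(1)[OF assms(1) that] by simp
    then show ?thesis
      using arcosh_less_iff_real[of "- (p \<star> q)" "cosh r"] assms(2)
      by (simp add: hyp_dist_def arcosh_cosh_real cosh_real_ge_1)
  qed
  then show ?thesis by (auto simp: hyp_ball_def hball_def)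
qed

lemma is_geodesic_ball_iff: "is_geodesic_ball B \<longleftrightarrow> (\<exists>p\<in>hyp_space. \<exists>c>1. B = hball p c)"
proof
  assume "is_geodesic_ball B"
  then obtain p r where "p \<in> hyp_space" "r > 0" "B = hball p (cosh r)"
    unfolding is_geodesic_ball_def by (metis hyp_ball_eq_hball)
  moreover have "cosh r > 1"
    using cosh_real_strict_mono[of 0 r] \<open>r > 0\<close> by simp
  ultimately show "\<exists>p\<in>hyp_space. \<exists>c>1. B = hball p c" by blast
next
  assume "\<exists>p\<in>hyp_space. \<exists>c>1. B = hball p c"
  then obtain p c where pc: "p \<in> hyp_space" "c > 1" "B = hball p c" by blast
  then have "arcosh c > 0" "cosh (arcosh c) = c" by simp_all
  then show "is_geodesic_ball B"
    unfolding is_geodesic_ball_def using pc hyp_ball_eq_hball[of p "arcosh c"]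
    by (intro bexI[of _ p] exI[of _ "arcosh c"] conjI) (auto simp del: arcosh_real_gt_1_iff)
qed

lemma hball_subset: "hball p c \<subseteq> hyp_space" "hcball p c \<subseteq> hyp_space" "hball p c \<subseteq> hcball p c"
  by (auto simp: hball_def hcball_def)

lemma openin_hball: "openin (top_of_set hyp_space) (hball p c)"
proof -
  have "hball p c = hyp_space \<inter> {q. - (p \<star> q) < c}" by (auto simp: hball_def)
  moreover have "open {q. - (p \<star> q) < c}"
    by (intro open_Collect_less continuous_intros)
  ultimately show ?thesis by (auto simp: openin_open)
qed

lemma closed_hcball: "closed (hcball p c)"
proof -
  have "hcball p c = hyp_space \<inter> {q. - (p \<star> q) \<le> c}" by (auto simp: hcball_def)
  moreover have "closed {q. - (p \<star> q) \<le> c}"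
    by (intro closed_Collect_le continuous_intros)
  ultimately show ?thesis using closed_hyp_space by (auto intro: closed_Int)
qed

lemma hcball_snd_bounded:
  assumes "p \<in> hyp_space" "x \<in> hcball p c"
  shows "snd x \<le> c / (snd p - norm (fst p))"
proof -
  have x: "norm (fst x) < snd x" "snd x > 0" "x \<in> hyp_space"
    using assms(2) by (auto simp: hcball_def intro: norm_fst_less_snd hyp_space_snd_pos)
  have p: "norm (fst p) < snd p" using assms(1) by (rule norm_fst_less_snd)
  have "snd p * snd x - fst p \<bullet> fst x \<le> c"
    using assms(2) by (simp add: hcball_def minkowski_def)
  moreover have "fst p \<bullet> fst x \<le> norm (fst p) * norm (fst x)"
    by (rule norm_cauchy_schwarz)
  moreover have "norm (fst p) * norm (fst x) \<le> norm (fst p) * snd x"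
    using x by (intro mult_left_mono) auto
  ultimately have "snd x * (snd p - norm (fst p)) \<le> c"
    by (simp add: algebra_simps)
  then show ?thesis using p by (simp add: pos_le_divide_eq)
qed

lemma compact_hcball: "p \<in> hyp_space \<Longrightarrow> compact (hcball p c)"
  by (rule compact_subset_hyp_space[OF closed_hcball hball_subset(2)]) (rule hcball_snd_bounded)

lemma minkowski_origin: "(0, 1) \<star> q = - snd q"
  by (simp add: minkowski_def)

lemma hcball_origin: "hcball (0, 1) c = {q \<in> hyp_space. snd q \<le> c}"
  by (simp add: hcball_def minkowski_origin)

lemma reflect_hball:
  assumes "e \<star> e = 1"
  shows "reflect e ` hball p c = hball (reflect e p) c" "reflect e ` hcball p c = hcball (reflect e p) c"
  using assms by (auto simp: reflect_image_iff hball_def hcball_def minkowski_reflect_right)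

lemma crossing_reflect:
  assumes "e \<star> e = 1"
  shows "crossing (reflect e ` K) = reflect e -` crossing K"
  using assms by (auto simp: crossing_def minkowski_reflect_right)

lemma emeasure_crossing_reflect:
  assumes "e \<star> e = 1"
  shows "crossing_vol (reflect e ` K) = crossing_vol K"
  using assms by (simp add: crossing_reflect emeasure_dual_measure_reflect)

text \<open>A single reflection carries \<open>q\<close> to \<open>p\<close>. Properties of balls
  can thus be checked for the centre \<open>(0, 1)\<close> only.\<close>

lemma hyp_space_homogeneous:
  assumes "p \<in> hyp_space" and refl: "P q" "q \<in> hyp_space"
    and step: "\<And>e p. e \<star> e = 1 \<Longrightarrow> p \<in> hyp_space \<Longrightarrow> P p \<Longrightarrow> P (reflect e p)"
  shows "P p"
proof (cases "p = q")
  case False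
  then show ?thesis
    using step[OF bisector_unit, of q p q] assms reflect_bisector[of q p] by auto
qed (use refl in simp)

lemma hball_borel [measurable]: "hball p c \<in> sets borel" "hcball p c \<in> sets borel"
proof -
  obtain U where "open U" "hball p c = hyp_space \<inter> U"
    using openin_hball[of p c] by (auto simp: openin_open)
  then show "hball p c \<in> sets borel"
    using borel_closed[OF closed_hyp_space] by auto
qed (rule borel_closed[OF closed_hcball])

lemma emeasure_hcball_center:
  fixes p :: "'a::euclidean_space \<times> real"
  assumes "p \<in> hyp_space"
  shows "hvol (hcball p c) = hvol (hcball (0 :: 'a, 1) c)"
    and "hvol (hball p c) = hvol (hball (0 :: 'a, 1) c)"
    and "crossing_vol (hcball p c) = crossing_vol (hcball (0 :: 'a, 1) c)"
proof -
  have "hvol (hcball p c) = hvol (hcball (0 :: 'a, 1) c) \<and>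
    hvol (hball p c) = hvol (hball (0 :: 'a, 1) c) \<and>
    crossing_vol (hcball p c) = crossing_vol (hcball (0 :: 'a, 1) c)"
    using assms
    by (rule hyp_space_homogeneous[where q = "(0 :: 'a, 1)"])
      (simp_all add: reflect_hball(1,2)[symmetric] emeasure_crossing_reflect
        emeasure_hyp_volume_measure_reflect[OF _ hball_borel(1) hball_subset(1)]
        emeasure_hyp_volume_measure_reflect[OF _ hball_borel(2) hball_subset(2)])
  then show "hvol (hcball p c) = hvol (hcball (0 :: 'a, 1) c)"
    and "hvol (hball p c) = hvol (hball (0 :: 'a, 1) c)"
    and "crossing_vol (hcball p c) = crossing_vol (hcball (0 :: 'a, 1) c)"
    by blast+
qed

section \<open>Balls about the origin in the graph coordinate\<close>

lemma snd_less_iff_norm_less: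
  assumes "c \<ge> 1"
  shows "sqrt (1 + (norm x)\<^sup>2) < c \<longleftrightarrow> norm x < sqrt (c\<^sup>2 - 1)"
    and "sqrt (1 + (norm x)\<^sup>2) \<le> c \<longleftrightarrow> norm x \<le> sqrt (c\<^sup>2 - 1)"
proof -
  have c: "c = sqrt (c\<^sup>2)" using assms by simp
  have n: "norm x = sqrt ((norm x)\<^sup>2)" by simp
  show "sqrt (1 + (norm x)\<^sup>2) < c \<longleftrightarrow> norm x < sqrt (c\<^sup>2 - 1)"
    by (subst c, subst (2) n) (simp only: real_sqrt_less_iff, linarith)
  show "sqrt (1 + (norm x)\<^sup>2) \<le> c \<longleftrightarrow> norm x \<le> sqrt (c\<^sup>2 - 1)"
    by (subst c, subst (2) n) (simp only: real_sqrt_le_iff, linarith)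
qed

lemma hyp_space_graph_image: "hyp_space = range (\<lambda>x. (x, sqrt (1 + (norm x)\<^sup>2)))"
  by (auto simp: hyp_space_iff prod_eq_iff)

lemma hball_origin_graph:
  assumes "c \<ge> 1"
  shows "hball (0, 1) c = (\<lambda>x. (x, sqrt (1 + (norm x)\<^sup>2))) ` ball (0::'a::euclidean_space) (sqrt (c\<^sup>2 - 1))"
    and "hcball (0, 1) c = (\<lambda>x. (x, sqrt (1 + (norm x)\<^sup>2))) ` cball (0::'a::euclidean_space) (sqrt (c\<^sup>2 - 1))"
  by (auto simp: hball_def hcball_def minkowski_origin hyp_space_graph_image snd_less_iff_norm_less[OF assms])

lemma continuous_on_graph: "continuous_on S (\<lambda>x. (x, sqrt (1 + (norm x)\<^sup>2)))"
  by (intro continuous_intros)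

lemma connected_hball:
  assumes "p \<in> hyp_space" "c \<ge> 1"
  shows "connected (hball p c)"
  using assms(1)
proof (rule hyp_space_homogeneous[where q = "(0, 1)"])
  show "connected (hball (0, 1) c :: ('a \<times> real) set)"
    unfolding hball_origin_graph[OF assms(2)]
    by (intro connected_continuous_image continuous_on_graph connected_ball)
  show "connected (hball (reflect e p) c)" if "e \<star> e = 1" "connected (hball p c)" for e p :: "'a \<times> real"
    unfolding reflect_hball(1)[OF that(1), symmetric]
    by (intro connected_continuous_image continuous_on_reflect continuous_on_id that)
qed simp

text \<open>At the origin this is the closure of a Euclidean ball of positive radius, transported by
  the graph map and then by reflections.\<close>

lemma hcball_subset_closure:
  assumes "p \<in> hyp_space" "c > 1"
  shows "hcball p c \<subseteq> closure (hball p c)"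
  using assms(1)
proof (rule hyp_space_homogeneous[where q = "(0, 1)"])
  have "closure (ball (0::'a) (sqrt (c\<^sup>2 - 1))) = cball 0 (sqrt (c\<^sup>2 - 1))"
    using assms(2) by (intro closure_ball) simp
  then show "hcball (0, 1) c \<subseteq> closure (hball (0, 1) c :: ('a \<times> real) set)"
    using image_closure_subset[OF continuous_on_graph closed_closure closure_subset, of "ball (0::'a) (sqrt (c\<^sup>2 - 1))"]
    using assms(2) by (simp add: hball_origin_graph)
  show "hcball (reflect e p) c \<subseteq> closure (hball (reflect e p) c)"
    if "e \<star> e = 1" "hcball p c \<subseteq> closure (hball p c)" for e p :: "'a \<times> real"
  proof -
    have "reflect e ` hcball p c \<subseteq> reflect e ` closure (hball p c)"
      using that(2) by (rule image_mono)
    also have "\<dots> \<subseteq> closure (reflect e ` hball p c)"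
      by (rule image_closure_subset[OF _ closed_closure closure_subset])
        (intro continuous_on_reflect continuous_on_id)
    finally show ?thesis by (simp add: reflect_hball that(1))
  qed
qed simp

lemma crossing_hcball: "p \<in> hyp_space \<Longrightarrow> c > 1 \<Longrightarrow> crossing (hcball p c) = crossing (hball p c)"
  using crossing_mono[OF hcball_subset_closure[of p c]] crossing_mono[OF hball_subset(3)[of p c]]
  by (auto simp: crossing_closure)

text \<open>By rotational symmetry only the slope \<open>|snd w| / norm (fst w)\<close> matters; the
  bound \<open>sqrt (c^2 - 1) / c\<close> is the hyperbolic tangent of the radius. The sign change
  is witnessed by the two points of height \<open>c\<close> over plus and minus the direction of
  \<open>fst w\<close>.\<close>

lemma crossing_hcball_origin:
  assumes "c \<ge> 1"
  shows "crossing (hcball (0, 1) c) = {w. \<bar>snd w\<bar> * c < sqrt (c\<^sup>2 - 1) * norm (fst w)}"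
proof -
  define s where "s = sqrt (c\<^sup>2 - 1)"
  have s: "s \<ge> 0" "s\<^sup>2 = c\<^sup>2 - 1" using assms by (simp_all add: s_def)
  have *: "snd w * c < s * norm (fst w)"
    if "x \<in> hcball (0, 1) c" "w \<star> x > 0" for x and w :: "'a \<times> real"
  proof -
    have x: "norm (fst x) < snd x" "snd x > 0" "x \<in> hyp_space" "snd x \<le> c"
      using that by (auto simp: hcball_origin intro: norm_fst_less_snd hyp_space_snd_pos)
    then have sq: "(snd x)\<^sup>2 = 1 + (norm (fst x))\<^sup>2" by (simp add: hyp_space_iff)
    have "(snd x)\<^sup>2 \<le> c\<^sup>2"
      using x by (intro power_mono) auto
    then have "(c * norm (fst x))\<^sup>2 \<le> (s * snd x)\<^sup>2"
      using sq by (simp add: power_mult_distrib s algebra_simps)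
    then have le: "c * norm (fst x) \<le> s * snd x"
      by (rule power2_le_imp_le) (use s x in auto)
    have "snd w * snd x < fst w \<bullet> fst x"
      using that by (simp add: minkowski_def)
    also have "\<dots> \<le> norm (fst w) * norm (fst x)"
      by (rule norm_cauchy_schwarz)
    finally have "snd w * snd x * c < norm (fst w) * norm (fst x) * c"
      using assms by simp
    also have "\<dots> \<le> norm (fst w) * (s * snd x)"
      using mult_left_mono[OF le norm_ge_zero[of "fst w"]] by (simp add: mult_ac)
    finally show ?thesis using x(2) by (simp add: mult.commute mult.left_commute)
  qed
  have "w \<in> crossing (hcball (0, 1) c)" if "\<bar>snd w\<bar> * c < s * norm (fst w)" for w :: "'a \<times> real"
  proof -
    have "fst w \<noteq> 0" using that assms by (auto simp: mult_less_0_iff)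
    define u where "u = sgn (fst w)"
    have u: "norm u = 1" "fst w \<bullet> u = norm (fst w)"
      using \<open>fst w \<noteq> 0\<close> by (auto simp: u_def norm_sgn sgn_div_norm dot_square_norm power2_eq_square)
    have mem: "(t *\<^sub>R u, c) \<in> hcball (0, 1) c" if "t\<^sup>2 = s\<^sup>2" for t
      using that u assms by (simp add: hcball_origin hyp_space_iff s)
    have abs_c: "\<bar>snd w * c\<bar> = \<bar>snd w\<bar> * c"
      using assms by (simp add: abs_mult)
    have "w \<star> (s *\<^sub>R u, c) > 0" "w \<star> ((- s) *\<^sub>R u, c) < 0"
      using that u by (auto simp: minkowski_def abs_less_iff simp flip: abs_c)
    then show ?thesis
      using mem[of s] mem[of "- s"] by (auto simp: crossing_def)
  qed
  moreover have "\<bar>snd w\<bar> * c < s * norm (fst w)" if "w \<in> crossing (hcball (0, 1) c)" for w :: "'a \<times> real"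
    using that *[of _ w] *[of _ "- w"] by (auto simp: crossing_def minkowski_simps abs_if)
  ultimately show ?thesis by (auto simp: s_def)
qed

lemma emeasure_dual_measure_open_pos:
  fixes D :: "('a::euclidean_space \<times> real) set"
  assumes "open D" "w \<in> D" "0 < w \<star> w" "w \<star> w < 1"
  shows "emeasure dual_measure D > 0"
proof (rule ccontr)
  assume "\<not> emeasure dual_measure D > 0"
  then have "(\<integral>\<^sup>+w. dual_weight w * indicator D w \<partial>lborel) = 0"
    using assms(1) by (simp add: emeasure_dual_measure)
  then have "AE w in lborel. dual_weight w * indicator D w = 0"
    using assms(1) by (subst (asm) nn_integral_0_iff_AE) auto
  then have "AE w in lborel. w \<notin> D \<inter> {w. 0 < w \<star> w} \<inter> {w. w \<star> w < 1}"
    by eventually_elim (auto simp: dual_weight_def indicator_def split: if_splits)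
  moreover have op: "open (D \<inter> {w. 0 < w \<star> w} \<inter> {w. w \<star> w < 1})"
    by (intro open_Int assms(1) open_Collect_less continuous_intros)
  ultimately have "D \<inter> {w. 0 < w \<star> w} \<inter> {w. w \<star> w < 1} \<in> null_sets lborel"
    by (subst (asm) AE_iff_null_sets[symmetric]) auto
  then have "negligible (D \<inter> {w. 0 < w \<star> w} \<inter> {w. w \<star> w < 1})"
    by (simp add: negligible_iff_null_sets null_sets_completionI)
  then show False
    using open_not_negligible[OF op] assms by blast
qed

lemma emeasure_crossing_hcball_strict_mono:
  assumes "1 \<le> c" "c < c'"
  shows "crossing_vol (hcball (0::'a::euclidean_space, 1) c) <
    crossing_vol (hcball (0::'a, 1) c')"
proof -
  define \<kappa> where "\<kappa> c = sqrt (c\<^sup>2 - 1) / c" for c :: real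
  have cr: "crossing (hcball (0::'a, 1) c) = {w. \<bar>snd w\<bar> < \<kappa> c * norm (fst w)}" if "c \<ge> 1" for c
    using that by (auto simp: crossing_hcball_origin \<kappa>_def field_simps)
  have \<kappa>2: "\<kappa> c = sqrt (1 - 1 / c\<^sup>2)" if "c \<ge> 1" for c
  proof -
    have "sqrt (1 - 1 / c\<^sup>2) = sqrt ((c\<^sup>2 - 1) / c\<^sup>2)"
      using that by (simp add: diff_divide_distrib)
    then show ?thesis using that by (simp add: \<kappa>_def real_sqrt_divide)
  qed
  have \<kappa>: "\<kappa> c < \<kappa> c'" "\<kappa> c' < 1" "\<kappa> c \<ge> 0"
    using assms by (auto simp: \<kappa>2 field_simps power_strict_mono)
  define D where "D = {w :: 'a \<times> real. \<kappa> c * norm (fst w) < \<bar>snd w\<bar>} \<inter> {w. \<bar>snd w\<bar> < \<kappa> c' * norm (fst w)}"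
  have "open D"
    unfolding D_def by (intro open_Int open_Collect_less continuous_intros)
  obtain u :: 'a where u: "norm u = 1" using vector_choose_size[of 1] by auto
  define m where "m = (\<kappa> c + \<kappa> c') / 2"
  have m: "\<kappa> c < m" "m < \<kappa> c'" "0 \<le> m" "m < 1" using \<kappa> by (auto simp: m_def)
  then have "m\<^sup>2 < 1" by (simp add: power2_less_1_iff)
  \<comment> \<open>The slope \<open>m\<close> lies strictly between the two bounds; halving makes
    \<open>w \<star> w\<close> less than 1, where the density is positive.\<close>
  define w where "w = ((1/2) *\<^sub>R u, m / 2)"
  have "w \<in> D" using m u by (simp add: w_def D_def)
  moreover have "w \<star> w = (1 - m\<^sup>2) / 4"
    using u by (simp add: w_def minkowski_self power_divide diff_divide_distrib)
  ultimately have D: "emeasure dual_measure D > 0"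
    using emeasure_dual_measure_open_pos[OF \<open>open D\<close>, of w] \<open>m\<^sup>2 < 1\<close> zero_le_power2[of m] by (simp add: field_simps)
  have fin: "crossing_vol (hcball (0::'a, 1) c) < top"
    by (rule emeasure_dual_crossing_finite[OF hball_subset(2), of _ _ c]) (simp add: hcball_origin)
  have sub: "crossing (hcball (0::'a, 1) c) \<union> D \<subseteq> crossing (hcball (0, 1) c')"
  proof -
    have "\<kappa> c * norm x \<le> \<kappa> c' * norm x" for x :: 'a
      using \<kappa> by (intro mult_right_mono) auto
    moreover have "1 \<le> c'" using assms by simp
    ultimately show ?thesis
      unfolding cr[OF assms(1)] cr[OF \<open>1 \<le> c'\<close>] by (auto simp: D_def intro: less_le_trans)
  qed
  have "crossing_vol (hcball (0::'a, 1) c) <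
      crossing_vol (hcball (0::'a, 1) c) + emeasure dual_measure D"
    using D fin by (simp add: less_top)
  also have "\<dots> = emeasure dual_measure (crossing (hcball (0::'a, 1) c) \<union> D)"
  proof (rule plus_emeasure)
    show "crossing (hcball (0, 1) c) \<inter> D = {}"
      using assms by (auto simp: cr D_def)
  qed (use \<open>open D\<close> in auto)
  also have "\<dots> \<le> crossing_vol (hcball (0::'a, 1) c')"
    by (intro emeasure_mono sub) simp
  finally show ?thesis .
qed

section \<open>Volume of balls as a function of the radius\<close>

lemma emeasure_hyp_volume_open_pos:
  fixes G :: "('a::euclidean_space \<times> real) set"
  assumes "openin (top_of_set hyp_space) G" "G \<noteq> {}"
  shows "hvol G > 0"
proof (rule ccontr)
  assume *: "\<not> hvol G > 0"
  obtain U where U: "open U" "G = hyp_space \<inter> U"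
    using assms(1) by (auto simp: openin_open)
  define V where "V = (\<lambda>x::'a. (x, sqrt (1 + (norm x)\<^sup>2))) -` U"
  have V: "open V"
    unfolding V_def by (rule open_vimage[OF U(1) continuous_on_graph])
  have "G \<in> sets borel"
    unfolding U(2) using U(1) borel_closed[OF closed_hyp_space] by auto
  have [measurable]: "V \<in> sets borel" using V by auto
  have "(\<integral>\<^sup>+x. ennreal (1 / sqrt (1 + (norm x)\<^sup>2)) * indicator V x \<partial>lborel) = 0"
  proof -
    have "(\<integral>\<^sup>+x. ennreal (1 / sqrt (1 + (norm x)\<^sup>2)) * indicator V x \<partial>lborel) = hvol G"
      unfolding emeasure_hyp_volume_measure[OF \<open>G \<in> sets borel\<close>]
      by (intro nn_integral_cong) (simp add: U(2) V_def indicator_def)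
    then show ?thesis using * by simp
  qed
  then have "AE x in (lborel :: 'a measure). ennreal (1 / sqrt (1 + (norm x)\<^sup>2)) * indicator V x = 0"
    by (subst (asm) nn_integral_0_iff_AE) auto
  moreover have "0 < 1 + (norm x)\<^sup>2" for x :: 'a
    by (simp add: add_pos_nonneg)
  then have "\<not> 1 + (norm x)\<^sup>2 \<le> 0" for x :: 'a
    by (simp add: not_le)
  ultimately have "AE x in (lborel :: 'a measure). x \<notin> V"
    by (auto simp: indicator_def ennreal_eq_0_iff not_le elim!: eventually_mono split: if_splits)
  then have "V \<in> null_sets lborel"
    by (subst (asm) AE_iff_null_sets[symmetric]) auto
  then have "negligible V"
    by (simp add: negligible_iff_null_sets null_sets_completionI)
  moreover have "V \<noteq> {}"
    using assms(2) U(2) by (auto simp: V_def hyp_space_graph_image)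
  ultimately show False using open_not_negligible[OF V] by blast
qed

lemma emeasure_hyp_volume_finite:
  fixes A :: "('a::euclidean_space \<times> real) set"
  assumes "A \<in> sets borel" "A \<subseteq> hyp_space" "\<And>x. x \<in> A \<Longrightarrow> snd x \<le> R"
  shows "hvol A < top"
proof -
  have "hvol A \<le> (\<integral>\<^sup>+x. indicator (cball 0 R) x \<partial>(lborel :: 'a measure))"
    unfolding emeasure_hyp_volume_measure[OF assms(1)]
  proof (rule nn_integral_mono)
    fix x :: 'a
    have "norm x \<le> R" if "(x, sqrt (1 + (norm x)\<^sup>2)) \<in> A"
      using norm_fst_less_snd[of "(x, sqrt (1 + (norm x)\<^sup>2))"] assms(3)[OF that] by simp
    moreover have "ennreal (1 / sqrt (1 + (norm x)\<^sup>2)) \<le> 1"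
      by (simp add: add_pos_nonneg)
    ultimately show "ennreal (1 / sqrt (1 + (norm x)\<^sup>2)) * indicator A (x, sqrt (1 + (norm x)\<^sup>2)) \<le> indicator (cball 0 R) x"
      by (auto simp: indicator_def)
  qed
  also have "\<dots> < top"
    using emeasure_lborel_cball_finite[of "0 :: 'a" R] by simp
  finally show ?thesis .
qed

lemma emeasure_hball_eq_hcball:
  fixes p :: "'a::euclidean_space \<times> real"
  assumes "p \<in> hyp_space" "c \<ge> 1"
  shows "hvol (hball p c) = hvol (hcball p c)"
proof -
  have "sphere (0::'a) (sqrt (c\<^sup>2 - 1)) \<in> null_sets lborel"
    using negligible_sphere[of "0 :: 'a"] by (simp add: negligible_iff_null_sets null_sets_completion_iff)
  then have "AE x in lborel. x \<notin> sphere (0::'a) (sqrt (c\<^sup>2 - 1))"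
    by (rule AE_not_in)
  then have "hvol (hball (0::'a, 1) c) = hvol (hcball (0::'a, 1) c)"
    unfolding emeasure_hyp_volume_measure[OF hball_borel(1)] emeasure_hyp_volume_measure[OF hball_borel(2)]
    by (intro nn_integral_cong_AE, elim eventually_mono)
      (auto simp: hball_def hcball_def minkowski_origin snd_less_iff_norm_less[OF assms(2)] indicator_def)
  then show ?thesis
    by (simp add: emeasure_hcball_center[OF assms(1)])
qed

lemma emeasure_hcball_strict_mono:
  fixes c c' :: real
  assumes "1 \<le> c" "c < c'"
  shows "hvol (hcball (0::'a::euclidean_space, 1) c) <
    hvol (hcball (0::'a, 1) c')"
proof -
  define D where "D = {x :: 'a \<times> real. x \<in> hyp_space \<and> c < snd x \<and> snd x < c'}"
  have op: "openin (top_of_set hyp_space) D"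
  proof -
    have "D = hyp_space \<inter> ({x. c < snd x} \<inter> {x. snd x < c'})" by (auto simp: D_def)
    moreover have "open ({x :: 'a \<times> real. c < snd x} \<inter> {x. snd x < c'})"
      by (intro open_Int open_Collect_less continuous_intros)
    ultimately show ?thesis by (auto simp: openin_open)
  qed
  obtain u :: 'a where u: "norm u = 1" using vector_choose_size[of 1] by auto
  define m where "m = (c + c') / 2"
  have "(sqrt (m\<^sup>2 - 1) *\<^sub>R u, m) \<in> D"
    using u assms by (simp add: D_def hyp_space_iff m_def)
  then have pos: "hvol D > 0"
    by (intro emeasure_hyp_volume_open_pos[OF op]) auto
  have Dm: "D \<in> sets borel"
  proof -
    have "D = hyp_space \<inter> ({x. c < snd x} \<inter> {x. snd x < c'})" by (auto simp: D_def)
    moreover have "({x :: 'a \<times> real. c < snd x} \<inter> {x. snd x < c'}) \<in> sets borel"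
      by (intro borel_open open_Int open_Collect_less continuous_intros)
    ultimately show ?thesis using borel_closed[OF closed_hyp_space] by auto
  qed
  have fin: "hvol (hcball (0::'a, 1) c) < top"
    by (rule emeasure_hyp_volume_finite[OF hball_borel(2) hball_subset(2), of _ _ c]) (simp add: hcball_origin)
  then have "hvol (hcball (0::'a, 1) c) <
      hvol (hcball (0::'a, 1) c) + hvol D"
    using pos by (simp add: less_top)
  also have "\<dots> = hvol (hcball (0::'a, 1) c \<union> D)"
  proof (rule plus_emeasure)
    show "hcball (0, 1) c \<inter> D = {}" by (auto simp: D_def hcball_origin)
  qed (use Dm in auto)
  also have "\<dots> \<le> hvol (hcball (0::'a, 1) c')"
  proof (rule emeasure_mono)
    show "hcball (0, 1) c \<union> D \<subseteq> hcball (0, 1) c'"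
      using assms by (auto simp: D_def hcball_origin)
  qed simp
  finally show ?thesis .
qed

text \<open>Serves to derive the continuity of the hyperbolic ball volume from that of the Euclidean
  one, whose increments dominate.\<close>

lemma continuous_on_dominated_increments:
  fixes f g :: "'b::metric_space \<Rightarrow> real"
  assumes "continuous_on S f" "\<And>s t. s \<in> S \<Longrightarrow> t \<in> S \<Longrightarrow> \<bar>g s - g t\<bar> \<le> \<bar>f s - f t\<bar>"
  shows "continuous_on S g"
  using assms unfolding continuous_on_iff dist_real_def by (meson le_less_trans)

text \<open>Intermediate value theorem in the Euclidean radius \<open>s = sqrt (c^2 - 1)\<close>.
  The density is at most 1, which gives continuity; on the ball of radius t \<ge> 1 it is at least
  \<open>1 / (2 t)\<close>, so that in dimension at least 2 the volume grows at least linearly in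
  t.\<close>

lemma exists_hcball_of_volume:
  assumes dim: "DIM('a::euclidean_space) \<ge> 2" and V: "V > 0"
  shows "\<exists>c>1. hvol (hcball (0::'a, 1) c) = ennreal V"
proof -
  define M where "M = density (lborel :: 'a measure) (\<lambda>x. ennreal (1 / sqrt (1 + (norm x)\<^sup>2)))"
  have [simp]: "sets M = sets borel" by (simp add: M_def)
  have M: "emeasure M A = (\<integral>\<^sup>+x. ennreal (1 / sqrt (1 + (norm x)\<^sup>2)) * indicator A x \<partial>lborel)" if "A \<in> sets borel" for A
    using that by (simp add: M_def emeasure_density)
  have weight_le: "ennreal (1 / sqrt (1 + (norm x)\<^sup>2)) \<le> 1" for x :: 'a
    by (simp add: add_pos_nonneg)
  have M_le: "emeasure M A \<le> emeasure lborel A" if [measurable]: "A \<in> sets borel" for A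
  proof -
    have "emeasure M A \<le> (\<integral>\<^sup>+x. indicator A x \<partial>lborel)"
      unfolding M[OF that] using weight_le by (intro nn_integral_mono) (auto simp: indicator_def)
    then show ?thesis using that by simp
  qed
  define G where "G s = measure M (cball 0 s)" for s
  have fin: "emeasure M (cball 0 s) < top" for s
    using M_le[of "cball 0 s"] emeasure_lborel_cball_finite[of "0::'a" s] by (auto intro: le_less_trans)
  have vol: "hvol (hcball (0::'a, 1) (sqrt (1 + s\<^sup>2))) = ennreal (G s)" if "s \<ge> 0" for s
  proof -
    have "sqrt (1 + s\<^sup>2) \<ge> 1" by simp
    then have "hvol (hcball (0::'a, 1) (sqrt (1 + s\<^sup>2))) = emeasure M (cball 0 s)"
      using that unfolding emeasure_hyp_volume_measure[OF hball_borel(2)]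
      by (subst M) (auto simp: hcball_def minkowski_origin snd_less_iff_norm_less[of "sqrt (1 + s\<^sup>2)"] indicator_def intro!: nn_integral_cong)
    then show ?thesis using fin[of s] by (simp add: G_def emeasure_eq_ennreal_measure less_top)
  qed
  have content: "measure lborel (cball (0::'a) s) = unit_ball_vol DIM('a) * s ^ DIM('a)" if "s \<ge> 0" for s
    using that by (rule content_cball)
  have incr: "\<bar>G s - G t\<bar> \<le> \<bar>unit_ball_vol DIM('a) * s ^ DIM('a) - unit_ball_vol DIM('a) * t ^ DIM('a)\<bar>"
    if "s \<ge> 0" "t \<ge> 0" for s t
    using that
  proof (induction s t rule: linorder_wlog)
    case (le s t)
    have "G t - G s = measure M (cball 0 t - cball 0 s)"
      unfolding G_def using le fin by (intro measure_Diff[symmetric]) (auto simp: less_top)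
    also have "\<dots> \<le> measure lborel (cball (0::'a) t - cball 0 s)"
    proof -
      have "emeasure lborel (cball (0::'a) t - cball 0 s) \<le> emeasure lborel (cball (0::'a) t)"
        by (rule emeasure_mono) auto
      then have "emeasure lborel (cball (0::'a) t - cball 0 s) < top"
        using emeasure_lborel_cball_finite[of "0::'a" t] by (simp add: le_less_trans)
      then show ?thesis
        unfolding measure_def by (intro enn2real_mono M_le) simp_all
    qed
    also have "\<dots> = measure lborel (cball (0::'a) t) - measure lborel (cball (0::'a) s)"
      using le emeasure_lborel_cball_finite[of "0::'a" t] by (intro measure_Diff) auto
    finally have "G t - G s \<le> unit_ball_vol DIM('a) * t ^ DIM('a) - unit_ball_vol DIM('a) * s ^ DIM('a)"
      using le by (simp add: content)
    moreover have "G s \<le> G t"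
      unfolding G_def measure_def using le fin[of t] by (intro enn2real_mono emeasure_mono) auto
    ultimately show ?case by simp
  next
    case (sym s t)
    then show ?case by (simp add: abs_minus_commute)
  qed
  have cont: "continuous_on {0..t} G" for t
    by (rule continuous_on_dominated_increments[where f = "\<lambda>s. unit_ball_vol DIM('a) * s ^ DIM('a)"])
      (auto intro!: continuous_intros incr)
  have G0: "G 0 = 0"
  proof -
    have "emeasure M (cball 0 0) \<le> emeasure lborel (cball (0::'a) 0)" by (rule M_le) simp
    then show ?thesis by (simp add: G_def measure_def)
  qed
  define C where "C = unit_ball_vol DIM('a)"
  have "C > 0" by (simp add: C_def)
  have G_ge: "G t \<ge> C * t / 2" if "t \<ge> 1" for t
  proof -
    have "ennreal (1 / (2 * t)) * emeasure lborel (cball (0::'a) t) = (\<integral>\<^sup>+x. ennreal (1 / (2 * t)) * indicator (cball (0::'a) t) x \<partial>lborel)"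
      by (rule nn_integral_cmult_indicator[symmetric]) simp
    also have "\<dots> \<le> emeasure M (cball 0 t)"
    proof (subst M, simp, rule nn_integral_mono)
      fix x :: 'a
      have "1 / (2 * t) \<le> 1 / sqrt (1 + (norm x)\<^sup>2)" if "norm x \<le> t"
      proof -
        have "(norm x)\<^sup>2 \<le> t\<^sup>2" "1 \<le> t\<^sup>2" using that \<open>t \<ge> 1\<close> by (auto intro: power_mono simp: one_le_power)
        then have "1 + (norm x)\<^sup>2 \<le> (2 * t)\<^sup>2" by (simp add: power_mult_distrib)
        then have "sqrt (1 + (norm x)\<^sup>2) \<le> 2 * t" using \<open>t \<ge> 1\<close> by (intro real_le_lsqrt) auto
        then show ?thesis by (intro divide_left_mono mult_pos_pos) (use \<open>t \<ge> 1\<close> in \<open>auto simp: add_pos_nonneg\<close>)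
      qed
      then show "ennreal (1 / (2 * t)) * indicator (cball 0 t) x \<le> ennreal (1 / sqrt (1 + (norm x)\<^sup>2)) * indicator (cball 0 t) x"
        by (auto simp: indicator_def intro: ennreal_leI)
    qed
    also have "\<dots> = ennreal (G t)"
      using fin[of t] by (simp add: G_def emeasure_eq_ennreal_measure less_top)
    finally have "ennreal (1 / (2 * t)) * ennreal (C * t ^ DIM('a)) \<le> ennreal (G t)"
      using that by (simp add: emeasure_cball C_def)
    then have "1 / (2 * t) * (C * t ^ DIM('a)) \<le> G t"
      using that \<open>C > 0\<close> by (subst (asm) ennreal_mult[symmetric]) (auto simp: G_def)
    moreover have "t * t \<le> t ^ DIM('a)"
      using power_increasing[OF dim that] by (simp add: power2_eq_square)
    then have "C * (t * t) / (2 * t) \<le> C * t ^ DIM('a) / (2 * t)"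
      using that \<open>C > 0\<close> by (intro divide_right_mono mult_left_mono) auto
    then have "C * t / 2 \<le> 1 / (2 * t) * (C * t ^ DIM('a))"
      using that by simp
    ultimately show ?thesis by simp
  qed
  define t where "t = max 1 (2 * V / C)"
  have "V \<le> C * t / 2"
    using \<open>C > 0\<close> by (simp add: t_def field_simps max_def)
  then have "V \<le> G t"
    using G_ge[of t] by (simp add: t_def)
  have "0 \<le> t" by (simp add: t_def le_max_iff_disj)
  obtain s where s: "0 \<le> s" "s \<le> t" "G s = V"
    using IVT'[of G 0 V t, OF _ \<open>V \<le> G t\<close> \<open>0 \<le> t\<close> cont] V G0 by auto
  have "s \<noteq> 0" using s G0 V by auto
  then have "sqrt (1 + s\<^sup>2) > 1" using s by simp
  then show ?thesis using vol[OF s(1)] s(3) by blast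
qed

section \<open>Two-point symmetrization\<close>

text \<open>Polarization towards the half-space \<open>0 \<le> x \<star> e\<close>. On the mirror,
  where \<open>reflect e x = x\<close>, the two clauses agree.\<close>

definition two_point :: "'a::euclidean_space \<times> real \<Rightarrow> ('a \<times> real) set \<Rightarrow> ('a \<times> real) set" where
  "two_point e K = {x. if 0 \<le> x \<star> e then x \<in> K \<or> reflect e x \<in> K else x \<in> K \<and> reflect e x \<in> K}"

context
  fixes e :: "'a::euclidean_space \<times> real" and K :: "('a \<times> real) set"
  assumes e: "e \<star> e = 1"
begin

lemma two_point_subset: "two_point e K \<subseteq> K \<union> reflect e ` K"
  using e by (auto simp: two_point_def reflect_image_iff split: if_splits)

lemma two_point_subset_hyp_space: "K \<subseteq> hyp_space \<Longrightarrow> two_point e K \<subseteq> hyp_space"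
  using two_point_subset e by force

lemma compact_two_point:
  assumes "compact K"
  shows "compact (two_point e K)"
proof -
  have "two_point e K = ((K \<union> reflect e ` K) \<inter> {x. 0 \<le> x \<star> e}) \<union> ((K \<inter> reflect e ` K) \<inter> {x. x \<star> e \<le> 0})"
    using e by (auto simp: two_point_def reflect_image_iff reflect_fixed not_le split: if_splits)
  moreover have "compact (reflect e ` K)"
    by (intro compact_continuous_image continuous_on_reflect continuous_on_id assms)
  moreover have "closed {x. 0 \<le> x \<star> e}" "closed {x. x \<star> e \<le> 0}"
    by (intro closed_Collect_le continuous_intros)+
  ultimately show ?thesis
    using assms by (simp only:) (intro compact_Un compact_Int_closed compact_Int)
qed

text \<open>Since \<open>w \<star> x = w \<star> reflect e x + 2 (x \<star> e) (w \<star>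
  e)\<close>, moving points to the favoured side can only decrease the product with a
  \<open>w\<close> that points away from it. It is therefore enough that \<open>K\<close> satisfied
  the inequality for one of \<open>w\<close> and its mirror image.\<close>

lemma polar_two_point:
  assumes "w \<star> e \<le> 0" "w \<in> polar K \<or> reflect e w \<in> polar K"
  shows "w \<in> polar (two_point e K)"
  unfolding polar_def
proof (intro CollectI ballI)
  fix x assume x: "x \<in> two_point e K"
  have wx: "w \<star> x = w \<star> reflect e x + 2 * ((x \<star> e) * (w \<star> e))"
    by (simp add: reflect_def minkowski_simps)
  have refl: "reflect e w \<star> reflect e x = w \<star> x" "reflect e w \<star> x = w \<star> reflect e x"
    using e by (simp_all add: minkowski_reflect_right)
  show "w \<star> x \<le> 0"
  proof (cases "0 \<le> x \<star> e")
    case True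
    then have "(x \<star> e) * (w \<star> e) \<le> 0" using assms(1) by (simp add: mult_nonneg_nonpos)
    then show ?thesis
      using x True assms(2) wx refl by (auto simp: two_point_def polar_def)
  next
    case False
    then show ?thesis
      using x assms(2) refl by (auto simp: two_point_def polar_def)
  qed
qed

lemma polar_two_point_both:
  assumes "w \<in> polar K" "reflect e w \<in> polar K"
  shows "w \<in> polar (two_point e K)"
  unfolding polar_def
proof (intro CollectI ballI)
  fix x assume "x \<in> two_point e K"
  then consider "x \<in> K" | "reflect e x \<in> K" by (auto simp: two_point_def split: if_splits)
  then show "w \<star> x \<le> 0"
    using assms e minkowski_reflect_reflect[OF e, of w x] by cases (auto simp: polar_def)
qed

text \<open>Together the two inclusions say that in each pair of hyperplanes exchanged by the
  reflection, the number of crossing ones does not increase. The reason is a propositional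
  combination of the polar rules for both coorientations.\<close>

lemma crossing_two_point:
  "crossing (two_point e K) \<union> reflect e -` crossing (two_point e K) \<subseteq> crossing K \<union> reflect e -` crossing K"
  "crossing (two_point e K) \<inter> reflect e -` crossing (two_point e K) \<subseteq> crossing K \<inter> reflect e -` crossing K"
proof -
  let ?N = "crossing K" and ?N' = "crossing (two_point e K)"
  let ?P = "\<lambda>w. (w \<in> ?N' \<or> reflect e w \<in> ?N' \<longrightarrow> w \<in> ?N \<or> reflect e w \<in> ?N) \<and>
    (w \<in> ?N' \<and> reflect e w \<in> ?N' \<longrightarrow> w \<in> ?N \<and> reflect e w \<in> ?N)"
  have *: "?P w" if "w \<star> e \<le> 0" for w
  proof -
    have neg: "reflect e (- w) = - reflect e w"
      by (rule linear_neg[OF linear_reflect])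
    have rr: "reflect e (reflect e w) = w" "reflect e (- reflect e w) = - w"
      using e by (simp_all add: linear_neg[OF linear_reflect])
    \<comment> \<open>Thus the one-sided rule applies to \<open>- reflect e w\<close> as well, the
      opposite coorientation of the mirror hyperplane.\<close>
    have s: "(- reflect e w) \<star> e \<le> 0"
      using that e by (simp add: minkowski_simps)
    note a = polar_two_point[OF that] polar_two_point[OF s]
      polar_two_point_both[of "reflect e w"] polar_two_point_both[of "- w"]
    show ?thesis
      using a unfolding crossing_iff_polar rr neg by blast
  qed
  have "?P w" for w
  proof (cases "w \<star> e \<le> 0")
    case False
    then have "reflect e w \<star> e \<le> 0" using e by simp
    from *[OF this] show ?thesis using e by auto
  qed (rule *)
  then show "?N' \<union> reflect e -` ?N' \<subseteq> ?N \<union> reflect e -` ?N" "?N' \<inter> reflect e -` ?N' \<subseteq> ?N \<inter> reflect e -` ?N"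
    unfolding vimage_def by blast+
qed

text \<open>By reflection invariance, twice the measure of a crossing set is the measure of the
  union with its mirror image plus that of the intersection; both shrink.\<close>

lemma emeasure_crossing_two_point:
  "crossing_vol (two_point e K) \<le> crossing_vol K"
proof -
  have m [measurable]: "reflect e -` crossing L \<in> sets borel" for L
    by (rule measurable_sets_borel[OF reflect_measurable crossing_borel])
  have double: "2 * crossing_vol L =
      emeasure dual_measure (crossing L \<union> reflect e -` crossing L) +
      emeasure dual_measure (crossing L \<inter> reflect e -` crossing L)" for L
    using emeasure_Un_Int[of "crossing L" dual_measure "reflect e -` crossing L"]
    by (simp add: emeasure_dual_measure_reflect[OF e] mult_2)
  have "2 * crossing_vol (two_point e K) \<le> 2 * crossing_vol K"
    unfolding double by (intro add_mono emeasure_mono crossing_two_point) auto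
  then show ?thesis
    by (subst (asm) ennreal_mult_le_mult_iff) auto
qed

context
  assumes K: "compact K" "K \<subseteq> hyp_space"
begin

text \<open>Symmetrization replaces the part \<open>P\<close> by its mirror image, which is disjoint
  from \<open>K\<close>. In the second claim no part of \<open>P\<close> leaves \<open>B\<close>,
  and the extra term counts the points of \<open>B\<close> newly covered from outside
  \<open>B\<close>.\<close>

lemma emeasure_two_point:
  "hvol (two_point e K) = hvol K"
  and emeasure_two_point_Int:
  "B \<in> sets borel \<Longrightarrow> (\<And>x. x \<in> B \<Longrightarrow> x \<star> e < 0 \<Longrightarrow> reflect e x \<in> B) \<Longrightarrow>
   hvol (K \<inter> B) + hvol {x \<in> B. x \<notin> K \<and> reflect e x \<in> K - B}
     \<le> hvol (two_point e K \<inter> B)"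
proof -
  define P where "P = {x \<in> K. x \<star> e < 0 \<and> reflect e x \<notin> K}"
  have [measurable]: "K \<in> sets borel" by (rule borel_compact[OF K(1)])
  have rm [measurable]: "reflect e -` A \<in> sets borel" if "A \<in> sets borel" for A
    using measurable_sets_borel[OF reflect_measurable that] by simp
  have im: "reflect e ` A = reflect e -` A" for A
    using e by (auto simp: reflect_image_iff)
  have [measurable]: "P \<in> sets borel"
  proof -
    have "P = K \<inter> {x. x \<star> e < 0} - reflect e -` K" by (auto simp: P_def)
    moreover have "{x. x \<star> e < 0} \<in> sets borel"
      by (intro borel_open open_Collect_less continuous_intros)
    ultimately show ?thesis by simp
  qed
  have PH: "P \<subseteq> hyp_space" using K by (auto simp: P_def)
  have split: "two_point e K = (K - P) \<union> reflect e ` P"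
    using e by (auto simp: two_point_def P_def im reflect_fixed not_less order_less_le split: if_splits)
  have disj: "K \<inter> reflect e ` P = {}" by (auto simp: P_def im e)
  have "hvol (two_point e K) =
      hvol (K - P) + hvol (reflect e ` P)"
    unfolding split using disj by (intro plus_emeasure[symmetric]) (auto simp: im)
  also have "\<dots> = hvol (K - P) + hvol P"
    by (simp add: emeasure_hyp_volume_measure_reflect[OF e _ PH])
  also have "\<dots> = hvol ((K - P) \<union> P)"
    by (rule plus_emeasure) auto
  also have "(K - P) \<union> P = K" by (auto simp: P_def)
  finally show "hvol (two_point e K) = hvol K" .
  show "hvol (K \<inter> B) + hvol {x \<in> B. x \<notin> K \<and> reflect e x \<in> K - B}
      \<le> hvol (two_point e K \<inter> B)" if B [measurable]: "B \<in> sets borel" and side: "\<And>x. x \<in> B \<Longrightarrow> x \<star> e < 0 \<Longrightarrow> reflect e x \<in> B"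
  proof -
    define D where "D = {x \<in> B. x \<notin> K \<and> reflect e x \<in> K - B}"
    have [measurable]: "D \<in> sets borel"
    proof -
      have "D = (B - K) \<inter> reflect e -` (K - B)" by (auto simp: D_def)
      then show ?thesis by simp
    qed
    have PB: "P \<inter> B \<subseteq> hyp_space" using PH by blast
    have sub: "(K - P) \<inter> B \<union> reflect e ` (P \<inter> B) \<union> D \<subseteq> two_point e K \<inter> B"
    proof -
      have "reflect e ` (P \<inter> B) \<subseteq> B" using side unfolding P_def by blast
      moreover have "D \<subseteq> reflect e ` P"
      proof
        fix x assume x: "x \<in> D"
        then have "\<not> x \<star> e < 0" using side[of x] unfolding D_def by blast
        moreover have "x \<star> e \<noteq> 0"
          using x reflect_fixed[OF e, of x] by (auto simp: D_def)
        ultimately have "x \<star> e > 0" by simp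
        then show "x \<in> reflect e ` P"
          using x e by (auto simp: D_def P_def im)
      qed
      ultimately show ?thesis unfolding split by (auto simp: D_def)
    qed
    have "hvol (K \<inter> B) = hvol (((K - P) \<inter> B) \<union> (P \<inter> B))"
      by (rule arg_cong[where f = "hvol"]) (auto simp: P_def)
    also have "\<dots> = hvol ((K - P) \<inter> B) + hvol (P \<inter> B)"
      by (rule plus_emeasure[symmetric]) auto
    also have "hvol (P \<inter> B) = hvol (reflect e ` (P \<inter> B))"
      by (simp add: emeasure_hyp_volume_measure_reflect[OF e _ PB])
    also have "hvol ((K - P) \<inter> B) + hvol (reflect e ` (P \<inter> B)) =
        hvol ((K - P) \<inter> B \<union> reflect e ` (P \<inter> B))"
      using disj by (intro plus_emeasure) (auto simp: im)
    finally have "hvol (K \<inter> B) + hvol D =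
        hvol ((K - P) \<inter> B \<union> reflect e ` (P \<inter> B)) + hvol D"
      by simp
    also have "\<dots> = hvol ((K - P) \<inter> B \<union> reflect e ` (P \<inter> B) \<union> D)"
    proof (rule plus_emeasure)
      show "((K - P) \<inter> B \<union> reflect e ` (P \<inter> B)) \<inter> D = {}"
        using e by (auto simp: D_def im)
    qed (auto simp: im)
    also have "\<dots> \<le> hvol (two_point e K \<inter> B)"
    proof (rule emeasure_mono[OF sub])
      show "two_point e K \<inter> B \<in> sets hyp_volume_measure"
        using borel_compact[OF compact_two_point[OF K(1)]] by simp
    qed
    finally show ?thesis by (simp add: D_def)
  qed
qed

end

end

section \<open>The inequality\<close>

text \<open>Otherwise \<open>S\<close> would be covered by open sets meeting it in measure zero, and
  countably many of them would suffice by the Lindelof property.\<close>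

lemma emeasure_support_point:
  fixes S :: "'b::second_countable_topology set"
  assumes sets_M: "sets M = sets borel" and S_borel: "S \<in> sets borel" and pos: "emeasure M S > 0"
  obtains y where "y \<in> S" "\<And>U. open U \<Longrightarrow> y \<in> U \<Longrightarrow> emeasure M (U \<inter> S) > 0"
proof -
  have "\<exists>y\<in>S. \<forall>U. open U \<and> y \<in> U \<longrightarrow> emeasure M (U \<inter> S) > 0"
  proof (rule ccontr)
    assume *: "\<not> ?thesis"
    define F where "F = {U. open U \<and> emeasure M (U \<inter> S) = 0}"
    obtain F' where F': "F' \<subseteq> F" "countable F'" "\<Union>F' = \<Union>F"
      using Lindelof[of F] by (auto simp: F_def)
    have "S \<subseteq> \<Union>F"
    proof
      fix y assume "y \<in> S"
      then obtain U where "open U" "y \<in> U" "emeasure M (U \<inter> S) = 0"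
        using * by (metis not_gr_zero)
      then show "y \<in> \<Union>F" by (auto simp: F_def)
    qed
    then have S: "(\<Union>U\<in>F'. U \<inter> S) = S" using F'(3) by blast
    have "U \<inter> S \<in> null_sets M" if "U \<in> F'" for U
    proof (rule null_setsI)
      have "U \<in> F" using that F'(1) by blast
      then show "emeasure M (U \<inter> S) = 0" "U \<inter> S \<in> sets M"
        using sets_M S_borel by (auto simp: F_def)
    qed
    then have "(\<Union>U\<in>F'. U \<inter> S) \<in> null_sets M"
      by (rule null_sets_UN'[OF F'(2)])
    then have "emeasure M S = 0" unfolding S by (rule null_setsD1)
    then show False using pos by simp
  qed
  then obtain y where y: "y \<in> S" "\<forall>U. open U \<and> y \<in> U \<longrightarrow> emeasure M (U \<inter> S) > 0"
    by (rule bexE)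
  show thesis
    by (rule that[OF y(1) y(2)[rule_format, OF conjI]])
qed

text \<open>Blaschke selection, by applying Arzela-Ascoli to the distance functions, which are
  1-Lipschitz; the limit set is the zero set of the limit function. Convergence is stated as its two
  one-sided halves because volume uses the first and crossings use the second.\<close>

lemma Hausdorff_convergent_subsequence:
  fixes L :: "nat \<Rightarrow> 'b::euclidean_space set"
  assumes X: "compact X" and L: "\<And>n. closed (L n)" "\<And>n. L n \<subseteq> X" "\<And>n. L n \<noteq> {}"
  obtains k K where "strict_mono (k :: nat \<Rightarrow> nat)" "compact K" "K \<subseteq> X" "K \<noteq> {}"
    "\<And>U. open U \<Longrightarrow> K \<subseteq> U \<Longrightarrow> eventually (\<lambda>n. L (k n) \<subseteq> U) sequentially"
    "\<And>x. x \<in> K \<Longrightarrow> \<exists>y. (\<forall>n. y n \<in> L (k n)) \<and> y \<longlonglongrightarrow> x"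
proof -
  obtain M where M: "\<And>x y. x \<in> X \<Longrightarrow> y \<in> X \<Longrightarrow> dist x y \<le> M"
    using compact_imp_bounded[OF X] unfolding bounded_two_points by metis
  have lip: "\<bar>infdist x A - infdist y A\<bar> \<le> dist x y" for x y :: 'b and A
    using infdist_triangle[of x A y] infdist_triangle[of y A x] by (simp add: dist_commute abs_le_iff)
  obtain g k where g: "continuous_on X g" and k: "strict_mono (k :: nat \<Rightarrow> nat)"
    and conv: "\<And>e. 0 < e \<Longrightarrow> \<exists>N. \<forall>n x. n \<ge> N \<and> x \<in> X \<longrightarrow> norm (infdist x (L (k n)) - g x) < e"
  proof (rule Arzela_Ascoli[OF X, of "\<lambda>n x. infdist x (L n)" M])
    show "norm (infdist x (L n)) \<le> M" if "x \<in> X" for n x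
    proof -
      obtain y where "y \<in> L n" using L(3) by blast
      then have "infdist x (L n) \<le> dist x y" by (rule infdist_le)
      also have "\<dots> \<le> M" using M that L(2) \<open>y \<in> L n\<close> by blast
      finally show ?thesis by (simp add: infdist_nonneg)
    qed
    show "\<exists>d>0. \<forall>n y. y \<in> X \<and> norm (x - y) < d \<longrightarrow> norm (infdist x (L n) - infdist y (L n)) < e"
      if "0 < e" for x e
      using that lip by (intro exI[of _ e]) (auto simp: dist_norm intro: le_less_trans)
  qed blast
  have lim: "(\<lambda>n. infdist x (L (k n))) \<longlonglongrightarrow> g x" if "x \<in> X" for x
    using conv that by (fastforce intro!: LIMSEQ_I)
  have g_nonneg: "g x \<ge> 0" if "x \<in> X" for x
    using lim[OF that] by (rule LIMSEQ_le_const) (auto simp: infdist_nonneg)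
  define K where "K = {x \<in> X. g x = 0}"
  have "K = X \<inter> g -` {0}" by (auto simp: K_def)
  then have "compact K"
    using continuous_closed_preimage[OF g compact_imp_closed[OF X], of "{0}"]
    by (metis X closed_singleton compact_Int_closed inf.left_idem)
  have nbhd: "eventually (\<lambda>n. L (k n) \<subseteq> U) sequentially" if U: "open U" "K \<subseteq> U" for U
  proof (cases "X - U = {}")
    case True
    then show ?thesis using L(2) by (intro always_eventually) blast
  next
    case False
    have "compact (X - U)" using X U(1) by (rule compact_diff)
    then obtain x0 where x0: "x0 \<in> X - U" "\<And>x. x \<in> X - U \<Longrightarrow> g x0 \<le> g x"
      using continuous_attains_inf[of "X - U" g] False continuous_on_subset[OF g] by blast
    have "g x0 > 0"
      using x0(1) U(2) g_nonneg[of x0] by (force simp: K_def)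
    then obtain N where N: "\<And>n x. n \<ge> N \<Longrightarrow> x \<in> X \<Longrightarrow> norm (infdist x (L (k n)) - g x) < g x0"
      using conv by blast
    show ?thesis
    proof (intro eventually_sequentiallyI[of N] subsetI)
      fix n x assume n: "N \<le> n" and x: "x \<in> L (k n)"
      show "x \<in> U"
      proof (rule ccontr)
        assume "x \<notin> U"
        then have "x \<in> X - U" using x L(2) by blast
        then have "g x0 \<le> g x" "norm (infdist x (L (k n)) - g x) < g x0"
          using x0(2) N[OF n] by blast+
        then show False using x by simp
      qed
    qed
  qed
  have "K \<noteq> {}"
  proof
    assume "K = {}"
    then have "eventually (\<lambda>n. L (k n) \<subseteq> {}) sequentially" by (intro nbhd) auto
    then show False using L(3) by (auto simp: eventually_sequentially)
  qed
  have approx: "\<exists>y. (\<forall>n. y n \<in> L (k n)) \<and> y \<longlonglongrightarrow> x" if x: "x \<in> K" for x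
  proof -
    have "\<exists>y\<in>L (k n). infdist x (L (k n)) = dist x y" for n
      using infdist_attains_inf[OF L(1,3)] by metis
    then obtain y where y: "\<And>n. y n \<in> L (k n)" "\<And>n. infdist x (L (k n)) = dist x (y n)" by metis
    have "(\<lambda>n. dist x (y n)) \<longlonglongrightarrow> 0"
      using lim[of x] x y(2) by (simp add: K_def)
    then have "y \<longlonglongrightarrow> x"
      by (subst tendsto_dist_iff) (simp add: dist_commute)
    then show ?thesis using y(1) by blast
  qed
  show thesis
    by (rule that[OF k \<open>compact K\<close> _ \<open>K \<noteq> {}\<close> nbhd approx]) (auto simp: K_def)
qed

text \<open>Upper semicontinuity: the neighbourhoods \<open>U j\<close> eventually contain
  \<open>L n\<close> and decrease to \<open>K\<close>. Intersecting with \<open>B\<close>, of finite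
  measure, permits continuity from above.\<close>

lemma emeasure_Hausdorff_limit:
  fixes K :: "'b::euclidean_space set"
  assumes M: "sets M = sets borel" and K: "closed K" "K \<noteq> {}"
    and B: "B \<in> sets borel" "emeasure M B < top"
    and nbhd: "\<And>U. open U \<Longrightarrow> K \<subseteq> U \<Longrightarrow> eventually (\<lambda>n. L n \<subseteq> U) sequentially"
    and a: "eventually (\<lambda>n. a \<le> emeasure M (L n \<inter> B)) sequentially"
  shows "a \<le> emeasure M (K \<inter> B)"
proof -
  define U where "U j = {x. infdist x K < 1 / real (Suc j)}" for j
  have U: "open (U j)" for j
    unfolding U_def by (intro open_Collect_less continuous_intros)
  have KU: "K \<subseteq> U j" for j by (auto simp: U_def)
  have decr: "U j \<subseteq> U i" if "i \<le> j" for i j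
  proof -
    have "1 / real (Suc j) \<le> 1 / real (Suc i)" using that by (simp add: frac_le)
    then show ?thesis by (auto simp: U_def)
  qed
  have "(\<Inter>j. U j \<inter> B) = K \<inter> B"
  proof -
    have "x \<in> K" if "\<And>j. x \<in> U j" for x
    proof -
      have "infdist x K \<le> 0"
      proof (rule field_le_epsilon)
        fix e :: real assume "0 < e"
        then obtain j where "1 / real (Suc j) < e" using nat_approx_posE by blast
        then show "infdist x K \<le> 0 + e" using that[of j] by (simp add: U_def)
      qed
      then have "infdist x K = 0" using infdist_nonneg[of x K] by simp
      then show ?thesis using K in_closed_iff_infdist_zero by blast
    qed
    then show ?thesis using KU by blast
  qed
  moreover have "(INF j. emeasure M (U j \<inter> B)) = emeasure M (\<Inter>j. U j \<inter> B)"
  proof (rule INF_emeasure_decseq)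
    show "range (\<lambda>j. U j \<inter> B) \<subseteq> sets M" using U B(1) M by auto
    show "decseq (\<lambda>j. U j \<inter> B)" using decr by (auto simp: decseq_def)
    show "emeasure M (U j \<inter> B) \<noteq> \<infinity>" for j
      using emeasure_mono[of "U j \<inter> B" B M] B M by (auto simp: top_unique)
  qed
  moreover have "a \<le> emeasure M (U j \<inter> B)" for j
  proof -
    have "eventually (\<lambda>n. a \<le> emeasure M (U j \<inter> B)) sequentially"
      using nbhd[OF U KU[of j]] a
    proof eventually_elim
      fix n assume "L n \<subseteq> U j" "a \<le> emeasure M (L n \<inter> B)"
      then show "a \<le> emeasure M (U j \<inter> B)"
        using emeasure_mono[of "L n \<inter> B" "U j \<inter> B" M] U[of j] B(1) M by (auto intro: order_trans)
    qed
    then show ?thesis by simp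
  qed
  then have "a \<le> (INF j. emeasure M (U j \<inter> B))" by (rule INF_greatest)
  ultimately show ?thesis by simp
qed

text \<open>Lower semicontinuity: a hyperplane with points of \<open>K\<close> strictly on both
  sides eventually has points of \<open>L n\<close> on both sides, so \<open>crossing K\<close> is
  contained in the lower limit of the sets \<open>crossing (L n)\<close>.\<close>

lemma emeasure_crossing_Hausdorff_limit:
  fixes K :: "('a::euclidean_space \<times> real) set"
  assumes approx: "\<And>x. x \<in> K \<Longrightarrow> \<exists>y. (\<forall>n. y n \<in> L n) \<and> y \<longlonglongrightarrow> x"
    and a: "\<And>n. crossing_vol (L n) \<le> a"
  shows "crossing_vol K \<le> a"
proof -
  define A where "A n = (\<Inter>i\<in>{n..}. crossing (L i))" for n
  have [measurable]: "A n \<in> sets borel" for n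
    unfolding A_def by (intro sets.countable_INT'') auto
  have "crossing K \<subseteq> (\<Union>n. A n)"
  proof
    fix w assume "w \<in> crossing K"
    then obtain x y where xy: "x \<in> K" "w \<star> x > 0" "y \<in> K" "w \<star> y < 0"
      by (auto simp: crossing_def)
    obtain x' where x': "\<And>n. x' n \<in> L n" "x' \<longlonglongrightarrow> x" using approx[OF xy(1)] by blast
    obtain y' where y': "\<And>n. y' n \<in> L n" "y' \<longlonglongrightarrow> y" using approx[OF xy(3)] by blast
    have "eventually (\<lambda>n. w \<star> x' n > 0) sequentially"
      using minkowski.tendsto[OF tendsto_const x'(2), of w] xy(2) by (rule order_tendstoD)
    moreover have "eventually (\<lambda>n. w \<star> y' n < 0) sequentially"
      using minkowski.tendsto[OF tendsto_const y'(2), of w] xy(4) by (rule order_tendstoD)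
    ultimately have "eventually (\<lambda>n. w \<in> crossing (L n)) sequentially"
      by eventually_elim (use x'(1) y'(1) in \<open>auto simp: crossing_def\<close>)
    then show "w \<in> (\<Union>n. A n)"
      by (auto simp: A_def eventually_sequentially)
  qed
  then have "crossing_vol K \<le> emeasure dual_measure (\<Union>n. A n)"
    by (rule emeasure_mono) simp
  also have "\<dots> = (SUP n. emeasure dual_measure (A n))"
    by (rule SUP_emeasure_incseq[symmetric]) (auto simp: incseq_def A_def)
  also have "\<dots> \<le> a"
  proof (rule SUP_least)
    fix n
    have "emeasure dual_measure (A n) \<le> crossing_vol (L n)"
      by (intro emeasure_mono) (auto simp: A_def)
    then show "emeasure dual_measure (A n) \<le> a" using a order_trans by blast
  qed
  finally show ?thesis .
qed

text \<open>Passing to the side of the mirror that contains the origin brings a point no farther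
  from the origin. This keeps all symmetrized sets in one fixed ball.\<close>

lemma reflect_mem_hcball_origin:
  assumes "e \<star> e = 1" "(0, 1) \<star> e \<ge> 0" "x \<in> hcball (0, 1) c" "x \<star> e \<le> 0"
  shows "reflect e x \<in> hcball (0, 1) c"
proof -
  have "(0, 1) \<star> reflect e x = (0, 1) \<star> x - 2 * ((x \<star> e) * ((0, 1) \<star> e))"
    by (simp add: reflect_def minkowski_simps)
  moreover have "(x \<star> e) * ((0, 1) \<star> e) \<le> 0"
    using assms by (simp add: mult_nonpos_nonneg)
  ultimately show ?thesis using assms by (simp add: hcball_def)
qed

text \<open>
  Among the compact subsets of a large ball with at least the volume of \<open>hcball (0, 1) c\<close> and at
  most the dual measure of \<open>K\<close>, one that meets \<open>hcball (0, 1) c\<close> in maximal volume must contain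
  it: otherwise a two-point symmetrization would increase the volume of the intersection.
\<close>

theorem emeasure_crossing_hcball_le:
  fixes K :: "('a::euclidean_space \<times> real) set"
  assumes K: "compact K" "K \<subseteq> hyp_space" and c: "c > 1"
    and vol: "hvol (hcball (0::'a, 1) c) \<le> hvol K"
  shows "crossing_vol (hcball (0::'a, 1) c) \<le> crossing_vol K"
proof -
  let ?\<mu> = "hyp_volume_measure :: ('a \<times> real) measure"
  define B where "B = hcball (0::'a, 1) c"
  have [measurable]: "B \<in> sets borel" by (simp add: B_def)
  have "compact (snd ` K)" by (intro compact_continuous_image K continuous_intros)
  then obtain R0 where R0: "\<And>x. x \<in> K \<Longrightarrow> snd x \<le> R0"
    by (metis bounded_has_Sup(1) compact_imp_bounded empty_iff imageI)
  define R where "R = max R0 c"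
  define X where "X = hcball (0::'a, 1) R"
  have [measurable]: "X \<in> sets borel" by (simp add: X_def)
  have X: "compact X" "X \<subseteq> hyp_space"
    unfolding X_def by (auto intro!: compact_hcball hball_subset)
  have BX: "B \<subseteq> X" by (auto simp: B_def X_def hcball_origin R_def)
  have KX: "K \<subseteq> X" using K R0 by (fastforce simp: X_def hcball_origin R_def)
  have finX: "emeasure ?\<mu> X < top"
    by (rule emeasure_hyp_volume_finite[OF \<open>X \<in> sets borel\<close> X(2), of R]) (simp add: X_def hcball_origin)
  have finB: "emeasure ?\<mu> B < top"
    using finX emeasure_mono[OF BX, of ?\<mu>] by (simp add: le_less_trans)
  have "(0, 1) \<in> hball (0::'a, 1) c" using c by (simp add: hball_def minkowski_origin)
  then have "emeasure ?\<mu> (hball (0::'a, 1) c) > 0"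
    by (intro emeasure_hyp_volume_open_pos openin_hball) auto
  then have posB: "emeasure ?\<mu> B > 0"
    using c by (simp add: B_def emeasure_hball_eq_hcball)
  define C where "C = {L. compact L \<and> L \<subseteq> X \<and> emeasure ?\<mu> B \<le> emeasure ?\<mu> L \<and>
      crossing_vol L \<le> crossing_vol K}"
  have "K \<in> C" using K KX vol by (simp add: C_def B_def)
  define f where "f L = emeasure ?\<mu> (L \<inter> B)" for L
  obtain s where s: "incseq s" "range s \<subseteq> f ` C" "(SUP L\<in>C. f L) = (SUP i. s i)"
    using ennreal_Sup_countable_SUP[of "f ` C"] \<open>K \<in> C\<close> by auto
  obtain L where L: "\<And>i. L i \<in> C" "\<And>i. s i = f (L i)"
  proof -
    have "\<exists>L\<in>C. s i = f L" for i using s(2) by blast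
    then show thesis using that by metis
  qed
  have Lne: "L i \<noteq> {}" for i
    using L(1)[of i] posB by (auto simp: C_def)
  obtain k L' where k: "strict_mono k" and L': "compact L'" "L' \<subseteq> X" "L' \<noteq> {}"
    and nbhd: "\<And>U. open U \<Longrightarrow> L' \<subseteq> U \<Longrightarrow> eventually (\<lambda>n. L (k n) \<subseteq> U) sequentially"
    and approx: "\<And>x. x \<in> L' \<Longrightarrow> \<exists>y. (\<forall>n. y n \<in> L (k n)) \<and> y \<longlonglongrightarrow> x"
  proof (rule Hausdorff_convergent_subsequence[OF X(1), of L])
    show "closed (L n)" "L n \<subseteq> X" "L n \<noteq> {}" for n
      using L(1)[of n] Lne by (simp_all add: C_def compact_imp_closed)
  qed (rule that)
  have [measurable]: "L' \<in> sets borel" using L'(1) by (rule borel_compact)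
  have "emeasure ?\<mu> B \<le> emeasure ?\<mu> (L' \<inter> X)"
  proof (rule emeasure_Hausdorff_limit[OF _ _ _ _ _ nbhd])
    have "L i \<inter> X = L i" for i using L(1)[of i] by (auto simp: C_def)
    then show "eventually (\<lambda>n. emeasure ?\<mu> B \<le> emeasure ?\<mu> (L (k n) \<inter> X)) sequentially"
      using L(1) by (auto simp: C_def)
  qed (use L' finX compact_imp_closed in auto)
  also have "L' \<inter> X = L'" using L'(2) by blast
  finally have volL': "emeasure ?\<mu> B \<le> emeasure ?\<mu> L'" .
  have dualL': "crossing_vol L' \<le> crossing_vol K"
    by (rule emeasure_crossing_Hausdorff_limit[OF approx]) (use L(1) in \<open>auto simp: C_def\<close>)
  have "L' \<in> C" using L' volL' dualL' by (simp add: C_def)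
  have maximal: "f L'' \<le> f L'" if "L'' \<in> C" for L''
  proof -
    have "s i \<le> f L'" for i
      unfolding f_def
    proof (rule emeasure_Hausdorff_limit[OF _ _ _ _ _ nbhd])
      have "s i \<le> emeasure ?\<mu> (L (k n) \<inter> B)" if "i \<le> n" for n
        using incseqD[OF s(1), of i "k n"] seq_suble[OF k, of n] that L(2)[of "k n"] by (simp add: f_def)
      then show "eventually (\<lambda>n. s i \<le> emeasure ?\<mu> (L (k n) \<inter> B)) sequentially"
        by (auto simp: eventually_sequentially)
    qed (use L' finB compact_imp_closed in auto)
    then have "(SUP L\<in>C. f L) \<le> f L'" unfolding s(3) by (rule SUP_least)
    then show ?thesis using that by (meson SUP_upper order_trans)
  qed
  have null: "emeasure ?\<mu> (B - L') = 0"
  proof (rule ccontr)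
    assume "emeasure ?\<mu> (B - L') \<noteq> 0"
    then have pos: "emeasure ?\<mu> (B - L') > 0" by (simp add: zero_less_iff_neq_zero)
    have split: "emeasure ?\<mu> (L' \<inter> B) + emeasure ?\<mu> (L' - B) = emeasure ?\<mu> L'"
      "emeasure ?\<mu> (L' \<inter> B) + emeasure ?\<mu> (B - L') = emeasure ?\<mu> B"
    proof -
      have "L' \<inter> B \<union> (L' - B) = L'" "L' \<inter> B \<union> (B - L') = B" by blast+
      moreover have "L' \<inter> B \<inter> (L' - B) = {}" "L' \<inter> B \<inter> (B - L') = {}" by blast+
      ultimately show "emeasure ?\<mu> (L' \<inter> B) + emeasure ?\<mu> (L' - B) = emeasure ?\<mu> L'"
        "emeasure ?\<mu> (L' \<inter> B) + emeasure ?\<mu> (B - L') = emeasure ?\<mu> B"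
        by (simp_all add: plus_emeasure)
    qed
    \<comment> \<open>\<open>L'\<close> has at least the volume of \<open>B\<close>, so a deficit
      inside \<open>B\<close> forces an excess outside.\<close>
    have "emeasure ?\<mu> (L' - B) > 0"
    proof (rule ccontr)
      assume "\<not> emeasure ?\<mu> (L' - B) > 0"
      then have "emeasure ?\<mu> B \<le> emeasure ?\<mu> (L' \<inter> B)"
        using volL' split(1) by simp
      moreover have "emeasure ?\<mu> (L' \<inter> B) < top"
        using split(2) finB by (metis ennreal_add_less_top)
      then have "emeasure ?\<mu> (L' \<inter> B) < emeasure ?\<mu> (L' \<inter> B) + emeasure ?\<mu> (B - L')"
        using pos by (simp add: less_top)
      ultimately show False using split(2) by simp
    qed
    then obtain y where y: "y \<in> L' - B" "\<And>U. open U \<Longrightarrow> y \<in> U \<Longrightarrow> emeasure ?\<mu> (U \<inter> (L' - B)) > 0"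
      by (rule emeasure_support_point[rotated 2]) auto
    \<comment> \<open>The missed point is sought in the open ball, so that a whole neighbourhood of
      it in the hyperboloid lies in \<open>B - L'\<close>.\<close>
    have "hball (0, 1) c - L' \<noteq> {}"
    proof
      assume "hball (0, 1) c - L' = {}"
      then have "B - L' \<subseteq> hcball (0, 1) c - hball (0, 1) c" by (auto simp: B_def)
      then have "emeasure ?\<mu> (B - L') \<le> emeasure ?\<mu> (hcball (0, 1) c - hball (0, 1) c)"
        by (rule emeasure_mono) simp
      also have "\<dots> = 0"
        using emeasure_hball_eq_hcball[of "(0::'a, 1)" c] c finB
        by (subst emeasure_Diff) (auto simp: hball_subset B_def less_top)
      finally show False using pos by simp
    qed
    then obtain x where x: "x \<in> hball (0, 1) c" "x \<notin> L'" by blast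
    have xH: "x \<in> hyp_space" "snd x < c" using x(1) by (auto simp: hball_def minkowski_origin)
    have yH: "y \<in> hyp_space" "snd y > c" using y(1) L'(2) X(2) by (auto simp: B_def hcball_origin)
    \<comment> \<open>The reflection carries \<open>y\<close>, near which \<open>L' - B\<close> has
      positive volume at every scale, to the missed point \<open>x\<close>. Symmetrizing therefore
      fills a set of positive volume in \<open>B - L'\<close>.\<close>
    define e where "e = bisector x y"
    have xy: "x \<noteq> y" using xH yH by auto
    have e: "e \<star> e = 1" "reflect e x = y"
      using xH yH xy by (auto simp: e_def bisector_unit reflect_bisector)
    then have ey: "reflect e y = x" by (metis reflect_reflect)
    have oe: "(0, 1) \<star> e > 0"
      unfolding e_def minkowski_bisector_pos_iff[OF xH(1) yH(1) xy] using xH yH by (simp add: minkowski_origin)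
    define D where "D = {z \<in> B. z \<notin> L' \<and> reflect e z \<in> L' - B}"
    define W where "W = {q. - ((0, 1) \<star> q) < c} - L'"
    have "open {q :: 'a \<times> real. - ((0, 1) \<star> q) < c}"
      by (intro open_Collect_less continuous_intros)
    then have "open W" unfolding W_def using L'(1) by (intro open_Diff compact_imp_closed)
    have WH: "W \<inter> hyp_space \<subseteq> B - L'" by (auto simp: W_def B_def hcball_def)
    define U where "U = reflect e -` W"
    have "open U"
      unfolding U_def using \<open>open W\<close> by (rule open_vimage) (intro continuous_on_reflect continuous_on_id)
    have "y \<in> U" using x by (simp add: U_def ey W_def hball_def)
    have UL: "U \<inter> (L' - B) \<subseteq> hyp_space" using L'(2) X(2) by blast
    have "reflect e ` (U \<inter> (L' - B)) \<subseteq> D"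
    proof
      fix z assume "z \<in> reflect e ` (U \<inter> (L' - B))"
      then have z: "z \<in> W" "reflect e z \<in> L' - B"
        by (auto simp: U_def reflect_image_iff[OF e(1)] e(1))
      moreover from z(2) have "reflect e z \<in> hyp_space" using L'(2) X(2) by blast
      then have "z \<in> hyp_space" using e(1) by simp
      ultimately show "z \<in> D" using WH by (auto simp: D_def)
    qed
    moreover have "D \<in> sets borel"
    proof -
      have "D = (B - L') \<inter> reflect e -` (L' - B)" by (auto simp: D_def)
      moreover have "reflect e -` (L' - B) \<in> sets borel"
        by (rule measurable_sets_borel[OF reflect_measurable]) simp
      ultimately show ?thesis by simp
    qed
    ultimately have "emeasure ?\<mu> (reflect e ` (U \<inter> (L' - B))) \<le> emeasure ?\<mu> D"
      by (intro emeasure_mono) auto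
    moreover have "emeasure ?\<mu> (reflect e ` (U \<inter> (L' - B))) = emeasure ?\<mu> (U \<inter> (L' - B))"
      using \<open>open U\<close> by (intro emeasure_hyp_volume_measure_reflect[OF e(1) _ UL]) auto
    ultimately have D: "emeasure ?\<mu> D > 0"
      using y(2)[OF \<open>open U\<close> \<open>y \<in> U\<close>] by simp
    have L'H: "L' \<subseteq> hyp_space" using L'(2) X(2) by blast
    have "two_point e L' \<in> C"
      unfolding C_def
    proof (intro CollectI conjI)
      show "compact (two_point e L')" by (rule compact_two_point[OF e(1) L'(1)])
      show "two_point e L' \<subseteq> X"
      proof
        fix z assume z: "z \<in> two_point e L'"
        show "z \<in> X"
        proof (cases "z \<in> L'")
          case False
          then have "z \<star> e \<ge> 0" "reflect e z \<in> X"
            using z L'(2) by (auto simp: two_point_def split: if_splits)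
          then have "reflect e z \<in> hcball (0, 1) R" "reflect e z \<star> e \<le> 0"
            using e(1) by (simp_all add: X_def)
          from reflect_mem_hcball_origin[OF e(1) less_imp_le[OF oe] this]
          show ?thesis using e(1) by (simp add: X_def)
        qed (use L'(2) in blast)
      qed
      show "emeasure ?\<mu> B \<le> emeasure ?\<mu> (two_point e L')"
        using volL' by (simp add: emeasure_two_point[OF e(1) L'(1) L'H])
      show "crossing_vol (two_point e L') \<le> crossing_vol K"
        using emeasure_crossing_two_point[OF e(1)] dualL' by (rule order_trans)
    qed
    then have "f (two_point e L') \<le> f L'" by (rule maximal)
    moreover have "f L' + emeasure ?\<mu> D \<le> f (two_point e L')"
      unfolding f_def D_def
    proof (rule emeasure_two_point_Int[OF e(1) L'(1) L'H])
      show "reflect e z \<in> B" if "z \<in> B" "z \<star> e < 0" for z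
        using reflect_mem_hcball_origin[OF e(1) less_imp_le[OF oe]] that by (simp add: B_def)
    qed simp
    moreover have "f L' < f L' + emeasure ?\<mu> D"
    proof -
      have "f L' \<le> emeasure ?\<mu> B" unfolding f_def by (rule emeasure_mono) auto
      then have "f L' < top" using finB by (rule le_less_trans)
      then show ?thesis using D by (simp add: less_top)
    qed
    ultimately show False by (meson leD order_trans)
  qed
  \<comment> \<open>Points of the open ball missed by the closed set \<open>L'\<close> would form a
    nonempty open set of volume zero.\<close>
  have "hball (0, 1) c \<subseteq> L'"
  proof (rule ccontr)
    assume "\<not> hball (0, 1) c \<subseteq> L'"
    then have ne: "hball (0, 1) c - L' \<noteq> {}" by blast
    have "openin (top_of_set hyp_space) (hball (0, 1) c - L')"
      using openin_hball L'(1,2) X(2) by (intro openin_diff closed_subset compact_imp_closed) auto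
    from emeasure_hyp_volume_open_pos[OF this ne]
    have "0 < emeasure ?\<mu> (hball (0, 1) c - L')" .
    also have "\<dots> \<le> emeasure ?\<mu> (B - L')"
      by (rule emeasure_mono) (auto simp: B_def hball_subset(3)[THEN subsetD])
    finally show False using null by simp
  qed
  then have "crossing B \<subseteq> crossing L'"
    unfolding B_def using crossing_hcball[of "(0::'a, 1)" c] c crossing_mono[of "hball (0, 1) c" L'] by simp
  then have "crossing_vol B \<le> crossing_vol L'"
    by (rule emeasure_mono) simp
  then show ?thesis using dualL' unfolding B_def by (rule order_trans)
qed

section \<open>Supporting hyperplanes of smooth domains\<close>

text \<open>The inequality read backwards, through strict monotonicity of the crossing measure in
  the radius: balls maximise volume. This is the form of extremality exploited in the equality
  case.\<close>

lemma emeasure_le_hcball_of_crossing_le: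
  fixes K :: "('a::euclidean_space \<times> real) set"
  assumes dim: "DIM('a) \<ge> 2" and K: "compact K" "K \<subseteq> hyp_space" and c: "c \<ge> 1"
    and le: "crossing_vol K \<le> crossing_vol (hcball (0::'a, 1) c)"
  shows "hvol K \<le> hvol (hcball (0::'a, 1) c)"
proof (rule ccontr)
  assume "\<not> ?thesis"
  then have less: "hvol (hcball (0::'a, 1) c) < hvol K"
    by (simp add: not_le)
  have "compact (snd ` K)" by (intro compact_continuous_image K continuous_intros)
  then obtain R where "\<And>x. x \<in> K \<Longrightarrow> snd x \<le> R"
    by (metis bounded_has_Sup(1) compact_imp_bounded empty_iff imageI)
  then have fin: "hvol K < top"
    using emeasure_hyp_volume_finite[of K R] borel_compact[OF K(1)] K(2) by blast
  define V where "V = measure hyp_volume_measure K"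
  have V: "hvol K = ennreal V"
    using fin by (simp add: V_def emeasure_eq_ennreal_measure less_top)
  have "V > 0"
    using less V by (metis ennreal_neg not_less not_less_zero)
  then obtain c' where c': "c' > 1" "hvol (hcball (0::'a, 1) c') = ennreal V"
    using exists_hcball_of_volume[OF dim] by blast
  have "c < c'"
  proof (rule ccontr)
    assume "\<not> c < c'"
    then have "hcball (0::'a, 1) c' \<subseteq> hcball (0, 1) c" by (auto simp: hcball_def)
    then have "hvol (hcball (0::'a, 1) c') \<le> hvol (hcball (0::'a, 1) c)"
      by (rule emeasure_mono) simp
    then show False using less V c'(2) by simp
  qed
  then have "crossing_vol (hcball (0::'a, 1) c) < crossing_vol (hcball (0::'a, 1) c')"
    by (rule emeasure_crossing_hcball_strict_mono[OF c])
  also have "\<dots> \<le> crossing_vol K"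
    by (rule emeasure_crossing_hcball_le[OF K c'(1)]) (simp add: V c'(2))
  finally show False using le by simp
qed

section \<open>Tangent directions at a smooth boundary\<close>

lemma hyp_space_curve_tendsto:
  fixes z v :: "'a::euclidean_space \<times> real"
  shows "((\<lambda>t. hyp_curve z v t) \<longlongrightarrow> z) (at_right 0)"
proof -
  have "((\<lambda>t. hyp_curve z v t) \<longlongrightarrow> sqrt (1 + 0\<^sup>2 * (v \<star> v)) *\<^sub>R z + 0 *\<^sub>R v) (at_right 0)"
    by (intro tendsto_intros)
  then show ?thesis by simp
qed

lemma hyp_space_curve_has_vector_derivative:
  fixes z v :: "'a::euclidean_space \<times> real"
  shows "((\<lambda>t. hyp_curve z v t) has_vector_derivative v) (at 0)"
proof -
  have "((\<lambda>t. sqrt (1 + t\<^sup>2 * (v \<star> v))) has_real_derivative 0) (at 0)"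
    by (auto intro!: derivative_eq_intros)
  from has_vector_derivative_scaleR[OF this has_vector_derivative_const[of z]]
  have "((\<lambda>t. sqrt (1 + t\<^sup>2 * (v \<star> v)) *\<^sub>R z) has_vector_derivative 0) (at 0)" by simp
  moreover have "((\<lambda>t. t *\<^sub>R v) has_vector_derivative v) (at 0)"
    using has_vector_derivative_scaleR[OF DERIV_ident has_vector_derivative_const[of v], of "0::real"] by simp
  ultimately show ?thesis
    using has_vector_derivative_add by fastforce
qed

text \<open>Moving from \<open>z\<close> along \<open>w\<close> makes the product
  \<open>w \<star> q t = t (w \<star> w)\<close> positive, so no neighbourhood of \<open>z\<close>
  in the hyperboloid lies in \<open>\<Omega>\<close>.\<close>

lemma polar_tangent_not_mem:
  assumes "openin (top_of_set hyp_space) \<Omega>" "w \<star> w > 0" "w \<star> z = 0" "w \<in> polar \<Omega>"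
  shows "z \<notin> \<Omega>"
proof
  assume z: "z \<in> \<Omega>"
  obtain U where U: "open U" "\<Omega> = hyp_space \<inter> U"
    using assms(1) by (auto simp: openin_open)
  define q where "q t = hyp_curve z w t" for t
  have "eventually (\<lambda>t. q t \<in> U) (at_right 0)"
    using topological_tendstoD[OF hyp_space_curve_tendsto U(1)] z U(2) by (simp add: q_def)
  moreover have "eventually (\<lambda>t. (t::real) > 0) (at_right 0)"
    by (rule eventually_at_right_less)
  ultimately have "eventually (\<lambda>t. t > 0 \<and> q t \<in> U) (at_right 0)"
    by eventually_elim simp
  then obtain t where t: "t > 0" "q t \<in> U"
    using eventually_happens[of _ "at_right (0::real)"] by (auto simp: trivial_limit_at_right_real)
  have "q t \<in> hyp_space"
    unfolding q_def using z U(2) assms(3) by (intro hyp_space_curve) auto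
  then have "w \<star> q t \<le> 0" using t(2) U(2) assms(4) by (auto simp: polar_def)
  moreover have "w \<star> q t = t * (w \<star> w)"
    using assms(3) by (simp add: q_def minkowski_simps)
  ultimately show False using t(1) assms(2) by (simp add: mult_le_0_iff)
qed

lemma hyp_boundary_eq:
  assumes "openin (top_of_set hyp_space) \<Omega>"
  shows "hyp_boundary \<Omega> = closure \<Omega> - \<Omega>"
proof -
  have "\<Omega> \<subseteq> hyp_space" using openin_imp_subset[OF assms] .
  moreover from this have "closure \<Omega> \<subseteq> hyp_space" by (rule closure_minimal[OF _ closed_hyp_space])
  ultimately have "hyp_space \<inter> \<Omega> = \<Omega>" "hyp_space \<inter> closure \<Omega> = closure \<Omega>" by blast+
  then show ?thesis
    by (simp only: hyp_boundary_def frontier_of_openin[OF assms] closure_of_subtopology euclidean_closure_of)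
qed

text \<open>Extracts the first-order data of a defining function. With \<open>v\<close> also
  \<open>- v\<close> is tangent to the hyperboloid, which yields both an inward and an outward
  direction.\<close>

lemma smooth_boundary_direction:
  assumes "smooth_boundary \<Omega>" "z \<in> hyp_boundary \<Omega>"
  obtains U f D where "open U" "z \<in> U" "continuous_on U f" "linear D" "f z = (0::real)"
    "\<Omega> \<inter> U = {q \<in> hyp_space \<inter> U. f q < 0}"
    "(f has_derivative D) (at z)" "\<exists>v. v \<star> z = 0 \<and> D v < 0" "\<exists>v. v \<star> z = 0 \<and> D v > 0"
proof -
  obtain U f v where U: "open U" "z \<in> U" and f: "smooth_on f U"
    and \<Omega>: "\<Omega> \<inter> U = {q \<in> hyp_space \<inter> U. f q < (0::real)}"
    and bd: "hyp_boundary \<Omega> \<inter> U = {q \<in> hyp_space \<inter> U. f q = 0}"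
    and v: "v \<star> z = 0" "frechet_derivative f (at z) v \<noteq> 0"
    using bspec[OF assms(1)[unfolded smooth_boundary_def] assms(2)] by (elim exE conjE) (rule that)
  define D where "D = frechet_derivative f (at z)"
  have "Ck_on 0 f U" "Ck_on (Suc 0) f U" using f unfolding smooth_on_def by (rule spec)+
  then have "continuous_on U f" "f differentiable (at z)" using U(2) by simp_all
  then have D: "(f has_derivative D) (at z)"
    by (simp add: D_def frechet_derivative_works)
  then have lin: "linear D" by (rule has_derivative_linear)
  have "D (- v) = - D v" by (rule linear_neg[OF lin])
  moreover have "(- v) \<star> z = 0" using v by (simp add: minkowski_simps)
  moreover have "D v < 0 \<or> D v > 0" using v by (auto simp: D_def)
  ultimately have "\<exists>v. v \<star> z = 0 \<and> D v < 0" "\<exists>v. v \<star> z = 0 \<and> D v > 0"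
    using v(1) by (metis neg_0_less_iff_less neg_less_0_iff_less)+
  moreover have "f z = 0" using assms(2) U(2) bd by blast
  ultimately show thesis
    by (intro that[OF U \<open>continuous_on U f\<close> lin _ \<Omega> D])
qed

lemma derivative_along_hyp_space_curve:
  fixes f :: "'a::euclidean_space \<times> real \<Rightarrow> real"
  assumes "(f has_derivative D) (at z)"
  shows "((\<lambda>t. f (hyp_curve z v t)) has_real_derivative D v) (at 0)"
proof -
  let ?q = "\<lambda>t. hyp_curve z v t"
  have "(f has_derivative D) (at (?q 0))" using assms by simp
  from has_derivative_compose[OF hyp_space_curve_has_vector_derivative[of v z, unfolded has_vector_derivative_def] this]
  have "((\<lambda>t. f (?q t)) has_derivative (\<lambda>t. D (t *\<^sub>R v))) (at 0)" .
  then show ?thesis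
    using linear_scale[OF has_derivative_linear[OF assms]]
    by (simp add: has_field_derivative_def mult.commute[of "D v"] mult_commute_abs)
qed

lemma smooth_boundary_inward:
  assumes z: "z \<in> hyp_space" and N: "open N" "z \<in> N"
    and f: "(f has_derivative D) (at z)" "f z = (0::real)" and v: "v \<star> z = 0" "D v < 0"
  obtains t where "t > 0" "hyp_curve z v t \<in> hyp_space \<inter> N"
    "f (hyp_curve z v t) < 0"
proof -
  let ?q = "\<lambda>t. hyp_curve z v t"
  obtain d where d: "d > 0" "\<And>t. 0 < t \<Longrightarrow> t < d \<Longrightarrow> f (?q t) < 0"
    using has_real_derivative_neg_dec_right[OF derivative_along_hyp_space_curve[OF f(1), of v] v(2)] f(2)
    by auto
  have "eventually (\<lambda>t. ?q t \<in> N) (at_right 0)"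
    using topological_tendstoD[OF hyp_space_curve_tendsto N] .
  moreover have "eventually (\<lambda>t. t \<in> {0<..<d}) (at_right 0)"
    using d(1) by (rule eventually_at_right_real)
  ultimately have "eventually (\<lambda>t. ?q t \<in> N \<and> t \<in> {0<..<d}) (at_right 0)"
    by eventually_elim simp
  then obtain t where "?q t \<in> N" "0 < t" "t < d"
    using eventually_happens[of _ "at_right (0::real)"] by (auto simp: trivial_limit_at_right_real)
  then show thesis
    using that[of t] d(2)[of t] hyp_space_curve[OF z v(1), of t] by simp
qed

text \<open>Every inward direction \<open>v\<close>, one with \<open>D v < 0\<close>, satisfies
  \<open>w \<star> v \<le> 0\<close>. So on the tangent space \<open>w\<close> acts as a nonnegative
  multiple of \<open>D\<close>; the multiple is fixed by \<open>w \<star> w = 1\<close>, and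
  definiteness of the form on the tangent space then determines \<open>w\<close>.\<close>

lemma smooth_boundary_normal_unique:
  assumes \<Omega>: "smooth_boundary \<Omega>" "z \<in> hyp_boundary \<Omega>" "z \<in> hyp_space"
    and N: "open N" "z \<in> N"
    and w: "w \<star> w = 1" "w \<star> z = 0" "\<And>x. x \<in> \<Omega> \<inter> N \<Longrightarrow> w \<star> x \<le> 0"
    and w': "w' \<star> w' = 1" "w' \<star> z = 0" "\<And>x. x \<in> \<Omega> \<inter> N \<Longrightarrow> w' \<star> x \<le> 0"
  shows "w = w'"
proof -
  obtain U f D where U: "open U" "z \<in> U" and D: "linear D" and fz: "f z = (0::real)"
    and \<Omega>U: "\<Omega> \<inter> U = {q \<in> hyp_space \<inter> U. f q < 0}"
    and f: "(f has_derivative D) (at z)" and "\<exists>v. v \<star> z = 0 \<and> D v < 0"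
    by (rule smooth_boundary_direction[OF \<Omega>(1,2)])
  then obtain v0 where v0: "v0 \<star> z = 0" "D v0 < 0" by blast
  have proportional: "w \<star> v = (w \<star> v0 / D v0) * D v" "w \<star> v0 \<le> 0"
    if w: "w \<star> z = 0" "\<And>x. x \<in> \<Omega> \<inter> N \<Longrightarrow> w \<star> x \<le> 0" and v: "v \<star> z = 0" for w v
  proof -
    have neg: "w \<star> v \<le> 0" if v: "v \<star> z = 0" "D v < 0" for v
    proof -
      have "open (N \<inter> U)" "z \<in> N \<inter> U" using N U by auto
      from smooth_boundary_inward[OF \<Omega>(3) this f fz v]
      obtain t where t: "t > 0" "hyp_curve z v t \<in> hyp_space \<inter> (N \<inter> U)"
        "f (hyp_curve z v t) < 0" .
      then have "hyp_curve z v t \<in> \<Omega> \<inter> N" using \<Omega>U by blast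
      then have "w \<star> (hyp_curve z v t) \<le> 0" by (rule w(2))
      then show ?thesis using t(1) w(1) by (simp add: minkowski_simps mult_le_0_iff)
    qed
    then show "w \<star> v0 \<le> 0" using v0 by blast
    have ker: "w \<star> v \<le> 0" if v: "v \<star> z = 0" "D v = 0" for v
    proof (rule ccontr)
      assume "\<not> w \<star> v \<le> 0"
      \<comment> \<open>Adding \<open>\<epsilon> v0\<close> makes \<open>v\<close> strictly inward,
        while \<open>\<epsilon>\<close> is small enough for the product with \<open>w\<close> to
        stay positive.\<close>
      define \<epsilon> where "\<epsilon> = (w \<star> v) / (1 + \<bar>w \<star> v0\<bar>)"
      have pos: "1 + \<bar>w \<star> v0\<bar> > 0" by simp
      have "\<epsilon> > 0" using \<open>\<not> w \<star> v \<le> 0\<close> pos by (simp add: \<epsilon>_def)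
      have "D (v + \<epsilon> *\<^sub>R v0) < 0"
        using v v0 \<open>\<epsilon> > 0\<close> by (simp add: linear_add[OF D] linear_scale[OF D] mult_pos_neg)
      then have "w \<star> (v + \<epsilon> *\<^sub>R v0) \<le> 0"
        using v v0 by (intro neg) (simp_all add: minkowski_simps)
      then have "w \<star> v \<le> \<epsilon> * \<bar>w \<star> v0\<bar>"
        using \<open>\<epsilon> > 0\<close> mult_left_mono[OF abs_ge_minus_self[of "w \<star> v0"], of \<epsilon>] by (simp add: minkowski_simps)
      also have "\<dots> < \<epsilon> * (1 + \<bar>w \<star> v0\<bar>)" using \<open>\<epsilon> > 0\<close> by simp
      also have "\<dots> = w \<star> v" using pos by (simp add: \<epsilon>_def)
      finally show False by simp
    qed
    define u where "u = v - (D v / D v0) *\<^sub>R v0"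
    have u: "u \<star> z = 0" "D u = 0"
      using v v0 by (simp_all add: u_def minkowski_simps linear_diff[OF D] linear_scale[OF D])
    then have "(- u) \<star> z = 0" "D (- u) = 0" by (simp_all add: minkowski_simps linear_neg[OF D])
    then have "w \<star> u = 0" using ker[OF u] ker[of "- u"] by (simp add: minkowski_simps)
    then show "w \<star> v = (w \<star> v0 / D v0) * D v"
      by (simp add: u_def minkowski_simps)
  qed
  define l l' where "l = w \<star> v0 / D v0" and "l' = w' \<star> v0 / D v0"
  have lw: "w \<star> v = l * D v" "w' \<star> v = l' * D v" if "v \<star> z = 0" for v
    using proportional(1)[OF w(2,3) that] proportional(1)[OF w'(2,3) that] by (auto simp: l_def l'_def)
  have "l \<ge> 0" "l' \<ge> 0"
    using proportional(2)[OF w(2,3) v0(1)] proportional(2)[OF w'(2,3) v0(1)] v0(2)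
    by (auto simp: l_def l'_def intro: divide_nonpos_neg)
  moreover have 1: "l * D w = 1" "l' * D w' = 1"
    using lw[OF w(2)] lw[OF w'(2)] w(1) w'(1) by simp_all
  ultimately have pos: "l > 0" "l' > 0" by (auto simp: order_less_le)
  have "l * D w' = l' * D w"
    using lw(1)[OF w'(2)] lw(2)[OF w(2)] by (simp add: minkowski_commute)
  then have "l * l * (l' * D w') = l' * l' * (l * D w)"
    by (simp add: algebra_simps)
  then have "l * l = l' * l'" by (simp add: 1)
  then have "l = l'" using pos by (metis less_eq_real_def real_sqrt_abs2 abs_of_nonneg)
  then have eq: "(w - w') \<star> v = 0" if "v \<star> z = 0" for v
    using lw[OF that] by (simp add: minkowski_simps)
  have "(w - w') \<star> z = 0" using w w' by (simp add: minkowski_simps)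
  then have "w - w' = 0" using eq tangent_self_nonneg(2)[OF \<Omega>(3)] by blast
  then show ?thesis by simp
qed

text \<open>Rules out slits: arbitrarily close to a smooth boundary point the exterior contains a
  nonempty open set. This is what finally identifies the domain with the whole ball.\<close>

lemma smooth_boundary_exterior:
  assumes \<Omega>: "smooth_boundary \<Omega>" "z \<in> hyp_boundary \<Omega>" "z \<in> hyp_space" and N: "open N" "z \<in> N"
  obtains G where "openin (top_of_set hyp_space) G" "G \<noteq> {}" "G \<subseteq> N" "G \<inter> \<Omega> = {}"
proof -
  obtain U f D where U: "open U" "z \<in> U" and cont: "continuous_on U f" and D: "linear D" and fz: "f z = (0::real)"
    and \<Omega>U: "\<Omega> \<inter> U = {q \<in> hyp_space \<inter> U. f q < 0}"
    and f: "(f has_derivative D) (at z)" and "\<exists>v. v \<star> z = 0 \<and> D v > 0"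
    by (rule smooth_boundary_direction[OF \<Omega>(1,2)])
  then obtain v where v: "v \<star> z = 0" "D v > 0" by blast
  have NU: "open (N \<inter> U)" "z \<in> N \<inter> U" using N U by auto
  have neg: "((\<lambda>x. - f x) has_derivative (\<lambda>x. - D x)) (at z)" using f by (rule has_derivative_minus)
  have "- f z = 0" "- D v < 0" using fz v by simp_all
  from smooth_boundary_inward[OF \<Omega>(3) NU neg this(1) v(1) this(2)]
  obtain t where "hyp_curve z v t \<in> hyp_space \<inter> (N \<inter> U)"
    "- f (hyp_curve z v t) < 0" .
  then obtain q where q: "q \<in> hyp_space \<inter> (N \<inter> U)" "f q > 0"
    by (metis neg_less_0_iff_less)
  have "open (U \<inter> f -` {0<..})"
    using continuous_open_preimage[OF cont U(1), of "{0<..}"] by simp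
  then have "openin (top_of_set hyp_space) (hyp_space \<inter> (N \<inter> (U \<inter> f -` {0<..})))"
    by (rule openin_open_Int[OF open_Int[OF N(1)]])
  moreover have "hyp_space \<inter> (N \<inter> (U \<inter> f -` {0<..})) \<inter> \<Omega> = {}"
  proof (intro equals0I)
    fix x assume x: "x \<in> hyp_space \<inter> (N \<inter> (U \<inter> f -` {0<..})) \<inter> \<Omega>"
    then have "x \<in> \<Omega> \<inter> U" by blast
    then have "f x < 0" using \<Omega>U by blast
    then show False using x by simp
  qed
  moreover have "q \<in> hyp_space \<inter> (N \<inter> (U \<inter> f -` {0<..}))" using q by simp
  ultimately show thesis by (intro that) auto
qed

text \<open>\<open>w\<close> is the outer unit normal at \<open>z\<close> of a hyperplane that
  supports all of \<open>K\<close>, not only the part near \<open>z\<close>.\<close>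

definition contact :: "('a::euclidean_space \<times> real) set \<Rightarrow> 'a \<times> real \<Rightarrow> 'a \<times> real \<Rightarrow> bool" where
  "contact K z w \<longleftrightarrow> z \<in> K \<and> w \<star> w = 1 \<and> w \<star> z = 0 \<and> w \<in> polar K"

section \<open>Existence of supporting hyperplanes\<close>

lemma polar_closure: "polar (closure K) = polar K"
proof -
  have "closure K \<subseteq> {x. w \<star> x \<le> 0}" if "w \<in> polar K" for w
    using that by (intro closure_minimal closed_Collect_le continuous_intros) (auto simp: polar_def)
  then show ?thesis using closure_subset[of K] by (auto simp: polar_def)
qed

text \<open>In the projective model \<open>fst x / snd x\<close> one maximises the linear functional
  given by \<open>u\<close>. The maximum \<open>\<tau>\<close> makes \<open>(u, \<tau>)\<close>
  supporting, and since the model lies in the open unit ball, this vector is spacelike and can be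
  normalised.\<close>

lemma exists_contact:
  fixes K :: "('a::euclidean_space \<times> real) set"
  assumes K: "compact K" "K \<subseteq> hyp_space" "K \<noteq> {}" and u: "norm u = 1"
  obtains z \<tau> where "contact K z ((1 / sqrt (1 - \<tau>\<^sup>2)) *\<^sub>R (u, \<tau>))" "\<bar>\<tau>\<bar> < 1"
proof -
  have pos: "snd x > 0" "norm (fst x) < snd x" if "x \<in> K" for x
    using that K(2) by (auto intro: hyp_space_snd_pos norm_fst_less_snd)
  have "continuous_on K (\<lambda>x. (u \<bullet> fst x) / snd x)"
  proof (intro continuous_intros ballI)
    show "snd x \<noteq> 0" if "x \<in> K" for x using pos(1)[OF that] by simp
  qed
  then obtain z where z: "z \<in> K" "\<And>x. x \<in> K \<Longrightarrow> (u \<bullet> fst x) / snd x \<le> (u \<bullet> fst z) / snd z"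
    using continuous_attains_sup[OF K(1,3)] by blast
  define \<tau> where "\<tau> = (u \<bullet> fst z) / snd z"
  have "\<bar>u \<bullet> fst z\<bar> < snd z"
    using Cauchy_Schwarz_ineq2[of u "fst z"] u pos[OF z(1)] by simp
  then have \<tau>: "\<bar>\<tau>\<bar> < 1"
    using pos[OF z(1)] by (simp add: \<tau>_def abs_divide)
  then have "1 - \<tau>\<^sup>2 > 0" by (simp add: abs_square_less_1)
  define k where "k = 1 / sqrt (1 - \<tau>\<^sup>2)"
  have k: "k > 0" "k\<^sup>2 * (1 - \<tau>\<^sup>2) = 1" using \<open>1 - \<tau>\<^sup>2 > 0\<close> by (simp_all add: k_def power_divide)
  have mk: "(u, \<tau>) \<star> x = u \<bullet> fst x - \<tau> * snd x" for x by (simp add: minkowski_def)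
  have "contact K z (k *\<^sub>R (u, \<tau>))"
    unfolding contact_def
  proof (intro conjI z(1))
    have "(u, \<tau>) \<star> (u, \<tau>) = 1 - \<tau>\<^sup>2" using u by (simp add: minkowski_self)
    then show "(k *\<^sub>R (u, \<tau>)) \<star> (k *\<^sub>R (u, \<tau>)) = 1"
      unfolding minkowski.scaleR_left minkowski.scaleR_right using k(2) by (simp add: power2_eq_square mult.assoc)
    show "(k *\<^sub>R (u, \<tau>)) \<star> z = 0"
      unfolding minkowski.scaleR_left mk using pos[OF z(1)] by (simp add: \<tau>_def)
    show "k *\<^sub>R (u, \<tau>) \<in> polar K"
      unfolding polar_def
    proof (intro CollectI ballI)
      fix x assume x: "x \<in> K"
      then have "u \<bullet> fst x \<le> \<tau> * snd x"
        using z(2)[OF x] pos[OF x] by (simp add: \<tau>_def[symmetric] pos_divide_le_eq)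
      then show "(k *\<^sub>R (u, \<tau>)) \<star> x \<le> 0"
        unfolding minkowski.scaleR_left mk using k(1) by (simp add: mult_le_0_iff)
    qed
  qed
  then show thesis using that \<tau> by (simp only: k_def)
qed

section \<open>The equality case\<close>

lemma tangent_normalized:
  assumes z: "z \<in> hyp_space" and u: "u \<noteq> 0" "u \<star> z = 0"
  obtains k where "k > 0" "(k *\<^sub>R u) \<star> (k *\<^sub>R u) = 1" "(k *\<^sub>R u) \<star> z = 0"
proof -
  have "u \<star> u > 0"
    using tangent_self_nonneg[OF z u(2)] u(1) by (simp add: order_less_le)
  then show thesis
    using that[of "1 / sqrt (u \<star> u)"] u(2) by (simp add: minkowski_simps real_div_sqrt flip: power2_eq_square)
qed

text \<open>Along the line the condition \<open>z1 \<star> z1 = -1\<close> is a quadratic equation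
  in \<open>\<gamma>\<close> with leading coefficient \<open>d \<star> d > 0\<close>; its roots 0
  and 1 belong to \<open>z\<close> and \<open>z2\<close>.\<close>

lemma hyp_space_no_three_collinear:
  assumes "z \<in> hyp_space" "z1 \<in> hyp_space" "z2 \<in> hyp_space"
    and "z - z1 = \<gamma> *\<^sub>R (z - z2)" "z \<noteq> z2"
  shows "z = z1 \<or> z1 = z2"
proof -
  define d where "d = z - z2"
  have d: "d \<star> d = 2 * (z \<star> d)" "z \<star> d > 0"
    using minkowski_diff_self[OF assms(1,3)] assms(5) by (simp_all add: d_def)
  have z1: "z1 = z - \<gamma> *\<^sub>R d" using assms(4) by (simp add: d_def algebra_simps)
  have "z1 \<star> z1 = z \<star> z - 2 * \<gamma> * (z \<star> d) + \<gamma> * \<gamma> * (d \<star> d)"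
    unfolding z1 by (simp add: minkowski_simps minkowski_commute[of d z] algebra_simps)
  then have "\<gamma> * \<gamma> * (d \<star> d) = \<gamma> * (d \<star> d)"
    using assms(1,2) by (auto simp: hyp_space_self d(1))
  then have "\<gamma> * \<gamma> = \<gamma>" using d by simp
  then have "\<gamma> = 0 \<or> \<gamma> = 1" by auto
  then show ?thesis using z1 by (auto simp: d_def)
qed

text \<open>Extremality is formulated as maximal volume at bounded crossing measure, because the
  competitors are obtained by adding volume without creating crossings.\<close>

locale extremal_domain =
  fixes \<Omega> :: "('a::euclidean_space \<times> real) set" and R :: real
  assumes openin_\<Omega>: "openin (top_of_set hyp_space) \<Omega>" and nonempty: "\<Omega> \<noteq> {}"
    and bounded: "\<And>x. x \<in> \<Omega> \<Longrightarrow> snd x \<le> R"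
    and smooth: "smooth_boundary \<Omega>"
    and extremal: "\<And>L :: ('a \<times> real) set. compact L \<Longrightarrow> L \<subseteq> hyp_space \<Longrightarrow>
      crossing_vol L \<le> crossing_vol (closure \<Omega>) \<Longrightarrow>
      hvol L \<le> hvol (closure \<Omega>)"
begin

abbreviation "K \<equiv> closure \<Omega>"

lemma \<Omega>_subset: "\<Omega> \<subseteq> hyp_space"
  by (rule openin_imp_subset[OF openin_\<Omega>])

lemma K_subset: "K \<subseteq> hyp_space"
  by (rule closure_minimal[OF \<Omega>_subset closed_hyp_space])

lemma K_bounded: "x \<in> K \<Longrightarrow> snd x \<le> R"
proof -
  assume "x \<in> K"
  moreover have "K \<subseteq> {x. snd x \<le> R}"
    by (intro closure_minimal closed_Collect_le continuous_intros) (use bounded in blast)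
  ultimately show "snd x \<le> R" by blast
qed

lemma compact_K: "compact K"
  by (rule compact_subset_hyp_space[OF closed_closure K_subset K_bounded])

lemma volume_K_finite: "hvol K < top"
  using emeasure_hyp_volume_finite[OF borel_closed[OF closed_closure] K_subset K_bounded] .

lemma contact_not_mem: "contact K z w \<Longrightarrow> z \<notin> \<Omega>"
  using polar_tangent_not_mem[OF openin_\<Omega>, of w z] by (simp add: contact_def polar_closure)

lemma contact_boundary:
  assumes "contact K z w"
  shows "z \<in> hyp_boundary \<Omega>" "z \<in> hyp_space"
  using assms contact_not_mem[OF assms] K_subset
  by (auto simp: hyp_boundary_eq[OF openin_\<Omega>] contact_def)

text \<open>The comparison is local, since a symmetrized set is only known to contain the part of
  \<open>\<Omega>\<close> on one side of the mirror and the reflection of the other part.\<close>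

lemma contact_normal_unique:
  assumes c: "contact K z w" and N: "open N" "z \<in> N"
    and v: "v \<star> v = 1" "v \<star> z = 0" "\<And>x. x \<in> \<Omega> \<inter> N \<Longrightarrow> v \<star> x \<le> 0"
  shows "v = w"
proof (rule smooth_boundary_normal_unique[OF smooth contact_boundary[OF c] N v])
  show "w \<star> w = 1" "w \<star> z = 0" using c by (simp_all add: contact_def)
  show "w \<star> x \<le> 0" if "x \<in> \<Omega> \<inter> N" for x
    using c that by (simp add: contact_def polar_closure) (simp add: polar_def)
qed

lemma contact_unique: "contact K z w \<Longrightarrow> contact K z w' \<Longrightarrow> w = w'"
  by (rule contact_normal_unique[where N = UNIV]) (auto simp: contact_def polar_closure, auto simp: polar_def)

text \<open>
  If the reflection exchanging two contact points does not exchange their normals, then the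
  two-point symmetrization misses a set of positive volume lying in its own convex hull. Adding
  this set leaves the dual measure unchanged, against extremality.
\<close>

lemma contact_reflect:
  assumes c: "contact K z w" and c': "contact K z' w'" and ne: "z \<noteq> z'"
  shows "reflect (bisector z z') w' = w"
proof (rule ccontr)
  assume ne_w: "reflect (bisector z z') w' \<noteq> w"
  define e where "e = bisector z z'"
  have zH: "z \<in> hyp_space" "z' \<in> hyp_space"
    using contact_boundary(2)[OF c] contact_boundary(2)[OF c'] by auto
  have e: "e \<star> e = 1" "reflect e z = z'" "z \<star> e > 0"
    using zH ne by (simp_all add: e_def bisector_unit reflect_bisector bisector_side)
  have e': "reflect e z' = z" using e(1,2) by (metis reflect_reflect)
  have z'e: "z' \<star> e < 0" using minkowski_reflect_axis[OF e(1), of z] e by simp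
  define w2 where "w2 = reflect e w'"
  have w2: "w2 \<star> w2 = 1" "w2 \<star> z = 0" "w2 \<noteq> w"
    using c' e e' ne_w by (simp_all add: w2_def contact_def e_def[symmetric] flip: minkowski_reflect_right)
  have w: "w \<star> w = 1" "w \<star> z = 0" "\<And>x. x \<in> K \<Longrightarrow> w \<star> x \<le> 0"
    and w': "\<And>x. x \<in> K \<Longrightarrow> w' \<star> x \<le> 0" and zK: "z \<in> K" "z' \<in> K"
    using c c' by (auto simp: contact_def polar_def)
  define T where "T = two_point e K"
  have T: "compact T" "T \<subseteq> hyp_space"
    using compact_two_point[OF e(1) compact_K] two_point_subset_hyp_space[OF e(1) K_subset] by (simp_all add: T_def)
  have zT: "z \<in> T" using zK e(3) by (simp add: T_def two_point_def)
  have \<Omega>T: "x \<in> T" if "x \<in> \<Omega>" "x \<star> e > 0" for x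
    using that closure_subset[of \<Omega>] by (auto simp: T_def two_point_def)
  have \<sigma>\<Omega>T: "reflect e x \<in> T" if "x \<in> \<Omega>" "x \<star> e < 0" for x
    using that closure_subset[of \<Omega>] e(1) by (auto simp: T_def two_point_def)
  \<comment> \<open>Near \<open>z\<close> the set \<open>T\<close> is the union of \<open>K\<close>
    and its mirror image, which have different normals \<open>w\<close> and \<open>w2\<close> at
    \<open>z\<close>. No hyperplane supports both there, so by compactness all points near
    \<open>z\<close> satisfy every inequality that holds on \<open>T\<close>.\<close>
  have "\<exists>\<epsilon>>0. \<forall>x\<in>hyp_space. dist x z < \<epsilon> \<longrightarrow> (\<forall>v\<in>polar T. v \<star> x \<le> 0)"
  proof (rule ccontr)
    assume contra: "\<not> ?thesis"
    have "\<exists>x v. x \<in> hyp_space \<and> dist x z < 1 / real (Suc n) \<and> v \<in> polar T \<and> v \<star> x > 0" for n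
    proof -
      have "1 / real (Suc n) > 0" by simp
      then show ?thesis using contra by (meson not_less)
    qed
    then obtain x v where xv: "\<And>n. x n \<in> hyp_space" "\<And>n. dist (x n) z < 1 / real (Suc n)"
      "\<And>n. v n \<in> polar T" "\<And>n. v n \<star> x n > 0"
      by metis
    have v0: "v n \<noteq> 0" for n using xv(4)[of n] by (auto simp: minkowski_simps)
    define u where "u n = (1 / norm (v n)) *\<^sub>R v n" for n
    have u: "u n \<in> sphere 0 1" "\<And>y. y \<in> T \<Longrightarrow> u n \<star> y \<le> 0" "u n \<star> x n \<ge> 0" for n
      using v0[of n] xv(3,4)[of n] by (auto simp: u_def minkowski_simps polar_def divide_nonpos_pos less_imp_le)
    have "(\<lambda>n. dist (x n) z) \<longlonglongrightarrow> 0"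
      using LIMSEQ_inverse_real_of_nat
      by (rule Lim_null_comparison[rotated]) (use xv(2) in \<open>auto simp: inverse_eq_divide intro!: always_eventually less_imp_le\<close>)
    then have xz: "x \<longlonglongrightarrow> z" by (subst tendsto_dist_iff)
    obtain u0 r where r: "u0 \<in> sphere 0 1" "strict_mono (r :: nat \<Rightarrow> nat)" "(u \<circ> r) \<longlonglongrightarrow> u0"
  proof (rule seq_compactE[OF compact_imp_seq_compact[OF compact_sphere[of "0 :: 'a \<times> real" 1]]])
      show "\<forall>n. u n \<in> sphere 0 1" using u(1) by blast
    qed (rule that)
    have u0T: "u0 \<star> y \<le> 0" if "y \<in> T" for y
      by (rule LIMSEQ_le_const2[OF minkowski.tendsto[OF r(3) tendsto_const]]) (use u(2)[OF that] in auto)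
    have "(\<lambda>n. u (r n) \<star> x (r n)) \<longlonglongrightarrow> u0 \<star> z"
      using minkowski.tendsto[OF r(3) LIMSEQ_subseq_LIMSEQ[OF xz r(2)]] by (simp add: o_def)
    then have "u0 \<star> z \<ge> 0" by (rule LIMSEQ_le_const) (use u(3) in auto)
    then have "u0 \<star> z = 0" using u0T[OF zT] by simp
    moreover have "u0 \<noteq> 0" using r(1) by auto
    ultimately obtain k where k: "k > 0" "(k *\<^sub>R u0) \<star> (k *\<^sub>R u0) = 1" "(k *\<^sub>R u0) \<star> z = 0"
      using tangent_normalized[OF zH(1)] by metis
    have kT: "(k *\<^sub>R u0) \<star> y \<le> 0" if "y \<in> T" for y
      using u0T[OF that] k(1) by (simp add: minkowski.scaleR_left mult_nonneg_nonpos)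
    have "open {x. x \<star> e > 0}" "open {x. x \<star> e < 0}"
      by (intro open_Collect_less continuous_intros)+
    \<comment> \<open>The limiting direction would be the normal of \<open>\<Omega>\<close> at
      \<open>z\<close> and, after reflection, also the normal at \<open>z'\<close>.\<close>
    then have "k *\<^sub>R u0 = w"
      using e(3) \<Omega>T kT by (intro contact_normal_unique[OF c _ _ k(2,3)]) auto
    moreover have "reflect e (k *\<^sub>R u0) = w'"
      using \<open>open {x. x \<star> e < 0}\<close>
    proof (rule contact_normal_unique[OF c'])
      show "reflect e (k *\<^sub>R u0) \<star> z' = 0"
        using minkowski_reflect_right[OF e(1), of "k *\<^sub>R u0" z'] k(3) e' by simp
      show "reflect e (k *\<^sub>R u0) \<star> x \<le> 0" if "x \<in> \<Omega> \<inter> {x. x \<star> e < 0}" for x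
        using minkowski_reflect_right[OF e(1), of "k *\<^sub>R u0" x] kT[OF \<sigma>\<Omega>T[of x]] that by simp
    qed (use k(2) z'e e(1) in auto)
    ultimately have "w2 = w" unfolding w2_def using e(1) by (metis reflect_reflect)
    then show False using w2(3) by simp
  qed
  then obtain \<epsilon> where \<epsilon>: "\<epsilon> > 0" "\<And>x v. x \<in> hyp_space \<Longrightarrow> dist x z < \<epsilon> \<Longrightarrow> v \<in> polar T \<Longrightarrow> v \<star> x \<le> 0"
    by blast
  \<comment> \<open>Opposite normals would give \<open>w \<star> z' = 0\<close>; then the reflection
    fixes \<open>w\<close>, hence \<open>w' = - w\<close> and \<open>K\<close> lies in a hyperplane,
    which is impossible for the closure of a nonempty open set.\<close>
  have "w2 \<noteq> - w"
  proof
    assume w2w: "w2 = - w"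
    have "w \<star> z' = - (w' \<star> z)"
      using minkowski_reflect_right[OF e(1), of w' z'] w2w by (simp add: w2_def e' minkowski_simps)
    then have "w \<star> z' = 0" using w(3)[OF zK(2)] w'[OF zK(1)] by simp
    then have "w \<star> e = 0"
      using w(2) zH ne by (simp add: e_def minkowski_bisector)
    then have "reflect e w = w" by (rule reflect_fixed[OF e(1)])
    then have "w' = - w"
      using w2w e(1) by (metis w2_def reflect_reflect linear_neg[OF linear_reflect])
    then have w0: "w \<star> x = 0" if "x \<in> K" for x
      using w(3)[OF that] w'[OF that] by (simp add: minkowski_simps)
    obtain x where x: "x \<in> \<Omega>" "x \<in> K" using nonempty closure_subset by blast
    have "w \<in> polar \<Omega>" using w(3) closure_subset[of \<Omega>] by (auto simp: polar_def)
    then show False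
      using polar_tangent_not_mem[OF openin_\<Omega> _ w0[OF x(2)]] w(1) x(1) by simp
  qed
  then have "w \<star> w2 > -1"
    using tangent_Cauchy_Schwarz[OF zH(1) w(2) w2(2) w(1) w2(1)] by (simp add: order_less_le)
  \<comment> \<open>This direction leaves both supporting half-spaces at once, because its product
    with \<open>w\<close> and with \<open>w2\<close> is \<open>1 + w \<star> w2 > 0\<close>. Points
    slightly along it are outside \<open>K\<close> and outside its mirror image.\<close>
  define v where "v = w + w2"
  have v: "v \<star> z = 0" using w(2) w2(2) by (simp add: v_def minkowski_simps)
  define q where "q t = hyp_curve z v t" for t
  have q: "(q \<longlongrightarrow> z) (at_right 0)" unfolding q_def by (rule hyp_space_curve_tendsto)
  have "eventually (\<lambda>t. dist (q t) z < \<epsilon>) (at_right 0)"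
    using q \<epsilon>(1) by (rule tendstoD)
  moreover have "eventually (\<lambda>t. q t \<star> e > 0) (at_right 0)"
    using minkowski.tendsto[OF q tendsto_const] e(3) by (rule order_tendstoD)
  moreover have "eventually (\<lambda>t. (t::real) > 0) (at_right 0)"
    by (rule eventually_at_right_less)
  ultimately have "eventually (\<lambda>t. dist (q t) z < \<epsilon> \<and> q t \<star> e > 0 \<and> t > 0) (at_right 0)"
    by eventually_elim simp
  then obtain t where t: "dist (q t) z < \<epsilon>" "q t \<star> e > 0" "t > 0"
    using eventually_happens[of _ "at_right (0::real)"] by (auto simp: trivial_limit_at_right_real)
  have "w \<star> q t = t * (1 + w \<star> w2)" "w2 \<star> q t = t * (1 + w \<star> w2)"
    using w w2 by (simp_all add: q_def v_def minkowski_simps minkowski_commute[of w2 w] add.commute)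
  then have wq: "w \<star> q t > 0" "w2 \<star> q t > 0"
    using t(3) \<open>w \<star> w2 > -1\<close> by simp_all
  define N where "N = {x. dist x z < \<epsilon>} \<inter> {x. x \<star> e > 0} \<inter> {x. w \<star> x > 0} \<inter> {x. w2 \<star> x > 0}"
  have "open N"
    unfolding N_def by (intro open_Int open_Collect_less continuous_intros)
  moreover have "q t \<in> N" using t wq by (simp add: N_def)
  ultimately obtain \<delta> where \<delta>: "\<delta> > 0" "cball (q t) \<delta> \<subseteq> N"
    using open_contains_cball by blast
  define C where "C = hyp_space \<inter> cball (q t) \<delta>"
  have "q t \<in> hyp_space" unfolding q_def by (rule hyp_space_curve[OF zH(1) v])
  have C: "compact C" "C \<subseteq> hyp_space" "C \<subseteq> N"
    using closed_hyp_space \<delta>(2) by (auto simp: C_def intro: closed_Int_compact)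
  have "0 < hvol (hyp_space \<inter> ball (q t) \<delta>)"
    using \<open>q t \<in> hyp_space\<close> \<delta>(1) by (intro emeasure_hyp_volume_open_pos openin_open_Int) auto
  also have "\<dots> \<le> hvol C"
    using C(1) by (intro emeasure_mono) (auto simp: C_def borel_compact)
  finally have posC: "0 < hvol C" .
  have "C \<inter> T = {}"
  proof (rule equals0I)
    fix x assume "x \<in> C \<inter> T"
    then have x: "x \<star> e > 0" "w \<star> x > 0" "w2 \<star> x > 0" "x \<in> T" using C(3) by (auto simp: N_def)
    then have "x \<in> K \<or> reflect e x \<in> K" by (simp add: T_def two_point_def)
    then show False
      using w(3)[of x] w'[of "reflect e x"] x minkowski_reflect_right[OF e(1), of w' x]
      by (auto simp: w2_def)
  qed
  \<comment> \<open>\<open>C\<close> lies within distance \<open>\<epsilon>\<close> of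
    \<open>z\<close>, where every inequality valid on \<open>T\<close> holds.\<close>
  have "polar T \<subseteq> polar (T \<union> C)"
    using \<epsilon>(2) C by (auto simp: polar_def N_def subset_iff)
  then have "crossing (T \<union> C) \<subseteq> crossing T"
    by (auto simp: crossing_iff_polar)
  then have "crossing_vol (T \<union> C) \<le> crossing_vol T"
    by (rule emeasure_mono) simp
  also have "\<dots> \<le> crossing_vol K"
    unfolding T_def by (rule emeasure_crossing_two_point[OF e(1)])
  finally have "hvol (T \<union> C) \<le> hvol K"
    by (rule extremal[OF compact_Un[OF T(1) C(1)] Un_least[OF T(2) C(2)]])
  moreover have "hvol (T \<union> C) = hvol T + hvol C"
    using T(1) C(1) \<open>C \<inter> T = {}\<close> by (intro plus_emeasure[symmetric]) (auto simp: borel_compact)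
  moreover have "hvol T = hvol K"
    unfolding T_def by (rule emeasure_two_point[OF e(1) compact_K K_subset])
  moreover have "hvol K < hvol K + hvol C"
    using volume_K_finite posC by (simp add: less_top)
  ultimately show False by simp
qed

lemma contact_diff:
  assumes "contact K z w" "contact K z' w'" "z \<noteq> z'"
  shows "\<exists>k. w - w' = k *\<^sub>R (z - z')"
proof -
  have "w = w' - (2 * (w' \<star> bisector z z')) *\<^sub>R bisector z z'"
    using contact_reflect[OF assms] by (simp add: reflect_def)
  then have "w - w' = (- (2 * (w' \<star> bisector z z')) / sqrt ((z - z') \<star> (z - z'))) *\<^sub>R (z - z')"
    by (simp add: bisector_def)
  then show ?thesis by blast
qed

text \<open>Two contact pairs fix \<open>c\<close> and \<open>a\<close>. They are taken in opposite
  directions \<open>u\<close> and \<open>- u\<close>, whose normals cannot coincide, so that the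
  contact points differ. A third pair with another slope would make three contact points
  collinear.\<close>

lemma contact_affine:
  assumes dim: "DIM('a) \<ge> 2"
  obtains c a z1 w1 z2 w2 where "contact K z1 w1" "contact K z2 w2" "z1 \<noteq> z2"
    "\<And>z w. contact K z w \<Longrightarrow> w = c *\<^sub>R z + a"
proof -
  obtain u :: 'a where u: "norm u = 1" using vector_choose_size[of 1] by auto
  then have u': "norm (- u) = 1" by simp
  have Kne: "K \<noteq> {}" using nonempty by simp
  obtain z1 \<tau>1 where c1: "contact K z1 ((1 / sqrt (1 - \<tau>1\<^sup>2)) *\<^sub>R (u, \<tau>1))" "\<bar>\<tau>1\<bar> < 1"
    using exists_contact[OF compact_K K_subset Kne u] .
  obtain z2 \<tau>2 where c2: "contact K z2 ((1 / sqrt (1 - \<tau>2\<^sup>2)) *\<^sub>R (- u, \<tau>2))" "\<bar>\<tau>2\<bar> < 1"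
    using exists_contact[OF compact_K K_subset Kne u'] .
  define w1 where "w1 = (1 / sqrt (1 - \<tau>1\<^sup>2)) *\<^sub>R (u, \<tau>1)"
  define w2 where "w2 = (1 / sqrt (1 - \<tau>2\<^sup>2)) *\<^sub>R (- u, \<tau>2)"
  have ne: "z1 \<noteq> z2"
  proof
    assume "z1 = z2"
    then have "w1 = w2"
      unfolding w1_def w2_def using c1(1) c2(1) by (metis contact_unique)
    then have "(1 / sqrt (1 - \<tau>1\<^sup>2)) *\<^sub>R u = (1 / sqrt (1 - \<tau>2\<^sup>2)) *\<^sub>R (- u)"
      by (simp add: w1_def w2_def)
    then have "(1 / sqrt (1 - \<tau>1\<^sup>2) + 1 / sqrt (1 - \<tau>2\<^sup>2)) *\<^sub>R u = 0"
      by (simp add: scaleR_add_left)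
    moreover have "1 / sqrt (1 - \<tau>1\<^sup>2) > 0" "1 / sqrt (1 - \<tau>2\<^sup>2) > 0"
      using c1(2) c2(2) by (simp_all add: abs_square_less_1)
    ultimately show False using u by (auto simp del: divide_eq_0_iff)
  qed
  have c1: "contact K z1 w1" and c2: "contact K z2 w2"
    using c1 c2 by (simp_all only: w1_def w2_def)
  obtain c where c: "w1 - w2 = c *\<^sub>R (z1 - z2)"
    using contact_diff[OF c1 c2 ne] by blast
  define a where "a = w1 - c *\<^sub>R z1"
  have w1: "w1 = c *\<^sub>R z1 + a" by (simp add: a_def)
  have w2: "w2 = c *\<^sub>R z2 + a" using c by (simp add: a_def algebra_simps)
  have "w = c *\<^sub>R z + a" if cz: "contact K z w" for z w
  proof (cases "z = z1 \<or> z = z2")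
    case True
    then show ?thesis using contact_unique[OF cz] c1 c2 w1 w2 by metis
  next
    case False
    obtain k1 where k1: "w - w1 = k1 *\<^sub>R (z - z1)" using contact_diff[OF cz c1] False by blast
    obtain k2 where k2: "w - w2 = k2 *\<^sub>R (z - z2)" using contact_diff[OF cz c2] False by blast
    have lin: "(k1 - c) *\<^sub>R (z - z1) = (k2 - c) *\<^sub>R (z - z2)"
    proof -
      have "k1 *\<^sub>R (z - z1) + w1 = k2 *\<^sub>R (z - z2) + w2"
        using k1 k2 by (metis diff_add_cancel)
      then show ?thesis unfolding w1 w2 by (simp add: algebra_simps)
    qed
    show ?thesis
    proof (cases "k1 = c")
      case True
      have "w = (w - w1) + w1" by simp
      also have "\<dots> = k1 *\<^sub>R (z - z1) + w1" by (simp only: k1)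
      also have "\<dots> = c *\<^sub>R z + a" by (simp add: True w1 algebra_simps)
      finally show ?thesis .
    next
      case neq: False
      have "z - z1 = (1 / (k1 - c)) *\<^sub>R ((k1 - c) *\<^sub>R (z - z1))" using neq by simp
      also have "\<dots> = ((k2 - c) / (k1 - c)) *\<^sub>R (z - z2)" unfolding lin by simp
      finally have "z = z1 \<or> z1 = z2"
        using False contact_boundary(2)[OF cz] contact_boundary(2)[OF c1] contact_boundary(2)[OF c2]
        by (intro hyp_space_no_three_collinear) auto
      then show ?thesis using False ne by blast
    qed
  qed
  then show thesis using that c1 c2 ne by blast
qed

text \<open>The centre is \<open>a\<close> rescaled to the hyperboloid. Containment in the ball
  comes from the point of \<open>K\<close> farthest from the centre, which is itself a contact
  point; the inclusion of crossings holds because every half-space containing \<open>K\<close> also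
  contains the ball.\<close>

theorem extremal_ball:
  assumes dim: "DIM('a) \<ge> 2"
  obtains p C where "p \<in> hyp_space" "C > 1" "\<Omega> \<subseteq> hball p C"
    "crossing (hcball p C) \<subseteq> crossing K"
proof -
  have Kne: "K \<noteq> {}" using nonempty by simp
  obtain c a z1 w1 z2 w2 where c12: "contact K z1 w1" "contact K z2 w2" "z1 \<noteq> z2"
    and aff: "\<And>z w. contact K z w \<Longrightarrow> w = c *\<^sub>R z + a"
    by (rule contact_affine[OF dim]) (rule that)
  have az: "a \<star> z = c" and aw: "a \<star> w = 1" if "contact K z w" for z w
  proof -
    have w: "w = c *\<^sub>R z + a" using aff[OF that] .
    have zz: "z \<star> z = -1" using contact_boundary(2)[OF that] by (rule hyp_space_self)
    have "w \<star> z = 0" "w \<star> w = 1" using that by (simp_all add: contact_def)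
    then show "a \<star> z = c" using zz unfolding w by (simp add: minkowski_simps)
    have "w \<star> w = c * (w \<star> z) + a \<star> w"
      by (subst (2) w) (simp add: minkowski_simps minkowski_commute[of w a])
    then show "a \<star> w = 1" using \<open>w \<star> z = 0\<close> \<open>w \<star> w = 1\<close> by simp
  qed
  have ex: "\<exists>z \<tau> k. contact K z (k *\<^sub>R (u, \<tau>)) \<and> k > 0 \<and> \<bar>\<tau>\<bar> < 1 \<and> k * (fst a \<bullet> u - snd a * \<tau>) = 1"
    if u: "norm u = 1" for u
  proof -
    obtain z \<tau> where z: "contact K z ((1 / sqrt (1 - \<tau>\<^sup>2)) *\<^sub>R (u, \<tau>))" "\<bar>\<tau>\<bar> < 1"
      using exists_contact[OF compact_K K_subset Kne u] .
    have pos: "1 / sqrt (1 - \<tau>\<^sup>2) > 0" using z(2) by (simp add: abs_square_less_1)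
    have "1 / sqrt (1 - \<tau>\<^sup>2) * (fst a \<bullet> u - snd a * \<tau>) = 1"
    proof -
      have "a \<star> (u, \<tau>) = fst a \<bullet> u - snd a * \<tau>" by (simp add: minkowski_def)
      then show ?thesis using aw[OF z(1)] unfolding minkowski.scaleR_right by (simp only: real_scaleR_def)
    qed
    then show ?thesis using z pos by blast
  qed
  have sum_nonneg: "\<tau> + \<tau>' \<ge> 0" if "contact K z (k *\<^sub>R (u, \<tau>))" "k > 0" "contact K z' (k' *\<^sub>R (- u, \<tau>'))" "k' > 0"
    for u \<tau> \<tau>' k k' z z'
  proof -
    obtain x where x: "x \<in> \<Omega>" "x \<in> K" using nonempty closure_subset by blast
    have "(k *\<^sub>R (u, \<tau>)) \<star> x \<le> 0" "(k' *\<^sub>R (- u, \<tau>')) \<star> x \<le> 0"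
      using that x(2) by (simp_all add: contact_def polar_def del: scaleR_Pair)
    then have "u \<bullet> fst x \<le> \<tau> * snd x" "- (u \<bullet> fst x) \<le> \<tau>' * snd x"
      using that unfolding minkowski.scaleR_left by (simp_all add: minkowski_def mult_le_0_iff)
    then have "0 \<le> (\<tau> + \<tau>') * snd x" by (simp add: distrib_right)
    moreover have "snd x > 0" using x(2) K_subset hyp_space_snd_pos by blast
    ultimately show ?thesis by (simp add: zero_le_mult_iff)
  qed
  \<comment> \<open>Take opposite directions orthogonal to \<open>fst a\<close>. Then
    \<open>a \<star> w = 1\<close> gives both slopes the sign opposite to \<open>snd a\<close>, and
    they cannot both be negative, since their sum is nonnegative: the two half-spaces have a common
    point on the upper sheet.\<close>
  have a0: "snd a < 0"
  proof -
    obtain y :: 'a where y: "y \<noteq> 0" "orthogonal (fst a) y"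
      using orthogonal_to_vector_exists[OF dim, of "fst a"] by blast
    define u where "u = sgn y"
    have u: "norm u = 1" "norm (- u) = 1" "fst a \<bullet> u = 0"
      using y by (simp_all add: u_def norm_sgn sgn_div_norm orthogonal_def)
    obtain z \<tau> k where 1: "contact K z (k *\<^sub>R (u, \<tau>))" "k > 0" "k * (fst a \<bullet> u - snd a * \<tau>) = 1"
      using ex[OF u(1)] by blast
    obtain z' \<tau>' k' where 2: "contact K z' (k' *\<^sub>R (- u, \<tau>'))" "k' > 0" "k' * (fst a \<bullet> (- u) - snd a * \<tau>') = 1"
      using ex[OF u(2)] by blast
    have pos: "x > 0" if "k * x = 1" "k > 0" for k x :: real
      using that by (metis zero_less_mult_pos zero_less_one)
    have "snd a * \<tau> < 0" "snd a * \<tau>' < 0"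
      using pos[OF 1(3,2)] pos[OF 2(3,2)] u(3) by simp_all
    moreover have "\<tau> + \<tau>' \<ge> 0" using sum_nonneg[OF 1(1,2) 2(1,2)] .
    ultimately show ?thesis by (auto simp: mult_less_0_iff)
  qed
  \<comment> \<open>The direction opposite to \<open>fst a\<close> makes its contribution to
    \<open>a \<star> w = 1\<close> negative, and the slope there is less than 1.\<close>
  have timelike: "norm (fst a) < - snd a"
  proof (cases "fst a = 0")
    case False
    define u where "u = - sgn (fst a)"
    have u: "norm u = 1" "fst a \<bullet> u = - norm (fst a)"
      using False by (simp_all add: u_def norm_sgn sgn_div_norm dot_square_norm power2_eq_square)
    obtain z \<tau> k where 1: "k > 0" "\<bar>\<tau>\<bar> < 1" "k * (fst a \<bullet> u - snd a * \<tau>) = 1"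
      using ex[OF u(1)] by blast
    then have "fst a \<bullet> u - snd a * \<tau> > 0" by (metis zero_less_mult_pos zero_less_one)
    then have "norm (fst a) < (- snd a) * \<tau>" by (simp add: u(2))
    also have "\<dots> < (- snd a) * 1" using a0 1(2) by (intro mult_strict_left_mono) auto
    finally show ?thesis by simp
  qed (use a0 in simp)
  have aa: "a \<star> a < 0"
    using power_strict_mono[OF timelike, of 2] by (simp add: minkowski_self)
  define s where "s = sqrt (- (a \<star> a))"
  have s: "s > 0" "s * s = - (a \<star> a)" using aa by (simp_all add: s_def)
  \<comment> \<open>The sign is reversed because \<open>snd a\<close> is negative and the centre has
    to lie on the upper sheet.\<close>
  define p where "p = (- 1 / s) *\<^sub>R a"
  have a: "a = - (s *\<^sub>R p)" using s(1) by (simp add: p_def)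
  have p: "p \<in> hyp_space"
  proof -
    have "p \<star> p = (a \<star> a) / (s * s)" by (simp add: p_def minkowski_simps)
    then show ?thesis using s aa a0 by (simp add: hyp_space_def p_def divide_neg_pos)
  qed
  define C where "C = c / s"
  have contact_dist: "- (p \<star> z) = C" if "contact K z w" for z w
    using az[OF that] s(1) by (simp add: a C_def minkowski_simps field_simps)
  have "C \<ge> 1"
    using contact_dist[OF c12(1)] minkowski_le_minus_one(1)[OF p contact_boundary(2)[OF c12(1)]] by simp
  moreover have "C \<noteq> 1"
    using contact_dist[OF c12(1)] contact_dist[OF c12(2)] c12(3)
      minkowski_le_minus_one(2)[OF p contact_boundary(2)[OF c12(1)]]
      minkowski_le_minus_one(2)[OF p contact_boundary(2)[OF c12(2)]] by auto
  ultimately have C: "C > 1" by simp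
  then have cpos: "c > 0" using s(1) by (simp add: C_def zero_less_divide_iff)
  \<comment> \<open>At a point of \<open>K\<close> farthest from \<open>p\<close> the radial
    direction \<open>m x - p\<close> is an outer normal: its product with \<open>y\<close> in
    \<open>K\<close> is \<open>m (x \<star> y) - p \<star> y\<close>, at most
    \<open>- m + m\<close>.\<close>
  have farthest: "contact K x ((1 / sqrt (m\<^sup>2 - 1)) *\<^sub>R (m *\<^sub>R x - p))"
    if x: "x \<in> K" "- (p \<star> x) = m" "m > 1" "\<And>y. y \<in> K \<Longrightarrow> - (p \<star> y) \<le> m" for x m
  proof -
    have xH: "x \<in> hyp_space" using x(1) K_subset by blast
    have px: "p \<star> x = - m" "x \<star> p = - m" using x(2) by (simp_all add: minkowski_commute[of x p])
    have m: "m\<^sup>2 - 1 > 0" using x(3) by (simp add: one_less_power)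
    define k where "k = 1 / sqrt (m\<^sup>2 - 1)"
    have k: "k > 0" "k * k * (m\<^sup>2 - 1) = 1" using m by (simp_all add: k_def)
    have "(m *\<^sub>R x - p) \<star> (m *\<^sub>R x - p) = m\<^sup>2 - 1"
      using hyp_space_self[OF xH] hyp_space_self[OF p] px by (simp add: minkowski_simps power2_eq_square)
    then have "(k *\<^sub>R (m *\<^sub>R x - p)) \<star> (k *\<^sub>R (m *\<^sub>R x - p)) = 1"
      using k(2) unfolding minkowski.scaleR_left[of k] minkowski.scaleR_right[of _ k] by (simp add: mult.assoc)
    moreover have "(m *\<^sub>R x - p) \<star> x = 0"
      using hyp_space_self[OF xH] px by (simp add: minkowski_simps)
    then have "(k *\<^sub>R (m *\<^sub>R x - p)) \<star> x = 0" unfolding minkowski.scaleR_left[of k] by simp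
    moreover have "(k *\<^sub>R (m *\<^sub>R x - p)) \<star> y \<le> 0" if y: "y \<in> K" for y
    proof -
      have "x \<star> y \<le> -1" using minkowski_le_minus_one(1)[OF xH] y K_subset by blast
      then have "m * (x \<star> y) \<le> m * (-1)" using x(3) by (intro mult_left_mono) auto
      then have "(m *\<^sub>R x - p) \<star> y \<le> 0"
        using x(4)[OF y] by (simp add: minkowski_simps)
      then show ?thesis unfolding minkowski.scaleR_left[of k] using k(1) by (simp add: mult_nonneg_nonpos)
    qed
    ultimately show ?thesis using x(1) by (simp add: contact_def polar_def k_def)
  qed
  obtain x0 where x0: "x0 \<in> K" "\<And>y. y \<in> K \<Longrightarrow> - (p \<star> y) \<le> - (p \<star> x0)"
  proof -
    have "continuous_on K (\<lambda>y. - (p \<star> y))" by (intro continuous_intros)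
    then show thesis using continuous_attains_sup[OF compact_K Kne] that by blast
  qed
  have z1K: "z1 \<in> K" using c12(1) by (simp add: contact_def)
  have "- (p \<star> x0) > 1" using x0(2)[OF z1K] contact_dist[OF c12(1)] C by simp
  \<comment> \<open>All contact points lie at the level \<open>C\<close>, hence so does the farthest
    point.\<close>
  then have "- (p \<star> x0) = C"
    using contact_dist[OF farthest[OF x0(1) refl _ x0(2)]] by simp
  then have K_le: "- (p \<star> y) \<le> C" if "y \<in> K" for y using x0(2)[OF that] by simp
  have \<Omega>_ball: "\<Omega> \<subseteq> hball p C"
  proof
    fix x assume x: "x \<in> \<Omega>"
    then have xK: "x \<in> K" using closure_subset by blast
    have "- (p \<star> x) \<noteq> C"
      using contact_not_mem[OF farthest[OF xK _ C K_le]] x by blast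
    then show "x \<in> hball p C" using K_le[OF xK] x \<Omega>_subset by (auto simp: hball_def)
  qed
  \<comment> \<open>In the direction of \<open>w\<close> the contact hyperplane with slope
    \<open>\<tau>\<close> supports the ball as well, since
    \<open>c (z \<star> x) - s (p \<star> x) \<le> - c + s C = 0\<close>. The slope of
    \<open>w\<close> is at least \<open>\<tau>\<close>, which only enlarges the half-space.\<close>
  have polar_ball: "w \<in> polar (hcball p C)" if w: "\<bar>snd w\<bar> < norm (fst w)" "w \<in> polar K" for w
  proof -
    define b where "b = norm (fst w)"
    have b: "b > 0" unfolding b_def by (rule le_less_trans[OF abs_ge_zero w(1)])
    define u where "u = (1 / b) *\<^sub>R fst w"
    define t where "t = snd w / b"
    have u: "norm u = 1" using b by (simp add: u_def b_def)
    have wb: "w = b *\<^sub>R (u, t)" using b by (simp add: u_def t_def prod_eq_iff)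
    obtain z \<tau> k where z: "contact K z (k *\<^sub>R (u, \<tau>))" "k > 0"
      using ex[OF u] by blast
    have mk: "(u, t) \<star> x = (u, \<tau>) \<star> x - (t - \<tau>) * snd x" for x
      by (simp add: minkowski_def algebra_simps)
    have zK: "z \<in> K" "z \<in> hyp_space" using z(1) contact_boundary(2)[OF z(1)] by (simp_all add: contact_def)
    have "(k *\<^sub>R (u, \<tau>)) \<star> z = 0" using z(1) by (simp add: contact_def)
    then have "(u, \<tau>) \<star> z = 0" using z(2) unfolding minkowski.scaleR_left by simp
    moreover have "(b *\<^sub>R (u, t)) \<star> z \<le> 0" using w(2) zK(1) unfolding wb polar_def by blast
    then have "(u, t) \<star> z \<le> 0" using b unfolding minkowski.scaleR_left by (simp add: mult_le_0_iff)
    ultimately have "(t - \<tau>) * snd z \<ge> 0" using mk[of z] by simp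
    then have t\<tau>: "t \<ge> \<tau>" using hyp_space_snd_pos[OF zK(2)] by (simp add: zero_le_mult_iff)
    show ?thesis
      unfolding polar_def
    proof (intro CollectI ballI)
      fix x assume x: "x \<in> hcball p C"
      then have xH: "x \<in> hyp_space" and px: "- (p \<star> x) \<le> C" by (auto simp: hcball_def)
      have "(k *\<^sub>R (u, \<tau>)) \<star> x = c * (z \<star> x) + s * (- (p \<star> x))"
        unfolding aff[OF z(1)] by (simp add: a minkowski_simps)
      also have "\<dots> \<le> c * (-1) + s * C"
        using minkowski_le_minus_one(1)[OF zK(2) xH] px cpos s(1)
        by (intro add_mono mult_left_mono) auto
      also have "\<dots> = 0" using s(1) by (simp add: C_def)
      finally have "(u, \<tau>) \<star> x \<le> 0" using z(2) unfolding minkowski.scaleR_left by (simp add: mult_le_0_iff)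
      moreover have "(t - \<tau>) * snd x \<ge> 0" using t\<tau> hyp_space_snd_pos[OF xH] by simp
      ultimately have "(u, t) \<star> x \<le> 0" using mk[of x] by simp
      then show "w \<star> x \<le> 0" unfolding wb minkowski.scaleR_left using b by (simp add: mult_nonneg_nonpos)
    qed
  qed
  have "crossing (hcball p C) \<subseteq> crossing K"
  proof
    fix w assume w: "w \<in> crossing (hcball p C)"
    then have sp: "\<bar>snd w\<bar> < norm (fst w)" "\<bar>snd (- w)\<bar> < norm (fst (- w))"
      using crossing_spacelike[OF hball_subset(2) w] by simp_all
    show "w \<in> crossing K"
      using w polar_ball[OF sp(1)] polar_ball[OF sp(2)] by (auto simp: crossing_iff_polar)
  qed
  then show thesis using that p C \<Omega>_ball by blast
qed

end

text \<open>A gap would contain a nonempty open set, either around a missed point off the closure or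
  in the exterior near a missed boundary point. Its positive volume would contradict the comparison
  of volumes.\<close>

lemma eq_hball_of_volume:
  assumes \<Omega>: "openin (top_of_set hyp_space) \<Omega>" "smooth_boundary \<Omega>" "\<Omega> \<subseteq> hball p c"
    and vol: "hvol (hball p c) \<le> hvol \<Omega>"
    and fin: "hvol \<Omega> < top"
  shows "\<Omega> = hball p c"
proof (rule ccontr)
  assume "\<Omega> \<noteq> hball p c"
  then obtain x where x: "x \<in> hball p c" "x \<notin> \<Omega>" using \<Omega>(3) by blast
  have no_gap: False if G: "openin (top_of_set hyp_space) G" "G \<noteq> {}" "G \<subseteq> hball p c" "G \<inter> \<Omega> = {}" for G
  proof -
    have borel: "A \<in> sets borel" if "openin (top_of_set hyp_space) A" for A :: "('a \<times> real) set"
      using that borel_closed[OF closed_hyp_space] by (auto simp: openin_open)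
    have "hvol \<Omega> < hvol \<Omega> + hvol G"
      using emeasure_hyp_volume_open_pos[OF G(1,2)] fin by (simp add: less_top)
    also have "\<dots> = hvol (\<Omega> \<union> G)"
      using G(1,4) \<Omega>(1) borel by (intro plus_emeasure) auto
    also have "\<dots> \<le> hvol (hball p c)"
      using G(3) \<Omega>(3) by (intro emeasure_mono) auto
    finally show False using vol by simp
  qed
  obtain U where U: "open U" "hball p c = hyp_space \<inter> U"
    using openin_hball[of p c] by (auto simp: openin_open)
  have "x \<in> closure \<Omega>"
  proof (rule ccontr)
    assume nx: "x \<notin> closure \<Omega>"
    have "openin (top_of_set hyp_space) (hyp_space \<inter> (U - closure \<Omega>))"
      using U(1) by (intro openin_open_Int open_Diff) auto
    moreover have "hyp_space \<inter> (U - closure \<Omega>) \<inter> \<Omega> = {}" using closure_subset[of \<Omega>] by blast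
    moreover have "x \<in> hyp_space \<inter> (U - closure \<Omega>)" using x nx U(2) by blast
    ultimately show False using U(2) by (intro no_gap[of "hyp_space \<inter> (U - closure \<Omega>)"]) auto
  qed
  then have "x \<in> hyp_boundary \<Omega>" "x \<in> hyp_space" "x \<in> U"
    using x U(2) by (auto simp: hyp_boundary_eq[OF \<Omega>(1)])
  then obtain G where G: "openin (top_of_set hyp_space) G" "G \<noteq> {}" "G \<subseteq> U" "G \<inter> \<Omega> = {}"
    using smooth_boundary_exterior[OF \<Omega>(2)] U(1) by blast
  have "G \<subseteq> hball p c" using G(3) openin_imp_subset[OF G(1)] U(2) by blast
  then show False using no_gap[OF G(1,2) _ G(4)] by blast
qed

lemma hyp_bounded_snd:
  assumes "hyp_bounded \<Omega>" "\<Omega> \<subseteq> hyp_space"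
  obtains R where "\<And>x. x \<in> \<Omega> \<Longrightarrow> snd x \<le> R"
proof -
  obtain p r where p: "p \<in> hyp_space" and r: "\<And>q. q \<in> \<Omega> \<Longrightarrow> hyp_dist p q \<le> r"
    using assms(1) by (auto simp: hyp_bounded_def)
  \<comment> \<open>The maximum covers a negative \<open>r\<close>, possible for empty
    \<open>\<Omega>\<close>, as \<open>cosh\<close> is increasing only on the nonnegative
    half-line.\<close>
  define c where "c = cosh (max 0 r)"
  have "x \<in> hcball p c" if x: "x \<in> \<Omega>" for x
  proof -
    have xH: "x \<in> hyp_space" using x assms(2) by blast
    have ge: "- (p \<star> x) \<ge> 1" using minkowski_le_minus_one(1)[OF p xH] by simp
    have "arcosh (- (p \<star> x)) \<le> max 0 r" using r[OF x] by (simp add: hyp_dist_def)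
    then have "cosh (arcosh (- (p \<star> x))) \<le> cosh (max 0 r)"
      using ge by (subst cosh_real_nonneg_le_iff) auto
    then show ?thesis using ge xH by (simp add: hcball_def c_def)
  qed
  then show thesis using hcball_snd_bounded[OF p] that by blast
qed

section \<open>The profile function of balls\<close>

definition ball_volume :: "'a::euclidean_space itself \<Rightarrow> real \<Rightarrow> real" where
  "ball_volume _ c = measure hyp_volume_measure (hcball (0::'a, 1) c)"

definition ball_crossing :: "'a::euclidean_space itself \<Rightarrow> real \<Rightarrow> real" where
  "ball_crossing _ c = measure dual_measure (crossing (hcball (0::'a, 1) c))"

lemma ball_volume_nonneg [simp]: "ball_volume TYPE('a::euclidean_space) c \<ge> 0"
  by (simp add: ball_volume_def)

lemma ball_crossing_nonneg [simp]: "ball_crossing TYPE('a::euclidean_space) c \<ge> 0"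
  by (simp add: ball_crossing_def)

lemma emeasure_hcball_origin:
  "hvol (hcball (0::'a::euclidean_space, 1) c) = ennreal (ball_volume TYPE('a) c)"
proof -
  have "hvol (hcball (0::'a, 1) c) < top"
    by (rule emeasure_hyp_volume_finite[OF hball_borel(2) hball_subset(2), of _ _ c]) (simp add: hcball_origin)
  then show ?thesis by (simp add: ball_volume_def emeasure_eq_ennreal_measure less_top)
qed

lemma emeasure_crossing_hcball_origin:
  "crossing_vol (hcball (0::'a::euclidean_space, 1) c) = ennreal (ball_crossing TYPE('a) c)"
proof -
  have "crossing_vol (hcball (0::'a, 1) c) < top"
    by (rule emeasure_dual_crossing_finite[OF hball_subset(2), of _ _ c]) (simp add: hcball_origin)
  then show ?thesis by (simp add: ball_crossing_def emeasure_eq_ennreal_measure less_top)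
qed

lemma ball_volume_less: "1 \<le> c \<Longrightarrow> c < c' \<Longrightarrow> ball_volume TYPE('a::euclidean_space) c < ball_volume TYPE('a) c'"
  using emeasure_hcball_strict_mono[where 'a = 'a, of c c']
  by (simp add: emeasure_hcball_origin ennreal_less_iff)

lemma ball_crossing_less: "1 \<le> c \<Longrightarrow> c < c' \<Longrightarrow> ball_crossing TYPE('a::euclidean_space) c < ball_crossing TYPE('a) c'"
  using emeasure_crossing_hcball_strict_mono[where 'a = 'a, of c c']
  by (simp add: emeasure_crossing_hcball_origin ennreal_less_iff)

lemma ball_volume_inj: "1 \<le> c \<Longrightarrow> 1 \<le> c' \<Longrightarrow> ball_volume TYPE('a::euclidean_space) c = ball_volume TYPE('a) c' \<Longrightarrow> c = c'"
  using ball_volume_less[where 'a = 'a, of c c'] ball_volume_less[where 'a = 'a, of c' c] by (metis less_irrefl linorder_neqE_linordered_idom)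

text \<open>The degenerate ball supplies the volume 0, so the profile can be defined on all of
  \<open>{0..}\<close>.\<close>

lemma ball_volume_one: "ball_volume TYPE('a::euclidean_space) 1 = 0"
proof -
  have "hball (0::'a, 1) 1 = {}"
    by (auto simp: hball_def minkowski_origin hyp_space_iff not_less)
  then have "hvol (hcball (0::'a, 1) 1) = 0"
    using emeasure_hball_eq_hcball[of "(0::'a, 1)" 1] by simp
  then show ?thesis by (simp add: ball_volume_def measure_def)
qed

lemma ball_volume_surj:
  assumes "DIM('a::euclidean_space) \<ge> 2" "v \<ge> 0"
  shows "\<exists>c\<ge>1. ball_volume TYPE('a) c = v"
proof (cases "v = 0")
  case False
  then obtain c where c: "c > 1" "hvol (hcball (0::'a, 1) c) = ennreal v"
    using exists_hcball_of_volume[OF assms(1), of v] assms(2) by auto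
  then have "ball_volume TYPE('a) c = v"
    using assms(2) by (simp add: ball_volume_def measure_def)
  then show ?thesis using c(1) less_imp_le by blast
qed (use ball_volume_one in force)

lemma hyp_volume_hball:
  fixes p :: "'a::euclidean_space \<times> real"
  assumes "p \<in> hyp_space" "c \<ge> 1"
  shows "hyp_volume (hball p c) = ball_volume TYPE('a) c"
  using emeasure_hball_eq_hcball[OF assms] emeasure_hcball_center(1)[OF assms(1)]
  by (simp add: hyp_volume_def ball_volume_def measure_def)

lemma quermass_hyperplanes_hball:
  fixes p :: "'a::euclidean_space \<times> real"
  assumes n: "DIM('a) = n + 1" and p: "p \<in> hyp_space" "c > 1"
  shows "quermass_hyperplanes n (hball p c) = real n / 2 * real (n + 1) * ball_crossing TYPE('a) c"
proof -
  have "quermass_hyperplanes n (hball p c) = real n / 2 * real (n + 1) * measure dual_measure (crossing (hball p c))"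
  proof (rule quermass_hyperplanes_eq_dual_measure[OF _ hball_subset(1) _ n])
    show "connected (hball p c)" using p by (intro connected_hball) auto
    show "snd x \<le> c / (snd p - norm (fst p))" if "x \<in> hball p c" for x
      using that hball_subset(3) by (intro hcball_snd_bounded[OF p(1)]) blast
  qed
  moreover have "measure dual_measure (crossing (hball p c)) = ball_crossing TYPE('a) c"
    using emeasure_hcball_center(3)[OF p(1)]
    by (simp add: crossing_hcball[OF p, symmetric] ball_crossing_def measure_def)
  ultimately show ?thesis by simp
qed

text \<open>Volume and crossing measure are both strictly increasing in \<open>c\<close>, and the
  volume takes every nonnegative value. So the crossing measure can be expressed as a strictly
  increasing function of the volume.\<close>

lemma exists_ball_profile:
  assumes "n \<ge> 2" and n: "DIM('a::euclidean_space) = n + 1"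
  shows "\<exists>\<psi>. is_ball_profile TYPE('a) n \<psi>"
proof -
  have dim: "DIM('a) \<ge> 2" using assms by simp
  define c where "c v = (SOME c. c \<ge> 1 \<and> ball_volume TYPE('a) c = v)" for v
  have c: "c v \<ge> 1" "ball_volume TYPE('a) (c v) = v" if "v \<ge> 0" for v
  proof -
    have "c v \<ge> 1 \<and> ball_volume TYPE('a) (c v) = v"
      unfolding c_def by (rule someI_ex[OF ball_volume_surj[OF dim that]])
    then show "c v \<ge> 1" "ball_volume TYPE('a) (c v) = v" by simp_all
  qed
  define \<psi> where "\<psi> v = real n / 2 * real (n + 1) * ball_crossing TYPE('a) (c v)" for v
  have "strict_mono_on {0..} \<psi>"
  proof (rule strict_mono_onI)
    fix v v' :: real assume v: "v \<in> {0..}" "v' \<in> {0..}" "v < v'"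
    have cv: "c v \<ge> 1" "ball_volume TYPE('a) (c v) = v"
      and cv': "c v' \<ge> 1" "ball_volume TYPE('a) (c v') = v'"
      using c v(1,2) by simp_all
    have "c v < c v'"
    proof (rule ccontr)
      assume "\<not> c v < c v'"
      then consider "c v = c v'" | "c v' < c v" by linarith
      then have "v' \<le> v"
      proof cases
        case 1
        then have "v = v'" using cv cv' by metis
        then show ?thesis by simp
      next
        case 2
        then show ?thesis
          using ball_volume_less[where 'a = 'a, OF cv'(1) 2] unfolding cv(2) cv'(2) by simp
      qed
      then show False using v by simp
    qed
    then have "ball_crossing TYPE('a) (c v) < ball_crossing TYPE('a) (c v')"
      by (rule ball_crossing_less[OF cv(1)])
    then show "\<psi> v < \<psi> v'"
      using assms(1) by (simp add: \<psi>_def)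
  qed
  moreover have "\<psi> (hyp_volume B) = quermass_hyperplanes n B" if ball: "is_geodesic_ball B" for B :: "('a \<times> real) set"
  proof -
    obtain p r where B: "p \<in> hyp_space" "r > 1" "B = hball p r"
      using ball unfolding is_geodesic_ball_iff by blast
    have vol: "hyp_volume B = ball_volume TYPE('a) r"
      unfolding B(3) using B by (intro hyp_volume_hball) auto
    have nonneg: "0 \<le> hyp_volume B" by (simp add: hyp_volume_def)
    have "c (hyp_volume B) = r"
    proof (rule ball_volume_inj[where 'a = 'a])
      show "1 \<le> c (hyp_volume B)" by (rule c(1)[OF nonneg])
      show "1 \<le> r" using B(2) by simp
      show "ball_volume TYPE('a) (c (hyp_volume B)) = ball_volume TYPE('a) r"
        by (rule trans[OF c(2)[OF nonneg] vol])
    qed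
    then show ?thesis
      unfolding \<psi>_def B(3) quermass_hyperplanes_hball[OF n B(1,2)] by simp
  qed
  ultimately show ?thesis unfolding is_ball_profile_def by blast
qed

theorem corollary1p3:
  fixes n :: nat
  assumes "n \<ge> 2" and "DIM('a::euclidean_space) = n + 1"
  shows "(\<exists>\<psi>. is_ball_profile TYPE('a) n \<psi>) \<and>
    (\<forall>\<psi>. is_ball_profile TYPE('a) n \<psi> \<longrightarrow>
      (\<forall>\<Omega> :: ('a \<times> real) set.
        hyp_domain \<Omega> \<and> hyp_bounded \<Omega> \<and> smooth_boundary \<Omega> \<and> weakly_convex \<Omega> \<longrightarrow>
          quermass_hyperplanes n \<Omega> \<ge> \<psi> (hyp_volume \<Omega>) \<and>
          (quermass_hyperplanes n \<Omega> = \<psi> (hyp_volume \<Omega>) \<longleftrightarrow> is_geodesic_ball \<Omega>)))"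
proof (intro conjI allI impI)
  show "\<exists>\<psi>. is_ball_profile TYPE('a) n \<psi>" by (rule exists_ball_profile[OF assms])
next
  fix \<psi> and \<Omega> :: "('a \<times> real) set"
  assume \<psi>: "is_ball_profile TYPE('a) n \<psi>"
    and "hyp_domain \<Omega> \<and> hyp_bounded \<Omega> \<and> smooth_boundary \<Omega> \<and> weakly_convex \<Omega>"
  then have op: "openin (top_of_set hyp_space) \<Omega>" and "connected \<Omega>" and ne: "\<Omega> \<noteq> {}"
    and bdd: "hyp_bounded \<Omega>" and smooth: "smooth_boundary \<Omega>"
    by (auto simp: hyp_domain_def)
  have dim: "DIM('a) \<ge> 2" using assms by simp
  have \<Omega>H: "\<Omega> \<subseteq> hyp_space" by (rule openin_imp_subset[OF op])
  obtain R where R: "\<And>x. x \<in> \<Omega> \<Longrightarrow> snd x \<le> R" by (rule hyp_bounded_snd[OF bdd \<Omega>H]) (rule that)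
  have \<Omega>_borel: "\<Omega> \<in> sets borel"
    using op borel_closed[OF closed_hyp_space] by (auto simp: openin_open)
  define K where "K = closure \<Omega>"
  have K: "K \<subseteq> hyp_space" unfolding K_def by (rule closure_minimal[OF \<Omega>H closed_hyp_space])
  have "K \<subseteq> {x. snd x \<le> R}"
    unfolding K_def by (intro closure_minimal closed_Collect_le continuous_intros) (use R in blast)
  then have "compact K"
    using K by (intro compact_subset_hyp_space) (auto simp: K_def)
  define V where "V = hyp_volume \<Omega>"
  have fin: "hvol \<Omega> < top" by (rule emeasure_hyp_volume_finite[OF \<Omega>_borel \<Omega>H R])
  then have V: "hvol \<Omega> = ennreal V"
    by (simp add: V_def hyp_volume_def emeasure_eq_ennreal_measure less_top)
  have "V > 0"
    using emeasure_hyp_volume_open_pos[OF op ne] unfolding V by simp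
  then obtain c where c: "c > 1" "hvol (hcball (0::'a, 1) c) = ennreal V"
    using exists_hcball_of_volume[OF dim] by blast
  then have cV: "ball_volume TYPE('a) c = V"
    using \<open>V > 0\<close> by (simp add: ball_volume_def measure_def)
  define \<kappa> where "\<kappa> = real n / 2 * real (n + 1)"
  have "\<kappa> > 0" using assms(1) by (simp add: \<kappa>_def)
  have \<psi>V: "\<psi> (hyp_volume \<Omega>) = \<kappa> * ball_crossing TYPE('a) c"
  proof -
    have "is_geodesic_ball (hball (0::'a, 1) c)" unfolding is_geodesic_ball_iff using c(1) hyp_space_origin by blast
    then have "\<psi> (hyp_volume (hball (0::'a, 1) c)) = quermass_hyperplanes n (hball (0::'a, 1) c)"
      using \<psi> by (simp add: is_ball_profile_def)
    then show ?thesis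
      using c(1) quermass_hyperplanes_hball[OF assms(2) hyp_space_origin c(1)]
      by (simp add: hyp_volume_hball cV \<kappa>_def V_def)
  qed
  have A: "quermass_hyperplanes n \<Omega> = \<kappa> * measure dual_measure (crossing \<Omega>)"
    unfolding \<kappa>_def by (rule quermass_hyperplanes_eq_dual_measure[OF \<open>connected \<Omega>\<close> \<Omega>H R assms(2)])
  have crossK: "crossing K = crossing \<Omega>" by (simp add: K_def crossing_closure)
  have "crossing_vol \<Omega> < top" by (rule emeasure_dual_crossing_finite[OF \<Omega>H R])
  then have mcross: "crossing_vol \<Omega> = ennreal (measure dual_measure (crossing \<Omega>))"
    by (simp add: emeasure_eq_ennreal_measure less_top)
  have VK: "ennreal V \<le> hvol K"
    unfolding V[symmetric] K_def by (intro emeasure_mono closure_subset) simp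
  have "crossing_vol (hcball (0::'a, 1) c) \<le> crossing_vol K"
    by (rule emeasure_crossing_hcball_le[OF \<open>compact K\<close> K c(1)]) (simp add: c(2) VK)
  then have le: "ball_crossing TYPE('a) c \<le> measure dual_measure (crossing \<Omega>)"
    unfolding crossK mcross emeasure_crossing_hcball_origin by (simp add: ennreal_le_iff)
  then show "\<psi> (hyp_volume \<Omega>) \<le> quermass_hyperplanes n \<Omega>"
    unfolding A \<psi>V using \<open>\<kappa> > 0\<close> by simp
  show "quermass_hyperplanes n \<Omega> = \<psi> (hyp_volume \<Omega>) \<longleftrightarrow> is_geodesic_ball \<Omega>"
  proof
    assume "is_geodesic_ball \<Omega>"
    then show "quermass_hyperplanes n \<Omega> = \<psi> (hyp_volume \<Omega>)"
      using \<psi> by (simp add: is_ball_profile_def)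
  next
    assume "quermass_hyperplanes n \<Omega> = \<psi> (hyp_volume \<Omega>)"
    then have "measure dual_measure (crossing \<Omega>) = ball_crossing TYPE('a) c"
      using \<open>\<kappa> > 0\<close> by (simp add: A \<psi>V)
    then have eq: "crossing_vol K = crossing_vol (hcball (0::'a, 1) c)"
      by (simp add: crossK mcross emeasure_crossing_hcball_origin)
    \<comment> \<open>In the case of equality the ball of volume \<open>V\<close> has the crossing
      measure of \<open>K\<close>, so no set with at most this measure exceeds the volume
      \<open>V\<close>.\<close>
    have small: "hvol L \<le> ennreal V"
      if "compact L" "L \<subseteq> hyp_space" "crossing_vol L \<le> crossing_vol K"
      for L :: "('a \<times> real) set"
      using emeasure_le_hcball_of_crossing_le[OF dim that(1,2), of c] that(3) c by (simp add: eq)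
    interpret extremal_domain \<Omega> R
    proof
      show "hvol L \<le> hvol (closure \<Omega>)"
        if "compact L" "L \<subseteq> hyp_space"
          "crossing_vol L \<le> crossing_vol (closure \<Omega>)"
        for L :: "('a \<times> real) set"
        using order_trans[OF small VK] that by (simp add: K_def)
    qed (use op ne R smooth in auto)
    obtain p C where p: "p \<in> hyp_space" "C > 1" "\<Omega> \<subseteq> hball p C" "crossing (hcball p C) \<subseteq> crossing (closure \<Omega>)"
      by (rule extremal_ball[OF dim])
    \<comment> \<open>The enclosing ball has no more crossings than \<open>K\<close>, so its volume
      is at most that of the domain inside it.\<close>
    have "hvol (hcball p C) \<le> ennreal V"
    proof (rule small[OF compact_hcball[OF p(1)] hball_subset(2)])
      show "crossing_vol (hcball p C) \<le> crossing_vol K"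
        using p(4) by (intro emeasure_mono) (simp_all add: K_def)
    qed
    then have "hvol (hball p C) \<le> hvol \<Omega>"
      using p(1,2) by (simp add: V emeasure_hball_eq_hcball)
    then have "\<Omega> = hball p C" by (rule eq_hball_of_volume[OF op smooth p(3) _ fin])
    then show "is_geodesic_ball \<Omega>" unfolding is_geodesic_ball_iff using p by blast
  qed
qed

end
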